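(* Let $\alpha>0$ and $0<r_0<\alpha/\sqrt3$. Consider the collapsing cylindrical dust interior $$ds^{2-}=-dt^2+dr^2+\left(1-\frac{t^2+r^2}{\alpha^2}\right)^2dz^2+r^2d\phi^2,\qquad 0\le r\le r_0,\quad t\ge0,\quad t^2+r^2<\alpha^2,$$ with timelike boundary $S$ at $r=r_0$. This interior can be matched across $S$ to a vacuum exterior of the form $$ds^{2+}=e^{2(\gamma-\psi)}(-dT^2+d\rho^2)+R^2e^{-2\psi}d\tilde\varphi^2+e^{2\psi}d\tilde z^2,$$ with $\psi,\gamma,R$ functions of $(T,\rho)$, within the domain of dependence $\mathcal{D}$ of $S$. Given the interior metric, the data for the exterior at $S$ (located at $\rho=\rho_0$, $T=\lambda$, with $0\le\lambda<\sqrt{\alpha^2-r_0^2}$) is $$\gamma=\psi=\ln\left(1-\frac{\lambda^2+r_0^2}{\alpha^2}\right),\qquad R=r_0\left(1-\frac{\lambda^2+r_0^2}{\alpha^2}\right),$$ $$\gamma_{,\rho}=\psi_{,\rho}=-\frac{2r_0}{\alpha^2}\left(1-\frac{\lambda^2+r_0^2}{\alpha^2}\right)^{-1},\qquad R_{,\rho}=1-\frac{\lambda^2+3r_0^2}{\alpha^2},\qquad \gamma_{,T}=\psi_{,T},$$ and the exterior metric, i.e. the solution $(\psi,\gamma,R)$ with these data of the vacuum Einstein equations $$\gamma_{,TT}-\gamma_{,\rho\rho}-\psi_{,\rho}^2+\psi_{,T}^2=0,\qquad R_{,TT}-R_{,\rho\rho}=0,$$ $$\psi_{,TT}+\frac{R_{,T}}{R}\psi_{,T}-\psi_{,\rho\rho}-\frac{R_{,\rho}}{R}\psi_{,\rho}=0,$$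 together with the constraint equations $$(R_{,\rho}^2-R_{,T}^2)\,\gamma_{,\rho}=RR_{,\rho}(\psi_{,T}^2+\psi_{,\rho}^2)-2RR_{,T}\psi_{,T}\psi_{,\rho}+R_{,\rho}R_{,\rho\rho}-R_{,T}R_{,T\rho},$$ $$(R_{,T}^2-R_{,\rho}^2)\,\gamma_{,T}=RR_{,T}(\psi_{,T}^2+\psi_{,\rho}^2)-2RR_{,\rho}\psi_{,T}\psi_{,\rho}+R_{,T}R_{,\rho\rho}-R_{,\rho}R_{,T\rho},$$ exists within $\mathcal{D}$ and is unique.
   Context: Commas denote partial derivatives. The interior metric is a solution of the Einstein equations with dust source and $\Lambda=0$ (the Senovilla-Vera metric), whose curvature singularity is at $t^2+r^2=\alpha^2$. Matching: two spacetimes with boundary are matched across $S$ when their boundaries $S^-$ (interior) and $S^+$ (exterior) are identified to a single hypersurface $S$ so that the first fundamental forms (induced metrics) and the second fundamental forms (extrinsic curvatures) computed from both sides agree. Here $S$ has coordinates $(\lambda,\xi,\varphi)$, and the embeddings are: from the interior, $t=\lambda$, $r=r_0$, $\phi=\varphi$, $z=\xi$; from the exterior, $T=\lambda$, $\rho=\rho_0$, $\tilde\varphi=\varphi$, $\tilde z=\xi$, where $\rho_0$ is a constant. (The form of the exterior metric is preserved by $x\to f(x)$, $y\to g(y)$ with $x=T+\rho$, $y=T-\rho$; this freedom has been used to put the exterior boundary at $\dot T=1$, $\dot\rho=0$.) The exterior lies on the side $\rho\ge\rho_0$. Domain of dependence: in the quotient $(T,\rho)$-space of the exterior by the symmetries,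 the data is given on the curve $\{\rho=\rho_0,\ 0\le T<\sqrt{\alpha^2-r_0^2}\}$. Its domain of dependence $\mathcal{D}$ is the set of points with $\rho\ge\rho_0$ for which both characteristics $T+\rho=\mathrm{const}$ and $T-\rho=\mathrm{const}$ through the point meet this curve, i.e. $$\mathcal{D}=\{(T,\rho):\ \rho\ge\rho_0,\ T-\rho\ge-\rho_0,\ T+\rho<\sqrt{\alpha^2-r_0^2}+\rho_0\}.$$ *)

theory Defs
  imports "HOL-Analysis.Analysis"
begin

section \<open>Calculus on regions with boundary\<close>

text \<open>
  All derivatives are Frechet derivatives within the region \<open>M\<close>, hence one-sided at the
  boundary points that belong to \<open>M\<close>. The regions used below are convex with nonempty interior, so
  that these derivatives are unique. (A limit along the coordinate axis only would not do: the
  corner \<open>T = 0\<close>, \<open>\<rho> = \<rho>\<^sub>0\<close> of the domain of dependence cannot be approached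
  in the direction of \<open>\<rho>\<close>.)
\<close>

definition partial ::
    "'a::euclidean_space set \<Rightarrow> 'a \<Rightarrow> ('a \<Rightarrow> real) \<Rightarrow> 'a \<Rightarrow> real" where
  "partial M e f x = frechet_derivative f (at x within M) e"

definition C2_on :: "'a::euclidean_space set \<Rightarrow> ('a \<Rightarrow> real) \<Rightarrow> bool" where
  "C2_on M f \<longleftrightarrow>
     f differentiable_on M \<and>
     (\<forall>e\<in>Basis. partial M e f differentiable_on M) \<and>
     (\<forall>e\<in>Basis. \<forall>e'\<in>Basis. continuous_on M (partial M e' (partial M e f)))"


section \<open>Metrics, curvature and matching in coordinates\<close>

type_synonym metric = "real^4 \<Rightarrow> real^4^4"

definition diag4 :: "real \<Rightarrow> real \<Rightarrow> real \<Rightarrow> real \<Rightarrow> real^4^4" where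
  "diag4 a b c d = (\<chi> i j. if i = j then vector [a, b, c, d] $ i else 0)"

definition christoffel ::
    "(real^4) set \<Rightarrow> metric \<Rightarrow> 4 \<Rightarrow> 4 \<Rightarrow> 4 \<Rightarrow> real^4 \<Rightarrow> real" where
  "christoffel M g i j k x =
     (1/2) * (\<Sum>l\<in>UNIV. matrix_inv (g x) $ i $ l *
       (partial M (axis j 1) (\<lambda>y. g y $ l $ k) x
        + partial M (axis k 1) (\<lambda>y. g y $ l $ j) x
        - partial M (axis l 1) (\<lambda>y. g y $ j $ k) x))"

definition ricci ::
    "(real^4) set \<Rightarrow> metric \<Rightarrow> 4 \<Rightarrow> 4 \<Rightarrow> real^4 \<Rightarrow> real" where
  "ricci M g i j x =
     (\<Sum>k\<in>UNIV. partial M (axis k 1) (christoffel M g k i j) x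
              - partial M (axis j 1) (christoffel M g k i k) x
              + (\<Sum>l\<in>UNIV. christoffel M g k k l x * christoffel M g l i j x
                        - christoffel M g k j l x * christoffel M g l i k x))"

definition vacuum :: "(real^4) set \<Rightarrow> metric \<Rightarrow> bool" where
  "vacuum M g \<longleftrightarrow> (\<forall>x\<in>M. \<forall>i j. ricci M g i j x = 0)"

text \<open>
  A hypersurface is parametrised by \<open>\<Phi>\<close> on a parameter region \<open>W\<close>;
  \<open>tangent W \<Phi> a \<sigma>\<close> is the coordinate tangent vector \<open>\<partial>\<Phi>/\<partial>\<sigma>\<^sup>a\<close>.
\<close>

definition tangent ::
    "(real^3) set \<Rightarrow> (real^3 \<Rightarrow> real^4) \<Rightarrow> 3 \<Rightarrow> real^3 \<Rightarrow> real^4" where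
  "tangent W \<Phi> a \<sigma> = (\<chi> i. partial W (axis a 1) (\<lambda>\<tau>. \<Phi> \<tau> $ i) \<sigma>)"

definition first_form ::
    "metric \<Rightarrow> (real^3) set \<Rightarrow> (real^3 \<Rightarrow> real^4) \<Rightarrow> 3 \<Rightarrow> 3 \<Rightarrow> real^3 \<Rightarrow> real" where
  "first_form g W \<Phi> a b \<sigma> = tangent W \<Phi> a \<sigma> \<bullet> (g (\<Phi> \<sigma>) *v tangent W \<Phi> b \<sigma>)"

definition unit_normal ::
    "metric \<Rightarrow> (real^3) set \<Rightarrow> (real^3 \<Rightarrow> real^4) \<Rightarrow> real^3 \<Rightarrow> real^4 \<Rightarrow> bool" where
  "unit_normal g W \<Phi> \<sigma> n \<longleftrightarrow>
     n \<bullet> (g (\<Phi> \<sigma>) *v n) = 1 \<and> (\<forall>a. n \<bullet> (g (\<Phi> \<sigma>) *v tangent W \<Phi> a \<sigma>) = 0)"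

text \<open>
  The second fundamental form with respect to the normal \<open>n\<close>, with the sign convention
  \<open>K\<^sub>a\<^sub>b = e\<^sub>a\<^sup>i e\<^sub>b\<^sup>j \<nabla>\<^sub>i n\<^sub>j
    = - n\<^sub>i (\<partial>\<^sub>a \<partial>\<^sub>b \<Phi>\<^sup>i + \<Gamma>\<^sup>i\<^sub>j\<^sub>k e\<^sub>a\<^sup>j e\<^sub>b\<^sup>k)\<close>.
\<close>

definition second_form ::
    "(real^4) set \<Rightarrow> metric \<Rightarrow> (real^3) set \<Rightarrow> (real^3 \<Rightarrow> real^4) \<Rightarrow> real^4 \<Rightarrow>
       3 \<Rightarrow> 3 \<Rightarrow> real^3 \<Rightarrow> real" where
  "second_form M g W \<Phi> n a b \<sigma> =
     - (\<Sum>i\<in>UNIV. (g (\<Phi> \<sigma>) *v n) $ i *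
         (partial W (axis a 1) (\<lambda>\<tau>. tangent W \<Phi> b \<tau> $ i) \<sigma>
          + (\<Sum>j\<in>UNIV. \<Sum>k\<in>UNIV. christoffel M g i j k (\<Phi> \<sigma>)
               * tangent W \<Phi> a \<sigma> $ j * tangent W \<Phi> b \<sigma> $ k)))"

text \<open>
  In both spacetimes the second coordinate is the one transverse to the hypersurface, increasing
  from the interior to the exterior. The conditions on \<open>n $ 2\<close> and \<open>m $ 2\<close> orient both
  normals from the interior to the exterior.
\<close>

definition matched ::
    "(real^4) set \<Rightarrow> metric \<Rightarrow> (real^3 \<Rightarrow> real^4) \<Rightarrow>
     (real^4) set \<Rightarrow> metric \<Rightarrow> (real^3 \<Rightarrow> real^4) \<Rightarrow> (real^3) set \<Rightarrow> bool" where
  "matched M\<^sub>1 g\<^sub>1 \<Phi>\<^sub>1 M\<^sub>2 g\<^sub>2 \<Phi>\<^sub>2 W \<longleftrightarrow>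
     (\<forall>\<sigma>\<in>W.
        (\<forall>a b. first_form g\<^sub>1 W \<Phi>\<^sub>1 a b \<sigma> = first_form g\<^sub>2 W \<Phi>\<^sub>2 a b \<sigma>) \<and>
        (\<exists>n m. unit_normal g\<^sub>1 W \<Phi>\<^sub>1 \<sigma> n \<and> n $ 2 > 0 \<and>
               unit_normal g\<^sub>2 W \<Phi>\<^sub>2 \<sigma> m \<and> m $ 2 > 0 \<and>
               (\<forall>a b. second_form M\<^sub>1 g\<^sub>1 W \<Phi>\<^sub>1 n a b \<sigma> = second_form M\<^sub>2 g\<^sub>2 W \<Phi>\<^sub>2 m a b \<sigma>)))"


section \<open>The interior\<close>

text \<open>Coordinates \<open>(t, r, \<phi>, z)\<close>; the angle ranges over the universal cover.\<close>

definition interior_region :: "real \<Rightarrow> real \<Rightarrow> (real^4) set" where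
  "interior_region \<alpha> r\<^sub>0 =
     {x. 0 \<le> x $ 2 \<and> x $ 2 \<le> r\<^sub>0 \<and> 0 \<le> x $ 1 \<and> (x $ 1)\<^sup>2 + (x $ 2)\<^sup>2 < \<alpha>\<^sup>2}"

definition interior_metric :: "real \<Rightarrow> metric" where
  "interior_metric \<alpha> x =
     diag4 (-1) 1 ((x $ 2)\<^sup>2) ((1 - ((x $ 1)\<^sup>2 + (x $ 2)\<^sup>2) / \<alpha>\<^sup>2)\<^sup>2)"


section \<open>The exterior\<close>

definition domain_of_dependence :: "real \<Rightarrow> real \<Rightarrow> real \<Rightarrow> (real \<times> real) set" where
  "domain_of_dependence \<alpha> r\<^sub>0 \<rho>\<^sub>0 =
     {(T, \<rho>). \<rho> \<ge> \<rho>\<^sub>0 \<and> T - \<rho> \<ge> - \<rho>\<^sub>0 \<and> T + \<rho> < sqrt (\<alpha>\<^sup>2 - r\<^sub>0\<^sup>2) + \<rho>\<^sub>0}"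

lemma domain_of_dependence_characteristics:
  "domain_of_dependence \<alpha> r\<^sub>0 \<rho>\<^sub>0 =
     {(T, \<rho>). \<rho> \<ge> \<rho>\<^sub>0 \<and>
        (\<exists>s. 0 \<le> s \<and> s < sqrt (\<alpha>\<^sup>2 - r\<^sub>0\<^sup>2) \<and> T + \<rho> = s + \<rho>\<^sub>0) \<and>
        (\<exists>s. 0 \<le> s \<and> s < sqrt (\<alpha>\<^sup>2 - r\<^sub>0\<^sup>2) \<and> T - \<rho> = s - \<rho>\<^sub>0)}"
proof -
  have "(\<exists>s\<ge>0. s < L \<and> T + \<rho> = s + \<rho>\<^sub>0) \<longleftrightarrow> \<rho>\<^sub>0 \<le> T + \<rho> \<and> T + \<rho> < L + \<rho>\<^sub>0"
    and "(\<exists>s\<ge>0. s < L \<and> T - \<rho> = s - \<rho>\<^sub>0) \<longleftrightarrow> - \<rho>\<^sub>0 \<le> T - \<rho> \<and> T - \<rho> < L - \<rho>\<^sub>0"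
    for T \<rho> L :: real
    by (auto intro: exI[of _ "T + \<rho> - \<rho>\<^sub>0"] exI[of _ "T - \<rho> + \<rho>\<^sub>0"])
  then show ?thesis
    unfolding domain_of_dependence_def by auto
qed

text \<open>Coordinates \<open>(T, \<rho>, \<phi>, z)\<close>, the angle again ranging over the universal cover.\<close>

definition exterior_region :: "real \<Rightarrow> real \<Rightarrow> real \<Rightarrow> (real^4) set" where
  "exterior_region \<alpha> r\<^sub>0 \<rho>\<^sub>0 = {x. (x $ 1, x $ 2) \<in> domain_of_dependence \<alpha> r\<^sub>0 \<rho>\<^sub>0}"

definition exterior_metric ::
    "(real \<times> real \<Rightarrow> real) \<Rightarrow> (real \<times> real \<Rightarrow> real) \<Rightarrow> (real \<times> real \<Rightarrow> real) \<Rightarrow> metric" where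
  "exterior_metric \<psi> \<gamma> R x =
     (let p = (x $ 1, x $ 2) in
      diag4 (- exp (2 * (\<gamma> p - \<psi> p))) (exp (2 * (\<gamma> p - \<psi> p)))
            ((R p)\<^sup>2 * exp (- 2 * \<psi> p)) (exp (2 * \<psi> p)))"

definition field_equations ::
    "(real \<times> real) set \<Rightarrow>
     (real \<times> real \<Rightarrow> real) \<Rightarrow> (real \<times> real \<Rightarrow> real) \<Rightarrow> (real \<times> real \<Rightarrow> real) \<Rightarrow> bool" where
  "field_equations D \<psi> \<gamma> R \<longleftrightarrow>
     (let dT = partial D (1, 0); d\<rho> = partial D (0, 1) in
      \<forall>p\<in>D.
        dT (dT \<gamma>) p - d\<rho> (d\<rho> \<gamma>) p - (d\<rho> \<psi> p)\<^sup>2 + (dT \<psi> p)\<^sup>2 = 0 \<and>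
        dT (dT R) p - d\<rho> (d\<rho> R) p = 0 \<and>
        dT (dT \<psi>) p + dT R p / R p * dT \<psi> p
          - d\<rho> (d\<rho> \<psi>) p - d\<rho> R p / R p * d\<rho> \<psi> p = 0 \<and>
        ((d\<rho> R p)\<^sup>2 - (dT R p)\<^sup>2) * d\<rho> \<gamma> p =
          R p * d\<rho> R p * ((dT \<psi> p)\<^sup>2 + (d\<rho> \<psi> p)\<^sup>2) - 2 * R p * dT R p * dT \<psi> p * d\<rho> \<psi> p
          + d\<rho> R p * d\<rho> (d\<rho> R) p - dT R p * d\<rho> (dT R) p \<and>
        ((dT R p)\<^sup>2 - (d\<rho> R p)\<^sup>2) * dT \<gamma> p =
          R p * dT R p * ((dT \<psi> p)\<^sup>2 + (d\<rho> \<psi> p)\<^sup>2) - 2 * R p * d\<rho> R p * dT \<psi> p * d\<rho> \<psi> p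
          + dT R p * d\<rho> (d\<rho> R) p - d\<rho> R p * d\<rho> (dT R) p)"

definition boundary_data ::
    "real \<Rightarrow> real \<Rightarrow> real \<Rightarrow>
     (real \<times> real \<Rightarrow> real) \<Rightarrow> (real \<times> real \<Rightarrow> real) \<Rightarrow> (real \<times> real \<Rightarrow> real) \<Rightarrow> bool" where
  "boundary_data \<alpha> r\<^sub>0 \<rho>\<^sub>0 \<psi> \<gamma> R \<longleftrightarrow>
     (let D = domain_of_dependence \<alpha> r\<^sub>0 \<rho>\<^sub>0;
          dT = partial D (1, 0); d\<rho> = partial D (0, 1) in
      \<forall>s. 0 \<le> s \<and> s < sqrt (\<alpha>\<^sup>2 - r\<^sub>0\<^sup>2) \<longrightarrow>
        (let p = (s, \<rho>\<^sub>0); u = 1 - (s\<^sup>2 + r\<^sub>0\<^sup>2) / \<alpha>\<^sup>2 in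
          \<gamma> p = \<psi> p \<and> \<psi> p = ln u \<and> R p = r\<^sub>0 * u \<and>
          d\<rho> \<gamma> p = d\<rho> \<psi> p \<and> d\<rho> \<psi> p = - (2 * r\<^sub>0 / \<alpha>\<^sup>2) * inverse u \<and>
          d\<rho> R p = 1 - (s\<^sup>2 + 3 * r\<^sub>0\<^sup>2) / \<alpha>\<^sup>2 \<and>
          dT \<gamma> p = dT \<psi> p))"


section \<open>The matching hypersurface\<close>

text \<open>Parameters \<open>(\<lambda>, \<xi>, \<phi>)\<close>; \<open>cylinder c\<close> is the interior embedding for \<open>c = r\<^sub>0\<close>
  and the exterior embedding for \<open>c = \<rho>\<^sub>0\<close>.\<close>

definition surface_params :: "real \<Rightarrow> real \<Rightarrow> (real^3) set" where
  "surface_params \<alpha> r\<^sub>0 = {\<sigma>. 0 \<le> \<sigma> $ 1 \<and> \<sigma> $ 1 < sqrt (\<alpha>\<^sup>2 - r\<^sub>0\<^sup>2)}"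

definition cylinder :: "real \<Rightarrow> real^3 \<Rightarrow> real^4" where
  "cylinder c \<sigma> = vector [\<sigma> $ 1, c, \<sigma> $ 3, \<sigma> $ 2]"

definition matched_to_exterior ::
    "real \<Rightarrow> real \<Rightarrow> real \<Rightarrow>
     (real \<times> real \<Rightarrow> real) \<Rightarrow> (real \<times> real \<Rightarrow> real) \<Rightarrow> (real \<times> real \<Rightarrow> real) \<Rightarrow> bool" where
  "matched_to_exterior \<alpha> r\<^sub>0 \<rho>\<^sub>0 \<psi> \<gamma> R \<longleftrightarrow>
     matched (interior_region \<alpha> r\<^sub>0) (interior_metric \<alpha>) (cylinder r\<^sub>0)
       (exterior_region \<alpha> r\<^sub>0 \<rho>\<^sub>0) (exterior_metric \<psi> \<gamma> R) (cylinder \<rho>\<^sub>0)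
       (surface_params \<alpha> r\<^sub>0)"

end

theory Submission
  imports Defs
begin

text \<open>
  In the null coordinates \<open>x = T + \<rho> - \<rho>\<^sub>0\<close>, \<open>y = T - \<rho> + \<rho>\<^sub>0\<close> the domain of dependence is the triangle
  \<open>0 \<le> y \<le> x < L\<close> with \<open>L = \<surd>(\<alpha>\<^sup>2 - r\<^sub>0\<^sup>2)\<close>, and the data live on the diagonal. The wave equation
  gives \<open>R = f(x) + g(y)\<close> with explicit cubic polynomials; \<open>r\<^sub>0 < \<alpha>/\<surd>3\<close> makes \<open>g\<close> decreasing, so
  \<open>R(x, y) \<ge> f(x) + g(x) > 0\<close>. The equation for \<open>\<psi>\<close> becomes
  \<open>2 R \<psi>\<^sub>x\<^sub>y + f' \<psi>\<^sub>y + g' \<psi>\<^sub>x = 0\<close>, and \<open>w = \<surd>R \<psi>\<close> solves \<open>w\<^sub>x\<^sub>y = c w\<close>, whose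
  Cauchy problem is solved by Picard iteration. Then \<open>\<gamma>\<^sub>x\<^sub>y = - \<psi>\<^sub>x \<psi>\<^sub>y\<close> gives \<open>\<gamma>\<close> by integration.
  The constraints are \<open>2 f' \<gamma>\<^sub>x = 2 R \<psi>\<^sub>x\<^sup>2 + f''\<close> and \<open>2 g' \<gamma>\<^sub>y = 2 R \<psi>\<^sub>y\<^sup>2 + g''\<close>: the difference
  of the two sides is constant in \<open>y\<close> and in \<open>x\<close> respectively, and vanishes on the diagonal. In this form
  they hold also where \<open>f' = 0\<close>, as the vacuum equations require.
\<close>

section \<open>Continuously differentiable functions on planar regions\<close>

definition C1_grad ::
    "(real \<times> real) set \<Rightarrow> (real \<times> real \<Rightarrow> real) \<Rightarrow> (real \<times> real \<Rightarrow> real) \<Rightarrow> (real \<times> real \<Rightarrow> real) \<Rightarrow> bool" where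
  "C1_grad S f f1 f2 \<longleftrightarrow> continuous_on S f1 \<and> continuous_on S f2 \<and>
     (\<forall>p\<in>S. (f has_derivative (\<lambda>v. f1 p * fst v + f2 p * snd v)) (at p within S))"

definition C1_on :: "(real \<times> real) set \<Rightarrow> (real \<times> real \<Rightarrow> real) \<Rightarrow> bool" where
  "C1_on S f \<longleftrightarrow> (\<exists>f1 f2. C1_grad S f f1 f2)"

definition C2_grad where
  "C2_grad S f f1 f2 f11 f12 f22 \<longleftrightarrow>
     C1_grad S f f1 f2 \<and> C1_grad S f1 f11 f12 \<and> C1_grad S f2 f12 f22"

lemma C1_grad_derivative:
  "C1_grad S f f1 f2 \<Longrightarrow> p \<in> S \<Longrightarrow>
    (f has_derivative (\<lambda>v. f1 p * fst v + f2 p * snd v)) (at p within S)"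
  by (simp add: C1_grad_def)

lemma C1_grad_continuous:
  assumes "C1_grad S f f1 f2"
  shows "continuous_on S f" "continuous_on S f1" "continuous_on S f2"
  using assms unfolding C1_grad_def continuous_on_eq_continuous_within
  by (auto dest: has_derivative_continuous)

lemma C1_grad_subset: "C1_grad S f f1 f2 \<Longrightarrow> S' \<subseteq> S \<Longrightarrow> C1_grad S' f f1 f2"
  unfolding C1_grad_def
  by (auto intro: continuous_on_subset has_derivative_subset)

lemma C1_on_continuous: "C1_on S f \<Longrightarrow> continuous_on S f"
  using C1_grad_continuous unfolding C1_on_def by blast

lemma C1_grad_cong:
  assumes "C1_grad S f f1 f2"
    and "\<And>p. p \<in> S \<Longrightarrow> g p = f p" "\<And>p. p \<in> S \<Longrightarrow> g1 p = f1 p" "\<And>p. p \<in> S \<Longrightarrow> g2 p = f2 p"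
  shows "C1_grad S g g1 g2"
proof -
  have "continuous_on S g1" "continuous_on S g2"
    using C1_grad_continuous(2,3)[OF assms(1)] assms(3,4) by (auto cong: continuous_on_cong)
  moreover have "(g has_derivative (\<lambda>v. g1 p * fst v + g2 p * snd v)) (at p within S)" if "p \<in> S" for p
    using has_derivative_transform[OF that _ C1_grad_derivative[OF assms(1) that], of g] assms(2-4) that
    by simp
  ultimately show ?thesis
    unfolding C1_grad_def by blast
qed

lemma C1_grad_const: "C1_grad S (\<lambda>p. c) (\<lambda>p. 0) (\<lambda>p. 0)"
  by (simp add: C1_grad_def)

lemma C1_grad_fst: "C1_grad S fst (\<lambda>p. 1) (\<lambda>p. 0)"
  by (auto simp: C1_grad_def intro!: derivative_eq_intros)

lemma C1_grad_snd: "C1_grad S snd (\<lambda>p. 0) (\<lambda>p. 1)"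
  by (auto simp: C1_grad_def intro!: derivative_eq_intros)

lemma C1_grad_add:
  assumes "C1_grad S f f1 f2" "C1_grad S g g1 g2"
  shows "C1_grad S (\<lambda>p. f p + g p) (\<lambda>p. f1 p + g1 p) (\<lambda>p. f2 p + g2 p)"
  using assms unfolding C1_grad_def
  by (auto intro!: continuous_intros derivative_eq_intros simp: algebra_simps)

lemma C1_grad_minus:
  assumes "C1_grad S f f1 f2"
  shows "C1_grad S (\<lambda>p. - f p) (\<lambda>p. - f1 p) (\<lambda>p. - f2 p)"
  using assms unfolding C1_grad_def
  by (auto intro!: continuous_intros derivative_eq_intros simp: algebra_simps)

lemma C1_grad_diff:
  assumes "C1_grad S f f1 f2" "C1_grad S g g1 g2"
  shows "C1_grad S (\<lambda>p. f p - g p) (\<lambda>p. f1 p - g1 p) (\<lambda>p. f2 p - g2 p)"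
  using C1_grad_add[OF assms(1) C1_grad_minus[OF assms(2)]] by simp

lemma C1_grad_mult:
  assumes "C1_grad S f f1 f2" "C1_grad S g g1 g2"
  shows "C1_grad S (\<lambda>p. f p * g p) (\<lambda>p. f1 p * g p + f p * g1 p) (\<lambda>p. f2 p * g p + f p * g2 p)"
proof -
  note c = C1_grad_continuous[OF assms(1)] C1_grad_continuous[OF assms(2)]
  have "((\<lambda>p. f p * g p) has_derivative
      (\<lambda>v. (f1 p * g p + f p * g1 p) * fst v + (f2 p * g p + f p * g2 p) * snd v)) (at p within S)"
    if "p \<in> S" for p
    by (rule has_derivative_eq_rhs[OF has_derivative_mult[OF C1_grad_derivative[OF assms(1) that]
          C1_grad_derivative[OF assms(2) that]]]) (auto simp: algebra_simps)
  then show ?thesis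
    unfolding C1_grad_def using c by (auto intro!: continuous_intros)
qed

lemma C1_on_add: "C1_on S f \<Longrightarrow> C1_on S g \<Longrightarrow> C1_on S (\<lambda>p. f p + g p)"
  unfolding C1_on_def by (elim exE) (intro exI, rule C1_grad_add)

lemma C1_on_mult: "C1_on S f \<Longrightarrow> C1_on S g \<Longrightarrow> C1_on S (\<lambda>p. f p * g p)"
  unfolding C1_on_def by (elim exE) (intro exI, rule C1_grad_mult)

lemma C1_grad_compose:
  assumes "C1_grad S f f1 f2" "continuous_on S (\<lambda>p. \<phi>' (f p))"
    and "\<And>p. p \<in> S \<Longrightarrow> (\<phi> has_real_derivative \<phi>' (f p)) (at (f p))"
  shows "C1_grad S (\<lambda>p. \<phi> (f p)) (\<lambda>p. \<phi>' (f p) * f1 p) (\<lambda>p. \<phi>' (f p) * f2 p)"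
proof -
  have "((\<lambda>p. \<phi> (f p)) has_derivative
      (\<lambda>v. \<phi>' (f p) * f1 p * fst v + \<phi>' (f p) * f2 p * snd v)) (at p within S)" if "p \<in> S" for p
    using has_derivative_compose[OF C1_grad_derivative[OF assms(1) that]
        assms(3)[OF that, unfolded has_field_derivative_def]]
    by (auto simp: algebra_simps)
  then show ?thesis
    unfolding C1_grad_def using C1_grad_continuous[OF assms(1)] assms(2)
    by (auto intro!: continuous_intros)
qed

lemma C1_grad_affine:
  assumes f: "C1_grad S f f1 f2"
    and A: "\<And>p. A p = (a + a1 * fst p + a2 * snd p, b + b1 * fst p + b2 * snd p)"
    and S': "\<And>p. p \<in> S' \<Longrightarrow> A p \<in> S"
  shows "C1_grad S' (\<lambda>p. f (A p)) (\<lambda>p. f1 (A p) * a1 + f2 (A p) * b1) (\<lambda>p. f1 (A p) * a2 + f2 (A p) * b2)"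
proof -
  have cA: "continuous_on S' A"
    unfolding A by (intro continuous_intros)
  have AS: "A ` S' \<subseteq> S" using S' by auto
  have dA: "(A has_derivative (\<lambda>v. (a1 * fst v + a2 * snd v, b1 * fst v + b2 * snd v))) (at p within S')" for p
    unfolding A by (auto intro!: derivative_eq_intros)
  have "((\<lambda>p. f (A p)) has_derivative (\<lambda>v. (f1 (A p) * a1 + f2 (A p) * b1) * fst v
      + (f1 (A p) * a2 + f2 (A p) * b2) * snd v)) (at p within S')" if "p \<in> S'" for p
    using has_derivative_in_compose[OF dA has_derivative_subset[OF C1_grad_derivative[OF f S'[OF that]] AS]]
    by (auto simp: algebra_simps)
  moreover have "continuous_on S' (\<lambda>p. f1 (A p))" "continuous_on S' (\<lambda>p. f2 (A p))"
    using C1_grad_continuous(2,3)[OF f] continuous_on_compose2[OF _ cA AS] by auto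
  ultimately show ?thesis
    unfolding C1_grad_def by (auto intro!: continuous_intros)
qed

lemma C1_grad_segment_derivative:
  assumes f: "C1_grad S f f1 f2" and S: "convex S" "p \<in> S" "q \<in> S" and t: "t \<in> {0..1}"
  shows "((\<lambda>t. f (p + t *\<^sub>R (q - p))) has_real_derivative
      f1 (p + t *\<^sub>R (q - p)) * fst (q - p) + f2 (p + t *\<^sub>R (q - p)) * snd (q - p)) (at t within {0..1})"
proof -
  have mem: "p + t *\<^sub>R (q - p) \<in> S" if "t \<in> {0..1}" for t
    using convexD_alt[OF S(1) S(2) S(3), of t] that by (simp add: algebra_simps)
  have d: "((\<lambda>t. p + t *\<^sub>R (q - p)) has_derivative (\<lambda>s. s *\<^sub>R (q - p))) (at t within {0..1})"
    by (auto intro!: derivative_eq_intros)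
  have "(\<lambda>t. p + t *\<^sub>R (q - p)) ` {0..1} \<subseteq> S" using mem by auto
  from has_derivative_in_compose[OF d has_derivative_subset[OF C1_grad_derivative[OF f mem[OF t]] this]]
  show ?thesis
    by (rule has_derivative_imp_has_field_derivative) (simp add: algebra_simps)
qed

lemma C1_grad_segment:
  assumes "C1_grad S f f1 f2" "convex S" "p \<in> S" "q \<in> S"
  shows "((\<lambda>t. f1 (p + t *\<^sub>R (q - p)) * fst (q - p) + f2 (p + t *\<^sub>R (q - p)) * snd (q - p))
      has_integral (f q - f p)) {0..1}"
  using fundamental_theorem_of_calculus[OF _
      C1_grad_segment_derivative[OF assms, unfolded has_real_derivative_iff_has_vector_derivative]]
  by simp

lemma C1_grad_mean:
  fixes a b c d :: "real \<Rightarrow> real"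
  assumes h: "C1_grad S h h1 h2" and S: "convex S"
    and cont: "continuous_on {0..1} a" "continuous_on {0..1} b" "continuous_on {0..1} c" "continuous_on {0..1} d"
    and q: "\<And>t p. q t p = (a t * fst p + b t * snd p, c t * fst p + d t * snd p)"
    and mem: "\<And>t p. t \<in> {0..1} \<Longrightarrow> p \<in> S \<Longrightarrow> q t p \<in> S"
  shows "C1_grad S (\<lambda>p. integral {0..1} (\<lambda>t. h (q t p)))
     (\<lambda>p. integral {0..1} (\<lambda>t. h1 (q t p) * a t + h2 (q t p) * c t))
     (\<lambda>p. integral {0..1} (\<lambda>t. h1 (q t p) * b t + h2 (q t p) * d t))"
proof -
  have cq: "continuous_on (S \<times> {0..1}) (\<lambda>z. q (snd z) (fst z))"
    unfolding q
    by (intro continuous_intros continuous_on_compose2[OF cont(1)] continuous_on_compose2[OF cont(2)]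
        continuous_on_compose2[OF cont(3)] continuous_on_compose2[OF cont(4)]) auto
  have ch: "continuous_on (S \<times> {0..1}) (\<lambda>z. k (q (snd z) (fst z)))" if "continuous_on S k" for k :: "real \<times> real \<Rightarrow> real"
    by (rule continuous_on_compose2[OF that cq]) (use mem in auto)
  have cs: "continuous_on (S \<times> {0..1}) (\<lambda>z. k (snd z))" if "continuous_on {0..1} k" for k :: "real \<Rightarrow> real"
    by (rule continuous_on_compose2[OF that]) (auto intro!: continuous_intros)
  have ch': "continuous_on {0..1} (\<lambda>t. k (q t p))" if "continuous_on S k" "p \<in> S" for k :: "real \<times> real \<Rightarrow> real" and p
  proof -
    have "continuous_on {0..1} (\<lambda>t::real. (p, t))" by (intro continuous_intros)
    from continuous_on_compose2[OF ch[OF that(1)] this] that(2) show ?thesis by auto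
  qed
  note hc = C1_grad_continuous[OF h]
  define F1 where "F1 p t = h1 (q t p) * a t + h2 (q t p) * c t" for p t
  define F2 where "F2 p t = h1 (q t p) * b t + h2 (q t p) * d t" for p t
  have cF1: "continuous_on (S \<times> {0..1}) (\<lambda>(p, t). F1 p t)"
    unfolding F1_def case_prod_beta by (intro continuous_intros ch cs hc cont)
  have cF2: "continuous_on (S \<times> {0..1}) (\<lambda>(p, t). F2 p t)"
    unfolding F2_def case_prod_beta by (intro continuous_intros ch cs hc cont)
  have iF: "F1 p integrable_on {0..1}" "F2 p integrable_on {0..1}" if "p \<in> S" for p
    unfolding F1_def F2_def
    by (auto intro!: integrable_continuous_interval continuous_intros ch' hc cont that)
  define fx :: "real \<times> real \<Rightarrow> real \<Rightarrow> (real \<times> real) \<Rightarrow>\<^sub>L real" where "fx p t = F1 p t *\<^sub>R fst_blinfun + F2 p t *\<^sub>R snd_blinfun" for p t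
  have fx: "blinfun_apply (fx p t) v = F1 p t * fst v + F2 p t * snd v" for p t v
    by (simp add: fx_def blinfun.bilinear_simps)
  have cfx: "continuous_on (S \<times> {0..1}) (\<lambda>(p, t). fx p t)"
    using cF1 cF2 unfolding fx_def case_prod_beta by (intro continuous_intros)
  have der: "((\<lambda>p. h (q t p)) has_derivative blinfun_apply (fx p t)) (at p within S)"
    if "p \<in> S" "t \<in> cbox 0 1" for p t
  proof -
    have "C1_grad S (\<lambda>p. h (q t p)) (\<lambda>p. h1 (q t p) * a t + h2 (q t p) * c t)
        (\<lambda>p. h1 (q t p) * b t + h2 (q t p) * d t)"
      by (rule C1_grad_affine[OF h, where a = 0 and b = 0]) (use that mem q in auto)
    from C1_grad_derivative[OF this that(1)]
    have "((\<lambda>p. h (q t p)) has_derivative (\<lambda>v. F1 p t * fst v + F2 p t * snd v)) (at p within S)"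
      by (simp add: F1_def F2_def)
    moreover have "blinfun_apply (fx p t) = (\<lambda>v. F1 p t * fst v + F2 p t * snd v)"
      by (rule ext) (rule fx)
    ultimately show ?thesis by simp
  qed
  have main: "((\<lambda>p. integral {0..1} (\<lambda>t. h (q t p))) has_derivative
      (\<lambda>v. integral {0..1} (F1 p) * fst v + integral {0..1} (F2 p) * snd v)) (at p within S)" if p: "p \<in> S" for p
  proof -
    have "((\<lambda>p. integral (cbox 0 1) (\<lambda>t. h (q t p))) has_derivative blinfun_apply (integral (cbox 0 1) (fx p))) (at p within S)"
      by (rule leibniz_rule[OF der])
        (use cfx p S ch'[OF hc(1)] in \<open>auto intro!: integrable_continuous_interval\<close>)
    moreover have bl: "blinfun_apply (integral (cbox 0 1) (fx p)) v = integral {0..1} (F1 p) * fst v + integral {0..1} (F2 p) * snd v" for v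
    proof -
      have "fx p integrable_on cbox 0 1"
      proof -
        have "continuous_on {0..1} (\<lambda>t::real. (p, t))" by (intro continuous_intros)
        from continuous_on_compose2[OF cfx this] p show ?thesis
          by (auto intro!: integrable_continuous_interval)
      qed
      from integral_linear[OF this blinfun.bounded_linear_left, of v]
      have "blinfun_apply (integral (cbox 0 1) (fx p)) v = integral {0..1} (\<lambda>t. F1 p t * fst v + F2 p t * snd v)"
        by (simp add: o_def fx)
      also have "\<dots> = integral {0..1} (F1 p) * fst v + integral {0..1} (F2 p) * snd v"
        using iF[OF p]
        by (subst Henstock_Kurzweil_Integration.integral_add[OF integrable_on_mult_left integrable_on_mult_left]) auto
      finally show ?thesis .
    qed
    moreover have "blinfun_apply (integral (cbox 0 1) (fx p)) =
        (\<lambda>v. integral {0..1} (F1 p) * fst v + integral {0..1} (F2 p) * snd v)"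
      by (rule ext) (rule bl)
    ultimately show ?thesis by simp
  qed
  have "continuous_on S (\<lambda>p. integral {0..1} (F1 p))" "continuous_on S (\<lambda>p. integral {0..1} (F2 p))"
    using integral_continuous_on_param[of S 0 1 F1] integral_continuous_on_param[of S 0 1 F2] cF1 cF2 by auto
  with main show ?thesis
    unfolding C1_grad_def F1_def F2_def by blast
qed

section \<open>Integration along characteristics\<close>

definition triangle :: "real \<Rightarrow> (real \<times> real) set" where
  "triangle L = {(x, y). 0 \<le> y \<and> y \<le> x \<and> x < L}"

definition y_int :: "(real \<times> real \<Rightarrow> real) \<Rightarrow> real \<times> real \<Rightarrow> real" where
  "y_int h p = (fst p - snd p) * integral {0..1} (\<lambda>t. h (fst p, t * fst p + (1 - t) * snd p))"

definition x_int :: "(real \<times> real \<Rightarrow> real) \<Rightarrow> real \<times> real \<Rightarrow> real" where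
  "x_int h p = (fst p - snd p) * integral {0..1} (\<lambda>t. h (t * fst p + (1 - t) * snd p, snd p))"

lemma convex_triangle: "convex (triangle L)"
proof -
  have "triangle L = {p. (0, 1) \<bullet> p \<ge> 0} \<inter> {p. (1, -1) \<bullet> p \<ge> 0} \<inter> {p. (1, 0) \<bullet> p < L}"
    by (auto simp: triangle_def)
  then show ?thesis
    by (simp add: convex_Int convex_halfspace_ge convex_halfspace_lt)
qed

lemma triangle_mono: "X \<le> L \<Longrightarrow> triangle X \<subseteq> triangle L"
  by (auto simp: triangle_def)

lemma triangle_diagonal: "(x, y) \<in> triangle L \<Longrightarrow> (x, x) \<in> triangle L \<and> (y, y) \<in> triangle L"
  by (auto simp: triangle_def)

lemma triangle_between:
  assumes "p \<in> triangle L" "t \<in> {0..1}"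
  shows "(fst p, t * fst p + (1 - t) * snd p) \<in> triangle L"
    "(t * fst p + (1 - t) * snd p, snd p) \<in> triangle L"
proof -
  have "(1 - t) * snd p \<le> (1 - t) * fst p" "t * snd p \<le> t * fst p"
    using assms by (auto intro!: mult_left_mono simp: triangle_def)
  moreover have "0 \<le> t * fst p + (1 - t) * snd p"
    using assms by (auto simp: triangle_def)
  ultimately show "(fst p, t * fst p + (1 - t) * snd p) \<in> triangle L"
    "(t * fst p + (1 - t) * snd p, snd p) \<in> triangle L"
    using assms by (auto simp: triangle_def algebra_simps)
qed

lemma y_int_continuous_integrand:
  assumes "continuous_on (triangle L) h" "p \<in> triangle L"
  shows "continuous_on {0..1} (\<lambda>t. h (fst p, t * fst p + (1 - t) * snd p))"
  by (rule continuous_on_compose2[OF assms(1)])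
    (use triangle_between[OF assms(2)] in \<open>auto intro!: continuous_intros\<close>)

lemma x_int_continuous_integrand:
  assumes "continuous_on (triangle L) h" "p \<in> triangle L"
  shows "continuous_on {0..1} (\<lambda>t. h (t * fst p + (1 - t) * snd p, snd p))"
  by (rule continuous_on_compose2[OF assms(1)])
    (use triangle_between[OF assms(2)] in \<open>auto intro!: continuous_intros\<close>)

lemma y_int_grad:
  assumes h: "C1_grad (triangle L) h h1 h2"
  shows "C1_grad (triangle L) (y_int h) (\<lambda>p. h (fst p, fst p) + y_int h1 p) (\<lambda>p. - h p)"
proof -
  let ?S = "triangle L"
  note hc = C1_grad_continuous[OF h]
  define q where "q t p = (fst p, t * fst p + (1 - t) * snd p)" for t :: real and p :: "real \<times> real"
  have M: "C1_grad ?S (\<lambda>p. integral {0..1} (\<lambda>t. h (q t p)))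
     (\<lambda>p. integral {0..1} (\<lambda>t. h1 (q t p) * 1 + h2 (q t p) * t))
     (\<lambda>p. integral {0..1} (\<lambda>t. h1 (q t p) * 0 + h2 (q t p) * (1 - t)))"
    by (rule C1_grad_mean[OF h convex_triangle])
      (auto simp: q_def intro!: continuous_intros triangle_between)
  show ?thesis
  proof (rule C1_grad_cong[OF C1_grad_mult[OF C1_grad_diff[OF C1_grad_fst C1_grad_snd] M]])
    fix p assume p: "p \<in> ?S"
    obtain x y where xy: "p = (x, y)" by (cases p)
    have c: "continuous_on {0..1} (\<lambda>t. h (q t p))" "continuous_on {0..1} (\<lambda>t. h1 (q t p))"
      "continuous_on {0..1} (\<lambda>t. h2 (q t p))"
      unfolding q_def by (rule y_int_continuous_integrand[OF _ p]; use hc in auto)+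
    have i: "(\<lambda>t. h (q t p)) integrable_on {0..1}" "(\<lambda>t. h1 (q t p)) integrable_on {0..1}"
      "(\<lambda>t. h2 (q t p) * t) integrable_on {0..1}" "(\<lambda>t. h2 (q t p) * (1 - t)) integrable_on {0..1}"
      by (auto intro!: integrable_continuous_interval continuous_intros c)
    have d: "((\<lambda>t. h (q t p)) has_real_derivative h2 (q t p) * (x - y)) (at t within {0..1})" if "t \<in> {0..1}" for t
      using C1_grad_segment_derivative[OF h convex_triangle p _ that, of "(x, x)"]
        triangle_diagonal[of x y L] p xy
      by (simp add: q_def algebra_simps)
    have "((\<lambda>t. t * h (q t p)) has_vector_derivative (h (q t p) + h2 (q t p) * t * (x - y))) (at t within {0..1})"
      if "t \<in> {0..1}" for t
      unfolding has_real_derivative_iff_has_vector_derivative[symmetric]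
      by (auto intro!: derivative_eq_intros d that)
    from fundamental_theorem_of_calculus[OF _ this]
    have 1: "integral {0..1} (\<lambda>t. h (q t p) + h2 (q t p) * t * (x - y)) = h (x, x)"
      by (auto simp: q_def xy)
    have "((\<lambda>t. (1 - t) * h (q t p)) has_vector_derivative (- h (q t p) + h2 (q t p) * (1 - t) * (x - y))) (at t within {0..1})"
      if "t \<in> {0..1}" for t
      unfolding has_real_derivative_iff_has_vector_derivative[symmetric]
      by (auto intro!: derivative_eq_intros d that)
    from fundamental_theorem_of_calculus[OF _ this]
    have 2: "integral {0..1} (\<lambda>t. - h (q t p) + h2 (q t p) * (1 - t) * (x - y)) = - h (x, y)"
      by (auto simp: q_def xy)
    show "y_int h p = (fst p - snd p) * integral {0..1} (\<lambda>t. h (q t p))"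
      by (simp add: y_int_def q_def)
    have "integral {0..1} (\<lambda>t. h (q t p)) + integral {0..1} (\<lambda>t. h2 (q t p) * t) * (x - y) = h (x, x)"
      using 1 i by (subst (asm) Henstock_Kurzweil_Integration.integral_add) (auto intro!: integrable_on_mult_left)
    moreover have "integral {0..1} (\<lambda>t. h1 (q t p) * 1 + h2 (q t p) * t) = integral {0..1} (\<lambda>t. h1 (q t p)) + integral {0..1} (\<lambda>t. h2 (q t p) * t)"
      using i by (subst Henstock_Kurzweil_Integration.integral_add) auto
    ultimately show "h (fst p, fst p) + y_int h1 p = (1 - 0) * integral {0..1} (\<lambda>t. h (q t p)) +
         (fst p - snd p) * integral {0..1} (\<lambda>t. h1 (q t p) * 1 + h2 (q t p) * t)"
      by (simp add: y_int_def q_def xy algebra_simps)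
    have "- integral {0..1} (\<lambda>t. h (q t p)) + integral {0..1} (\<lambda>t. h2 (q t p) * (1 - t)) * (x - y) = - h (x, y)"
      using 2 i by (subst (asm) Henstock_Kurzweil_Integration.integral_add) (auto intro!: integrable_on_mult_left integrable_neg)
    then show "- h p = (0 - 1) * integral {0..1} (\<lambda>t. h (q t p)) +
         (fst p - snd p) * integral {0..1} (\<lambda>t. h1 (q t p) * 0 + h2 (q t p) * (1 - t))"
      by (simp add: xy algebra_simps)
  qed
qed

lemma x_int_grad:
  assumes h: "C1_grad (triangle L) h h1 h2"
  shows "C1_grad (triangle L) (x_int h) h (\<lambda>p. - h (snd p, snd p) + x_int h2 p)"
proof -
  let ?S = "triangle L"
  note hc = C1_grad_continuous[OF h]
  define q where "q t p = (t * fst p + (1 - t) * snd p, snd p)" for t :: real and p :: "real \<times> real"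
  have M: "C1_grad ?S (\<lambda>p. integral {0..1} (\<lambda>t. h (q t p)))
     (\<lambda>p. integral {0..1} (\<lambda>t. h1 (q t p) * t + h2 (q t p) * 0))
     (\<lambda>p. integral {0..1} (\<lambda>t. h1 (q t p) * (1 - t) + h2 (q t p) * 1))"
    by (rule C1_grad_mean[OF h convex_triangle])
      (auto simp: q_def intro!: continuous_intros triangle_between)
  show ?thesis
  proof (rule C1_grad_cong[OF C1_grad_mult[OF C1_grad_diff[OF C1_grad_fst C1_grad_snd] M]])
    fix p assume p: "p \<in> ?S"
    obtain x y where xy: "p = (x, y)" by (cases p)
    have c: "continuous_on {0..1} (\<lambda>t. h (q t p))" "continuous_on {0..1} (\<lambda>t. h1 (q t p))"
      "continuous_on {0..1} (\<lambda>t. h2 (q t p))"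
      unfolding q_def by (rule x_int_continuous_integrand[OF _ p]; use hc in auto)+
    have i: "(\<lambda>t. h (q t p)) integrable_on {0..1}" "(\<lambda>t. h2 (q t p)) integrable_on {0..1}"
      "(\<lambda>t. h1 (q t p) * t) integrable_on {0..1}" "(\<lambda>t. h1 (q t p) * (1 - t)) integrable_on {0..1}"
      by (auto intro!: integrable_continuous_interval continuous_intros c)
    have d: "((\<lambda>t. h (q t p)) has_real_derivative h1 (q t p) * (x - y)) (at t within {0..1})" if "t \<in> {0..1}" for t
      using C1_grad_segment_derivative[OF h convex_triangle _ p that, of "(y, y)"]
        triangle_diagonal[of x y L] p xy
      by (simp add: q_def algebra_simps)
    have "((\<lambda>t. t * h (q t p)) has_vector_derivative (h (q t p) + h1 (q t p) * t * (x - y))) (at t within {0..1})"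
      if "t \<in> {0..1}" for t
      unfolding has_real_derivative_iff_has_vector_derivative[symmetric]
      by (auto intro!: derivative_eq_intros d that)
    from fundamental_theorem_of_calculus[OF _ this]
    have 1: "integral {0..1} (\<lambda>t. h (q t p) + h1 (q t p) * t * (x - y)) = h (x, y)"
      by (auto simp: q_def xy)
    have "((\<lambda>t. (1 - t) * h (q t p)) has_vector_derivative (- h (q t p) + h1 (q t p) * (1 - t) * (x - y))) (at t within {0..1})"
      if "t \<in> {0..1}" for t
      unfolding has_real_derivative_iff_has_vector_derivative[symmetric]
      by (auto intro!: derivative_eq_intros d that)
    from fundamental_theorem_of_calculus[OF _ this]
    have 2: "integral {0..1} (\<lambda>t. - h (q t p) + h1 (q t p) * (1 - t) * (x - y)) = - h (y, y)"
      by (auto simp: q_def xy)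
    show "x_int h p = (fst p - snd p) * integral {0..1} (\<lambda>t. h (q t p))"
      by (simp add: x_int_def q_def)
    have "integral {0..1} (\<lambda>t. h (q t p)) + integral {0..1} (\<lambda>t. h1 (q t p) * t) * (x - y) = h (x, y)"
      using 1 i by (subst (asm) Henstock_Kurzweil_Integration.integral_add) (auto intro!: integrable_on_mult_left)
    then show "h p = (1 - 0) * integral {0..1} (\<lambda>t. h (q t p)) +
         (fst p - snd p) * integral {0..1} (\<lambda>t. h1 (q t p) * t + h2 (q t p) * 0)"
      by (simp add: xy algebra_simps)
    have "- integral {0..1} (\<lambda>t. h (q t p)) + integral {0..1} (\<lambda>t. h1 (q t p) * (1 - t)) * (x - y) = - h (y, y)"
      using 2 i by (subst (asm) Henstock_Kurzweil_Integration.integral_add) (auto intro!: integrable_on_mult_left integrable_neg)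
    moreover have "integral {0..1} (\<lambda>t. h1 (q t p) * (1 - t) + h2 (q t p) * 1) = integral {0..1} (\<lambda>t. h1 (q t p) * (1 - t)) + integral {0..1} (\<lambda>t. h2 (q t p))"
      using i by (subst Henstock_Kurzweil_Integration.integral_add) auto
    ultimately show "- h (snd p, snd p) + x_int h2 p = (0 - 1) * integral {0..1} (\<lambda>t. h (q t p)) +
         (fst p - snd p) * integral {0..1} (\<lambda>t. h1 (q t p) * (1 - t) + h2 (q t p) * 1)"
      by (simp add: x_int_def q_def xy algebra_simps)
  qed
qed

lemma exp_integral_bound:
  fixes k d A :: real
  assumes k: "k > 0" and "d \<ge> 0" "A \<ge> 0" and c: "continuous_on {0..1} u"
    and u: "\<And>t. t \<in> {0..1} \<Longrightarrow> \<bar>u t\<bar> \<le> A * exp (k * (d * t))"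
  shows "\<bar>d * integral {0..1} u\<bar> \<le> A / k * exp (k * d)"
proof -
  have "((\<lambda>t. A / k * exp (k * (d * t))) has_vector_derivative d * (A * exp (k * (d * t)))) (at t within {0..1})" for t
    unfolding has_real_derivative_iff_has_vector_derivative[symmetric]
    using k by (auto intro!: derivative_eq_intros)
  from fundamental_theorem_of_calculus[OF _ this]
  have I: "((\<lambda>t. d * (A * exp (k * (d * t)))) has_integral A / k * exp (k * d) - A / k) {0..1}"
    by simp
  have "norm (integral {0..1} (\<lambda>t. d * u t)) \<le> integral {0..1} (\<lambda>t. d * (A * exp (k * (d * t))))"
    by (rule integral_norm_bound_integral)
      (use I u \<open>d \<ge> 0\<close> in \<open>auto intro!: integrable_continuous_interval continuous_intros c mult_left_mono simp: abs_mult\<close>)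
  also have "\<dots> = A / k * exp (k * d) - A / k"
    using I by (rule integral_unique)
  also have "\<dots> \<le> A / k * exp (k * d)"
    using assms by simp
  finally show ?thesis by simp
qed

lemma y_int_bound:
  assumes "k > 0" "A \<ge> 0" and h: "continuous_on (triangle L) h"
    and b: "\<And>p. p \<in> triangle L \<Longrightarrow> \<bar>h p\<bar> \<le> A * exp (k * (fst p - snd p))"
    and p: "p \<in> triangle L"
  shows "\<bar>y_int h p\<bar> \<le> A / k * exp (k * (fst p - snd p))"
proof -
  define u where "u t = h (fst p, t * fst p + (1 - t) * snd p)" for t
  have cu: "continuous_on {0..1} u"
    unfolding u_def by (rule y_int_continuous_integrand[OF h p])
  have "continuous_on {0..1} (\<lambda>t. u (1 - t))"
    by (rule continuous_on_compose2[OF cu]) (auto intro!: continuous_intros)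
  moreover have "\<bar>u (1 - t)\<bar> \<le> A * exp (k * ((fst p - snd p) * t))" if "t \<in> {0..1}" for t
    using b[OF triangle_between(1)[OF p, of "1 - t"]] that by (simp add: u_def algebra_simps)
  moreover have "fst p - snd p \<ge> 0" using p by (auto simp: triangle_def)
  ultimately have "\<bar>(fst p - snd p) * integral {0..1} (\<lambda>t. u (1 - t))\<bar> \<le> A / k * exp (k * (fst p - snd p))"
    using exp_integral_bound[OF assms(1) _ assms(2)] by blast
  moreover have "integral {0..1} (\<lambda>t. u (1 - t)) = integral {0..1} u"
  proof -
    have "(u has_integral integral {0..1} u) {0..1}"
      using cu by (intro integrable_integral integrable_continuous_interval)
    from has_integral_affinity[OF this[folded cbox_interval], of "-1" 1]
    have "((\<lambda>t. u (1 - t)) has_integral integral {0..1} u) ((\<lambda>t. 1 - t) ` {0..1})"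
      by simp
    moreover have "(\<lambda>t. 1 - t) ` {0..1} = {0..1::real}"
      by (auto intro!: image_eqI[of _ _ "1 - _"])
    ultimately show ?thesis by (auto intro: integral_unique)
  qed
  moreover have "y_int h p = (fst p - snd p) * integral {0..1} u"
    unfolding y_int_def u_def ..
  ultimately show ?thesis by simp
qed

lemma x_int_bound:
  assumes "k > 0" "A \<ge> 0" and h: "continuous_on (triangle L) h"
    and b: "\<And>p. p \<in> triangle L \<Longrightarrow> \<bar>h p\<bar> \<le> A * exp (k * (fst p - snd p))"
    and p: "p \<in> triangle L"
  shows "\<bar>x_int h p\<bar> \<le> A / k * exp (k * (fst p - snd p))"
  unfolding x_int_def
proof (rule exp_integral_bound[OF assms(1) _ assms(2) x_int_continuous_integrand[OF h p]])
  show "fst p - snd p \<ge> 0" using p by (auto simp: triangle_def)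
  show "\<bar>h (t * fst p + (1 - t) * snd p, snd p)\<bar> \<le> A * exp (k * ((fst p - snd p) * t))" if "t \<in> {0..1}" for t
    using b[OF triangle_between(2)[OF p that]] by (simp add: algebra_simps)
qed

lemma y_int_diff:
  assumes "continuous_on (triangle L) h" "continuous_on (triangle L) h'" "p \<in> triangle L"
  shows "y_int h p - y_int h' p = y_int (\<lambda>p. h p - h' p) p"
  unfolding y_int_def
  using assms by (subst Henstock_Kurzweil_Integration.integral_diff)
    (auto intro!: integrable_continuous_interval y_int_continuous_integrand simp: right_diff_distrib)

lemma x_int_diff:
  assumes "continuous_on (triangle L) h" "continuous_on (triangle L) h'" "p \<in> triangle L"
  shows "x_int h p - x_int h' p = x_int (\<lambda>p. h p - h' p) p"
  unfolding x_int_def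
  using assms by (subst Henstock_Kurzweil_Integration.integral_diff)
    (auto intro!: integrable_continuous_interval x_int_continuous_integrand simp: right_diff_distrib)

lemma y_int_cong:
  assumes "\<And>p. p \<in> triangle L \<Longrightarrow> h p = h' p" "p \<in> triangle L"
  shows "y_int h p = y_int h' p"
  unfolding y_int_def using assms triangle_between by (auto intro!: integral_cong)

lemma x_int_cong:
  assumes "\<And>p. p \<in> triangle L \<Longrightarrow> h p = h' p" "p \<in> triangle L"
  shows "x_int h p = x_int h' p"
  unfolding x_int_def using assms triangle_between by (auto intro!: integral_cong)

section \<open>The Cauchy problem on a characteristic triangle\<close>

lemma bounded_on_triangle:
  fixes f :: "real \<times> real \<Rightarrow> real"
  assumes "continuous_on (triangle L) f" "X < L"
  shows "\<exists>B>0. \<forall>p\<in>triangle X. \<bar>f p\<bar> \<le> B"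
proof -
  let ?K = "{p. (0, 1) \<bullet> p \<ge> 0} \<inter> {p. (1, -1) \<bullet> p \<ge> 0} \<inter> {p. (1, 0) \<bullet> p \<le> X} :: (real \<times> real) set"
  have "?K \<subseteq> {0..X} \<times> {0..X}" by auto
  moreover have "bounded ({0..X} \<times> {0..X})" by (intro bounded_Times) auto
  ultimately have "bounded ?K" using bounded_subset by blast
  moreover have "closed ?K"
    by (intro closed_Int closed_halfspace_ge closed_halfspace_le)
  ultimately have "compact ?K" by (simp add: compact_eq_bounded_closed)
  moreover have "?K \<subseteq> triangle L" using assms(2) by (auto simp: triangle_def)
  ultimately have "bounded (f ` ?K)"
    by (intro compact_imp_bounded compact_continuous_image continuous_on_subset[OF assms(1)])
  moreover have "f ` triangle X \<subseteq> f ` ?K" by (intro image_mono) (auto simp: triangle_def)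
  ultimately have "bounded (f ` triangle X)" by (rule bounded_subset)
  then show ?thesis by (simp add: bounded_pos)
qed

lemma at_within_triangle:
  assumes "p \<in> triangle X" "X \<le> L"
  shows "at p within triangle L = at p within triangle X"
proof (rule at_within_nhd[of p "{q. fst q < X}"])
  show "p \<in> {q. fst q < X}" using assms by (auto simp: triangle_def)
  show "open {q::real \<times> real. fst q < X}" by (intro open_Collect_less continuous_intros)
  show "triangle L \<inter> {q. fst q < X} - {p} = triangle X \<inter> {q. fst q < X} - {p}"
    using assms by (auto simp: triangle_def)
qed

lemma triangle_exhaust:
  assumes "p \<in> triangle L"
  obtains X where "p \<in> triangle X" "X < L"
proof -
  obtain x y where p: "p = (x, y)" by (cases p)
  show ?thesis
  proof (rule that)
    show "p \<in> triangle ((x + L) / 2)" "(x + L) / 2 < L"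
      using assms by (simp_all add: triangle_def p)
  qed
qed

lemma continuous_on_triangle_exhaust:
  assumes "\<And>X. X < L \<Longrightarrow> continuous_on (triangle X) f"
  shows "continuous_on (triangle L) f"
  unfolding continuous_on_eq_continuous_within
proof
  fix p assume "p \<in> triangle L"
  then obtain X where X: "p \<in> triangle X" "X < L"
    by (rule triangle_exhaust)
  with assms[OF X(2)] have "continuous (at p within triangle X) f"
    by (simp add: continuous_on_eq_continuous_within)
  with at_within_triangle[OF X(1), of L] X(2) show "continuous (at p within triangle L) f"
    by simp
qed

lemma C1_grad_triangle_exhaust:
  assumes "\<And>X. X < L \<Longrightarrow> C1_grad (triangle X) f f1 f2"
  shows "C1_grad (triangle L) f f1 f2"
  unfolding C1_grad_def
proof (intro conjI ballI)
  show "continuous_on (triangle L) f1" "continuous_on (triangle L) f2"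
    by (rule continuous_on_triangle_exhaust, rule C1_grad_continuous(2,3)[OF assms], assumption)+
  fix p assume "p \<in> triangle L"
  then obtain X where X: "p \<in> triangle X" "X < L"
    by (rule triangle_exhaust)
  with C1_grad_derivative[OF assms[OF X(2)] X(1)] at_within_triangle[OF X(1), of L]
  show "(f has_derivative (\<lambda>v. f1 p * fst v + f2 p * snd v)) (at p within triangle L)"
    by simp
qed

lemma integrate_along_characteristics:
  assumes v: "C1_grad (triangle L) v v1 v2" and p: "p \<in> triangle L"
  shows "v p = v (fst p, fst p) - y_int v2 p" "v p = v (snd p, snd p) + x_int v1 p"
proof -
  obtain x y where xy: "p = (x, y)" by (cases p)
  have d: "(x, x) \<in> triangle L" "(y, y) \<in> triangle L"
    using triangle_diagonal p xy by auto
  have "((\<lambda>t. v2 (x, t * x + (1 - t) * y) * (x - y)) has_integral v (x, x) - v p) {0..1}"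
    using C1_grad_segment[OF v convex_triangle p d(1)] by (simp add: xy algebra_simps)
  from integral_unique[OF this] show "v p = v (fst p, fst p) - y_int v2 p"
    by (simp add: y_int_def xy mult.commute)
  have "((\<lambda>t. v1 (t * x + (1 - t) * y, y) * (x - y)) has_integral v p - v (y, y)) {0..1}"
    using C1_grad_segment[OF v convex_triangle d(2) p] by (simp add: xy algebra_simps)
  from integral_unique[OF this] show "v p = v (snd p, snd p) + x_int v1 p"
    by (simp add: x_int_def xy mult.commute)
qed

text \<open>Every integration along a characteristic divides the weight \<open>exp (k (x - y))\<close> by \<open>k\<close>;
  for \<open>k = 1 + 2 C\<close> each step of the iteration therefore halves the error.\<close>

lemma cauchy_contraction:
  assumes C: "C > 0" and c: "continuous_on (triangle X) c" "\<And>p. p \<in> triangle X \<Longrightarrow> \<bar>c p\<bar> \<le> C"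
    and v: "continuous_on (triangle X) v"
    and b: "A \<ge> 0" "\<And>p. p \<in> triangle X \<Longrightarrow> \<bar>v p\<bar> \<le> A * exp ((1 + 2 * C) * (fst p - snd p))"
    and p: "p \<in> triangle X"
  shows "\<bar>y_int (\<lambda>p. c p * v p) p\<bar> \<le> A / 2 * exp ((1 + 2 * C) * (fst p - snd p))"
    and "\<bar>x_int (\<lambda>p. c p * v p) p\<bar> \<le> A / 2 * exp ((1 + 2 * C) * (fst p - snd p))"
proof -
  have cv: "continuous_on (triangle X) (\<lambda>p. c p * v p)" by (intro continuous_intros c v)
  have bb: "\<bar>c p * v p\<bar> \<le> (C * A) * exp ((1 + 2 * C) * (fst p - snd p))" if "p \<in> triangle X" for p
    using mult_mono[OF c(2)[OF that] b(2)[OF that]] C by (simp add: abs_mult mult.assoc)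
  have "C * A / (1 + 2 * C) * exp ((1 + 2 * C) * (fst p - snd p)) \<le> A / 2 * exp ((1 + 2 * C) * (fst p - snd p))"
    by (rule mult_right_mono) (use C b(1) in \<open>auto simp: field_simps\<close>)
  moreover have "\<bar>y_int (\<lambda>p. c p * v p) p\<bar> \<le> C * A / (1 + 2 * C) * exp ((1 + 2 * C) * (fst p - snd p))"
    by (rule y_int_bound[OF _ _ cv bb p]) (use C b(1) in auto)
  moreover have "\<bar>x_int (\<lambda>p. c p * v p) p\<bar> \<le> C * A / (1 + 2 * C) * exp ((1 + 2 * C) * (fst p - snd p))"
    by (rule x_int_bound[OF _ _ cv bb p]) (use C b(1) in auto)
  ultimately show "\<bar>y_int (\<lambda>p. c p * v p) p\<bar> \<le> A / 2 * exp ((1 + 2 * C) * (fst p - snd p))"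
    "\<bar>x_int (\<lambda>p. c p * v p) p\<bar> \<le> A / 2 * exp ((1 + 2 * C) * (fst p - snd p))"
    by linarith+
qed

lemma exp_bound_mult:
  assumes "C > 0" "\<bar>u\<bar> \<le> A" "p \<in> triangle X"
  shows "\<bar>u\<bar> \<le> A * exp ((1 + 2 * C) * (fst p - snd p))"
proof -
  have "A * 1 \<le> A * exp ((1 + 2 * C) * (fst p - snd p))"
    using assms by (intro mult_left_mono) (auto simp: triangle_def)
  with assms(2) show ?thesis by linarith
qed

lemma exp_weaken:
  assumes "C > 0" "k = 1 + 2 * C" "A \<ge> 0" "p \<in> triangle X"
    "\<bar>u\<bar> \<le> A * exp (k * (fst p - snd p))"
  shows "\<bar>u\<bar> \<le> A * exp (k * X)"
proof -
  have "k * (fst p - snd p) \<le> k * X"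
    using assms(1,2,4) by (intro mult_left_mono) (auto simp: triangle_def)
  then have "A * exp (k * (fst p - snd p)) \<le> A * exp (k * X)"
    using assms(3) by (intro mult_left_mono) auto
  with assms(5) show ?thesis by linarith
qed

lemma cauchy_unique:
  assumes v: "C1_grad (triangle L) v v1 v2" "C1_grad (triangle L) v1 v11 (\<lambda>p. c p * v p)"
    and c: "continuous_on (triangle L) c"
    and zero: "\<And>s. 0 \<le> s \<Longrightarrow> s < L \<Longrightarrow> v (s, s) = 0 \<and> v1 (s, s) = 0"
    and p: "p \<in> triangle L"
  shows "v p = 0"
proof -
  obtain X where X: "p \<in> triangle X" "X < L"
    using p by (rule triangle_exhaust)
  have sub: "triangle X \<subseteq> triangle L"
    using X by (intro triangle_mono) auto
  obtain C where C: "C > 0" "\<And>p. p \<in> triangle X \<Longrightarrow> \<bar>c p\<bar> \<le> C"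
    using bounded_on_triangle[OF c X(2)] by blast
  obtain B where B: "B > 0" "\<And>p. p \<in> triangle X \<Longrightarrow> \<bar>v p\<bar> \<le> B"
    using bounded_on_triangle[OF C1_grad_continuous(1)[OF v(1)] X(2)] by blast
  have cX: "continuous_on (triangle X) c" "continuous_on (triangle X) v" "continuous_on (triangle X) v1"
    using continuous_on_subset[OF _ sub] c C1_grad_continuous[OF v(1)] by auto
  define k where "k = 1 + 2 * C"
  have k: "k > 1" using C by (simp add: k_def)
  have diag: "v (fst q, fst q) = 0 \<and> v1 (fst q, fst q) = 0 \<and> v (snd q, snd q) = 0" if "q \<in> triangle X" for q
    using zero that X(2) by (auto simp: triangle_def)
  have bound: "q \<in> triangle X \<Longrightarrow> \<bar>v q\<bar> \<le> B / 2 ^ n * exp (k * (fst q - snd q))" for q n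
  proof (induction n arbitrary: q)
    case 0
    then show ?case
      using exp_bound_mult[OF C(1) B(2)] by (simp add: k_def)
  next
    case (Suc n)
    have v1: "\<bar>v1 q\<bar> \<le> B / 2 ^ Suc n * exp (k * (fst q - snd q))" if "q \<in> triangle X" for q
    proof -
      have "\<bar>y_int (\<lambda>p. c p * v p) q\<bar> \<le> B / 2 ^ n / 2 * exp ((1 + 2 * C) * (fst q - snd q))"
        by (rule cauchy_contraction[OF C(1) cX(1) C(2) cX(2)]) (use B Suc.IH that in \<open>auto simp: k_def\<close>)
      then show ?thesis
        using integrate_along_characteristics(1)[OF v(2), of q] that sub diag[OF that] by (auto simp: k_def mult.commute)
    qed
    have "\<bar>x_int v1 q\<bar> \<le> B / 2 ^ Suc n / k * exp (k * (fst q - snd q))"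
      by (rule x_int_bound[OF _ _ cX(3) v1]) (use k B Suc.prems in auto)
    also have "\<dots> \<le> B / 2 ^ Suc n * exp (k * (fst q - snd q))"
      by (rule mult_right_mono) (use k B in \<open>auto simp: field_simps\<close>)
    finally show ?case
      using integrate_along_characteristics(2)[OF v(1), of q] Suc.prems sub diag[of q] by auto
  qed
  have "(\<lambda>n. B * exp (k * (fst p - snd p)) * (1 / 2) ^ n) \<longlonglongrightarrow> B * exp (k * (fst p - snd p)) * 0"
    by (intro tendsto_intros LIMSEQ_power_zero) auto
  then have "\<bar>v p\<bar> \<le> 0"
    using bound[OF X(1)] by (intro LIMSEQ_le_const) (auto simp: power_divide mult_ac)
  then show ?thesis by simp
qed

lemma cauchy_operator_grad:
  assumes "C1_on (triangle L) h"
  shows "C1_grad (triangle L) (\<lambda>p. - y_int (x_int h) p) (\<lambda>p. - y_int h p) (x_int h)"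
proof -
  obtain h1 h2 where h: "C1_grad (triangle L) h h1 h2" using assms by (auto simp: C1_on_def)
  show ?thesis
    by (rule C1_grad_cong[OF C1_grad_minus[OF y_int_grad[OF x_int_grad[OF h]]]])
      (auto simp: x_int_def)
qed

lemma cauchy_exists:
  assumes c: "C1_on (triangle L) c" and h: "C1_on (triangle L) h"
  shows "\<exists>w w1 w2 w11 w22. C2_grad (triangle L) w w1 w2 w11 (\<lambda>p. c p * w p + h p) w22 \<and>
    (\<forall>s. 0 \<le> s \<and> s < L \<longrightarrow> w (s, s) = 0 \<and> w1 (s, s) = 0 \<and> w2 (s, s) = 0)"
proof -
  define W where "W n = ((\<lambda>w p. - y_int (x_int (\<lambda>p. c p * w p + h p)) p) ^^ n) (\<lambda>p. 0)" for n
  have W0: "W 0 = (\<lambda>p. 0)" by (simp add: W_def)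
  have WS: "W (Suc n) = (\<lambda>p. - y_int (x_int (\<lambda>p. c p * W n p + h p)) p)" for n
    by (simp add: W_def)
  define H where "H n = (\<lambda>p. c p * W n p + h p)" for n
  have C1comb: "C1_on (triangle L) (\<lambda>p. c p * u p + h p)" if "C1_on (triangle L) u" for u
    using C1_on_add[OF C1_on_mult[OF c that] h] .
  have WC1: "C1_on (triangle L) (W n)" for n
  proof (induction n)
    case 0 show ?case using C1_grad_const unfolding W0 C1_on_def by blast
  next
    case (Suc n)
    from cauchy_operator_grad[OF C1comb[OF this]] show ?case
      unfolding WS C1_on_def by blast
  qed
  have HC1: "C1_on (triangle L) (H n)" for n
    unfolding H_def by (rule C1comb[OF WC1])
  have Wgrad: "C1_grad (triangle L) (W (Suc n)) (\<lambda>p. - y_int (H n) p) (x_int (H n))" for n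
    using cauchy_operator_grad[OF HC1] unfolding WS H_def .
  define w where "w p = (\<Sum>n. W (Suc n) p - W n p)" for p
  have Hcont: "continuous_on (triangle L) (H n)" and Wcont: "continuous_on (triangle L) (W n)"
    and ccont: "continuous_on (triangle L) c" and hcont: "continuous_on (triangle L) h" for n
    using C1_on_continuous HC1 WC1 c h by auto
  define Hw where "Hw = (\<lambda>p. c p * w p + h p)"
  have wX: "C1_grad (triangle X) w (\<lambda>p. - y_int Hw p) (x_int Hw)" if X: "X < L" for X
  proof -
    have sub: "triangle X \<subseteq> triangle L"
      using X by (intro triangle_mono) auto
    obtain C where C: "C > 0" "\<And>p. p \<in> triangle X \<Longrightarrow> \<bar>c p\<bar> \<le> C"
      using bounded_on_triangle[OF ccont X] by blast
    obtain B where B: "B > 0" "\<And>p. p \<in> triangle X \<Longrightarrow> \<bar>W (Suc 0) p\<bar> \<le> B"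
      using bounded_on_triangle[OF Wcont[of "Suc 0"] X] by blast
    define k where "k = 1 + 2 * C"
    have k: "k > 1" using C by (simp add: k_def)
    note [continuous_intros] = continuous_on_subset[OF ccont sub] continuous_on_subset[OF hcont sub]
      continuous_on_subset[OF Wcont sub]
    have HcX: "continuous_on (triangle X) (H n)" for n
      using continuous_on_subset[OF Hcont sub] .
    have xHcX: "continuous_on (triangle X) (x_int (H n))" for n
      using C1_grad_continuous(3)[OF Wgrad] continuous_on_subset[OF _ sub] by auto
    have bound: "p \<in> triangle X \<Longrightarrow> \<bar>W (Suc n) p - W n p\<bar> \<le> B / 2 ^ n * exp (k * (fst p - snd p))" for p n
    proof (induction n arbitrary: p)
      case 0
      then show ?case
        using exp_bound_mult[OF C(1) B(2)] by (simp add: k_def W0)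
    next
      case (Suc n)
      define v where "v p = W (Suc n) p - W n p" for p
      have cv: "continuous_on (triangle X) v" unfolding v_def by (intro continuous_intros)
      have x: "\<bar>x_int (\<lambda>p. c p * v p) q\<bar> \<le> B / 2 ^ Suc n * exp (k * (fst q - snd q))" if "q \<in> triangle X" for q
      proof -
        have "\<bar>x_int (\<lambda>p. c p * v p) q\<bar> \<le> B / 2 ^ n / 2 * exp ((1 + 2 * C) * (fst q - snd q))"
          by (rule cauchy_contraction[OF C(1) continuous_on_subset[OF ccont sub] C(2) cv])
            (use B Suc.IH that in \<open>auto simp: k_def v_def\<close>)
        then show ?thesis by (simp add: k_def mult.commute)
      qed
      have xd: "x_int (H (Suc n)) q - x_int (H n) q = x_int (\<lambda>p. c p * v p) q" if "q \<in> triangle X" for q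
        unfolding x_int_diff[OF HcX HcX that]
        by (rule x_int_cong[OF _ that]) (auto simp: H_def v_def algebra_simps)
      have "continuous_on (triangle X) (\<lambda>q. x_int (H (Suc n)) q - x_int (H n) q)"
        by (intro continuous_intros xHcX)
      then have xc: "continuous_on (triangle X) (x_int (\<lambda>p. c p * v p))"
        using xd by (simp cong: continuous_on_cong)
      have "W (Suc (Suc n)) p - W (Suc n) p = - (y_int (x_int (H (Suc n))) p - y_int (x_int (H n)) p)"
        using WS[of "Suc n"] WS[of n] by (simp add: H_def)
      also have "y_int (x_int (H (Suc n))) p - y_int (x_int (H n)) p = y_int (x_int (\<lambda>p. c p * v p)) p"
        unfolding y_int_diff[OF xHcX xHcX Suc.prems] by (rule y_int_cong[OF xd Suc.prems])
      finally have "\<bar>W (Suc (Suc n)) p - W (Suc n) p\<bar> = \<bar>y_int (x_int (\<lambda>p. c p * v p)) p\<bar>" by simp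
      also have "\<dots> \<le> B / 2 ^ Suc n / k * exp (k * (fst p - snd p))"
        by (rule y_int_bound[OF _ _ xc x]) (use k B Suc.prems in auto)
      also have "\<dots> \<le> B / 2 ^ Suc n * exp (k * (fst p - snd p))"
        by (rule mult_right_mono) (use k B in \<open>auto simp: field_simps\<close>)
      finally show ?case .
    qed
    have ul: "uniform_limit (triangle X) (\<lambda>n p. \<Sum>i<n. W (Suc i) p - W i p) w sequentially"
      unfolding w_def
    proof (rule Weierstrass_m_test)
      show "norm (W (Suc n) p - W n p) \<le> B * exp (k * X) * (1 / 2) ^ n" if "p \<in> triangle X" for n p
      proof -
        have "\<bar>W (Suc n) p - W n p\<bar> \<le> B / 2 ^ n * exp (k * X)"
          by (rule exp_weaken[OF C(1) k_def _ that bound[OF that]]) (use B in auto)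
        then show ?thesis by (simp add: power_divide mult_ac)
      qed
      show "summable (\<lambda>n. B * exp (k * X) * (1 / 2) ^ n)"
        by (intro summable_mult summable_geometric) auto
    qed
    have "(\<Sum>i<n. W (Suc i) p - W i p) = W n p" for n p
      using sum_lessThan_telescope[of "\<lambda>i. W i p" n] by (simp add: W0)
    with ul have ul: "uniform_limit (triangle X) W w sequentially"
      by simp
    have wc: "continuous_on (triangle X) w"
      by (rule uniform_limit_theorem[OF _ ul])
        (simp_all add: continuous_on_subset[OF Wcont sub])
    have Hwc: "continuous_on (triangle X) Hw"
      unfolding Hw_def by (intro continuous_intros wc)
    have close: "\<bar>y_int (H n) p - y_int Hw p\<bar> \<le> e * exp (k * X) \<and> \<bar>x_int (H n) p - x_int Hw p\<bar> \<le> e * exp (k * X)"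
      if e: "e > 0" "\<And>q. q \<in> triangle X \<Longrightarrow> \<bar>W n q - w q\<bar> < e" and p: "p \<in> triangle X" for n e p
    proof -
      define v where "v p = W n p - w p" for p
      have cv: "continuous_on (triangle X) v" unfolding v_def by (intro continuous_intros wc)
      have bv: "\<bar>v q\<bar> \<le> e * exp ((1 + 2 * C) * (fst q - snd q))" if "q \<in> triangle X" for q
        using exp_bound_mult[OF C(1) less_imp_le[OF e(2)[OF that]] that] by (simp add: v_def)
      have "y_int (H n) p - y_int Hw p = y_int (\<lambda>p. c p * v p) p"
        unfolding y_int_diff[OF HcX Hwc p]
        by (rule y_int_cong[OF _ p]) (auto simp: H_def Hw_def v_def algebra_simps)
      moreover have "x_int (H n) p - x_int Hw p = x_int (\<lambda>p. c p * v p) p"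
        unfolding x_int_diff[OF HcX Hwc p]
        by (rule x_int_cong[OF _ p]) (auto simp: H_def Hw_def v_def algebra_simps)
      moreover have "\<bar>y_int (\<lambda>p. c p * v p) p\<bar> \<le> e / 2 * exp (k * X)"
        by (rule exp_weaken[OF C(1) k_def _ p, of "e / 2", unfolded k_def,
            OF _ cauchy_contraction(1)[OF C(1) continuous_on_subset[OF ccont sub] C(2) cv _ bv p], folded k_def])
          (use e in auto)
      moreover have "\<bar>x_int (\<lambda>p. c p * v p) p\<bar> \<le> e / 2 * exp (k * X)"
        by (rule exp_weaken[OF C(1) k_def _ p, of "e / 2", unfolded k_def,
            OF _ cauchy_contraction(2)[OF C(1) continuous_on_subset[OF ccont sub] C(2) cv _ bv p], folded k_def])
          (use e in auto)
      moreover have "e / 2 * exp (k * X) \<le> e * exp (k * X)" using e(1) by simp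
      ultimately show ?thesis by linarith
    qed
    have ev: "\<forall>\<^sub>F n in sequentially. \<forall>p\<in>triangle X. \<bar>y_int (H n) p - y_int Hw p\<bar> < e \<and> \<bar>x_int (H n) p - x_int Hw p\<bar> < e"
      if "e > 0" for e
    proof -
      have "e / 2 * exp (- (k * X)) > 0" using that by simp
      with ul have "\<forall>\<^sub>F n in sequentially. \<forall>q\<in>triangle X. dist (W n q) (w q) < e / 2 * exp (- (k * X))"
        unfolding uniform_limit_iff by blast
      then show ?thesis
      proof eventually_elim
        case (elim n)
        then show ?case
          using close[of "e / 2 * exp (- (k * X))" n] that
          by (force simp: dist_real_def exp_minus field_simps)
      qed
    qed
    have y: "uniform_limit (triangle X) (\<lambda>n. y_int (H n)) (y_int Hw) sequentially"
      by (rule uniform_limitI, drule ev) (auto elim!: eventually_mono simp: dist_real_def)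
    have x: "uniform_limit (triangle X) (\<lambda>n. x_int (H n)) (x_int Hw) sequentially"
      by (rule uniform_limitI, drule ev) (auto elim!: eventually_mono simp: dist_real_def)
    have cy: "continuous_on (triangle X) (y_int Hw)"
    proof (rule uniform_limit_theorem[OF _ y])
      have "continuous_on (triangle X) (\<lambda>p. - (- y_int (H n) p))" for n
        by (intro continuous_on_minus continuous_on_subset[OF C1_grad_continuous(2)[OF Wgrad] sub])
      then show "\<forall>\<^sub>F n in sequentially. continuous_on (triangle X) (y_int (H n))" by simp
    qed auto
    have cx: "continuous_on (triangle X) (x_int Hw)"
      by (rule uniform_limit_theorem[OF _ x]) (use xHcX in auto)
    have "(w has_derivative (\<lambda>v. - y_int Hw p * fst v + x_int Hw p * snd v)) (at p within triangle X)"
      if p: "p \<in> triangle X" for p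
    proof -
      have "\<exists>g. \<forall>x\<in>triangle X. (\<lambda>n. W (Suc n) x) \<longlonglongrightarrow> g x \<and>
         (g has_derivative (\<lambda>v. - y_int Hw x * fst v + x_int Hw x * snd v)) (at x within triangle X)"
      proof (rule has_derivative_sequence[OF convex_triangle _ _ p])
        show "(W (Suc n) has_derivative (\<lambda>v. - y_int (H n) x * fst v + x_int (H n) x * snd v)) (at x within triangle X)"
          if "x \<in> triangle X" for n x
          using C1_grad_derivative[OF C1_grad_subset[OF Wgrad sub] that] .
        show "(\<lambda>n. W (Suc n) p) \<longlonglongrightarrow> w p"
          by (rule LIMSEQ_Suc[OF tendsto_uniform_limitI[OF ul p]])
        fix e :: real assume e: "e > 0"
        show "\<forall>\<^sub>F n in sequentially. \<forall>x\<in>triangle X. \<forall>v. norm ((- y_int (H n) x * fst v + x_int (H n) x * snd v) -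
              (- y_int Hw x * fst v + x_int Hw x * snd v)) \<le> e * norm v"
          using ev[OF half_gt_zero[OF e]]
        proof eventually_elim
          case (elim n)
          show ?case
          proof (intro ballI allI)
            fix x v assume x: "x \<in> triangle X"
            have "norm ((- y_int (H n) x * fst v + x_int (H n) x * snd v) - (- y_int Hw x * fst v + x_int Hw x * snd v))
              = \<bar>- ((y_int (H n) x - y_int Hw x) * fst v) + (x_int (H n) x - x_int Hw x) * snd v\<bar>"
              by (simp add: algebra_simps)
            also have "\<dots> \<le> \<bar>(y_int (H n) x - y_int Hw x) * fst v\<bar> + \<bar>(x_int (H n) x - x_int Hw x) * snd v\<bar>"
              by linarith
            also have "\<dots> \<le> e / 2 * norm v + e / 2 * norm v"
              unfolding abs_mult
              by (intro add_mono mult_mono) (use elim x e norm_fst_le[of "fst v" "snd v"] norm_snd_le[of "snd v" "fst v"] in auto)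
            finally show "norm ((- y_int (H n) x * fst v + x_int (H n) x * snd v) - (- y_int Hw x * fst v + x_int Hw x * snd v))
                \<le> e * norm v" by simp
          qed
        qed
      qed
      then obtain g where g: "\<And>x. x \<in> triangle X \<Longrightarrow> (\<lambda>n. W (Suc n) x) \<longlonglongrightarrow> g x"
        "\<And>x. x \<in> triangle X \<Longrightarrow> (g has_derivative (\<lambda>v. - y_int Hw x * fst v + x_int Hw x * snd v)) (at x within triangle X)"
        by blast
      have "w q = g q" if "q \<in> triangle X" for q
        by (rule LIMSEQ_unique[OF LIMSEQ_Suc[OF tendsto_uniform_limitI[OF ul that]] g(1)[OF that]])
      from has_derivative_transform[OF p this g(2)[OF p]] show ?thesis by simp
    qed
    with cx cy show ?thesis
      unfolding C1_grad_def by (auto intro!: continuous_intros)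
  qed
  have wL: "C1_grad (triangle L) w (\<lambda>p. - y_int Hw p) (x_int Hw)"
    by (rule C1_grad_triangle_exhaust[OF wX])
  then have "C1_on (triangle L) Hw"
    unfolding Hw_def by (intro C1comb) (auto simp: C1_on_def)
  then obtain h1 h2 where Hw: "C1_grad (triangle L) Hw h1 h2" by (auto simp: C1_on_def)
  have "C1_grad (triangle L) (\<lambda>p. - y_int Hw p) (\<lambda>p. - (Hw (fst p, fst p) + y_int h1 p)) Hw"
    using C1_grad_minus[OF y_int_grad[OF Hw]] by simp
  with wL x_int_grad[OF Hw]
  have "C2_grad (triangle L) w (\<lambda>p. - y_int Hw p) (x_int Hw) (\<lambda>p. - (Hw (fst p, fst p) + y_int h1 p)) Hw
     (\<lambda>p. - Hw (snd p, snd p) + x_int h2 p)"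
    by (simp add: C2_grad_def)
  moreover have "W n (s, s) = 0" for n s by (cases n) (auto simp: W0 WS y_int_def)
  then have "w (s, s) = 0 \<and> - y_int Hw (s, s) = 0 \<and> x_int Hw (s, s) = 0" for s
    by (simp add: w_def y_int_def x_int_def)
  ultimately show ?thesis unfolding Hw_def by blast
qed

section \<open>Partial derivatives on convex regions\<close>

lemma has_derivative_unique_convex:
  fixes f :: "'a::euclidean_space \<Rightarrow> real"
  assumes S: "convex S" "interior S \<noteq> {}" "x \<in> S"
    and f: "(f has_derivative f1) (at x within S)" "(f has_derivative f2) (at x within S)"
  shows "f1 = f2"
proof -
  have dir: "f1 (z - x) = f2 (z - x)" if z: "z \<in> S" for z
  proof -
    have mem: "x + t *\<^sub>R (z - x) \<in> S" if "t \<in> {0..1}" for t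
      using convexD_alt[OF S(1,3) z, of t] that by (simp add: algebra_simps)
    have vd: "((\<lambda>t. f (x + t *\<^sub>R (z - x))) has_vector_derivative g (z - x)) (at 0 within {0..1})"
      if g: "(f has_derivative g) (at x within S)" for g
    proof -
      have d: "((\<lambda>t. x + t *\<^sub>R (z - x)) has_derivative (\<lambda>s. s *\<^sub>R (z - x))) (at 0 within {0..1})"
        by (auto intro!: derivative_eq_intros)
      have "(\<lambda>t. x + t *\<^sub>R (z - x)) ` {0..1} \<subseteq> S" using mem by auto
      with has_derivative_in_compose[OF d, of f g] has_derivative_subset[OF g]
      have "((\<lambda>t. f (x + t *\<^sub>R (z - x))) has_derivative (\<lambda>s. g (s *\<^sub>R (z - x)))) (at 0 within {0..1})"
        by simp
      moreover have "linear g" using g has_derivative_linear by blast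
      ultimately show ?thesis
        by (simp add: has_vector_derivative_def linear_cmul)
    qed
    show ?thesis
      by (rule vector_derivative_unique_within[OF _ vd[OF f(1)] vd[OF f(2)]])
        (simp add: trivial_limit_within islimpt_Icc)
  qed
  from S(2) obtain z e where e: "e > 0" "ball z e \<subseteq> S"
    by (auto simp: mem_interior)
  have lin: "linear f1" "linear f2" using f has_derivative_linear by blast+
  show ?thesis
  proof
    fix v
    show "f1 v = f2 v"
    proof (cases "v = 0")
      case True
      then show ?thesis using lin by (simp add: linear_0)
    next
      case False
      define c where "c = e / (2 * norm v)"
      have c: "c > 0" using False e by (simp add: c_def)
      have "z \<in> S" using e by auto
      have "z + c *\<^sub>R v \<in> ball z e" using False e by (auto simp: c_def dist_norm)
      then have "z + c *\<^sub>R v \<in> S" using e by auto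
      from dir[OF this] dir[OF \<open>z \<in> S\<close>]
      have "f1 z + c * f1 v - f1 x = f2 z + c * f2 v - f2 x" "f1 z - f1 x = f2 z - f2 x"
        by (simp_all add: linear_diff[OF lin(1)] linear_diff[OF lin(2)] linear_add[OF lin(1)]
            linear_add[OF lin(2)] linear_cmul[OF lin(1)] linear_cmul[OF lin(2)])
      then have "c * f1 v = c * f2 v" by linarith
      then show ?thesis using c by simp
    qed
  qed
qed

lemma partial_eq:
  fixes f :: "'a::euclidean_space \<Rightarrow> real"
  assumes "convex S" "interior S \<noteq> {}" "x \<in> S" "(f has_derivative f') (at x within S)"
  shows "partial S e f x = f' e"
proof -
  have "f differentiable (at x within S)" using assms(4) by (auto simp: differentiable_def)
  then have "(f has_derivative frechet_derivative f (at x within S)) (at x within S)"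
    by (simp add: frechet_derivative_works)
  from has_derivative_unique_convex[OF assms(1-3) this assms(4)]
  show ?thesis by (simp add: partial_def)
qed

lemma partial_cong:
  assumes "\<And>x. x \<in> S \<Longrightarrow> f x = g x" "x \<in> S"
  shows "partial S e f x = partial S e g x"
proof -
  have "(f has_derivative D) (at x within S) \<longleftrightarrow> (g has_derivative D) (at x within S)" for D
    using has_derivative_transform[OF assms(2), of f g D] has_derivative_transform[OF assms(2), of g f D] assms(1)
    by auto
  then show ?thesis by (simp add: partial_def frechet_derivative_def)
qed

lemma Basis_real_prod: "(Basis :: (real \<times> real) set) = {(1, 0), (0, 1)}"
  by (auto simp: Basis_prod_def)

lemma C1_grad_partial:
  assumes "convex S" "interior S \<noteq> {}" "p \<in> S" "C1_grad S f f1 f2"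
  shows "partial S (1, 0) f p = f1 p" "partial S (0, 1) f p = f2 p"
  using partial_eq[OF assms(1-3) C1_grad_derivative[OF assms(4,3)]] by simp_all

lemma differentiable_on_grad:
  assumes "f differentiable_on S" "p \<in> S"
  shows "(f has_derivative (\<lambda>v. partial S (1, 0) f p * fst v + partial S (0, 1) f p * snd v)) (at p within S)"
proof -
  let ?F = "frechet_derivative f (at p within S)"
  have F: "(f has_derivative ?F) (at p within S)"
    using assms by (simp add: differentiable_on_def frechet_derivative_works)
  then have lin: "linear ?F" by (rule has_derivative_linear)
  have "?F v = partial S (1, 0) f p * fst v + partial S (0, 1) f p * snd v" for v
  proof -
    have v: "v = fst v *\<^sub>R (1, 0) + snd v *\<^sub>R (0, 1)" by (simp add: prod_eq_iff)
    have "?F v = fst v *\<^sub>R ?F (1, 0) + snd v *\<^sub>R ?F (0, 1)"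
      by (subst v) (simp only: linear_add[OF lin] linear_cmul[OF lin])
    then show ?thesis by (simp add: partial_def mult.commute)
  qed
  then have "?F = (\<lambda>v. partial S (1, 0) f p * fst v + partial S (0, 1) f p * snd v)" by auto
  with F show ?thesis by simp
qed

lemma C2_on_C1_grad:
  assumes "C2_on S f"
  shows "C1_grad S f (partial S (1, 0) f) (partial S (0, 1) f)"
    and "C1_grad S (partial S (1, 0) f) (partial S (1, 0) (partial S (1, 0) f)) (partial S (0, 1) (partial S (1, 0) f))"
    and "C1_grad S (partial S (0, 1) f) (partial S (1, 0) (partial S (0, 1) f)) (partial S (0, 1) (partial S (0, 1) f))"
proof -
  have d: "f differentiable_on S" "partial S (1, 0) f differentiable_on S" "partial S (0, 1) f differentiable_on S"
    using assms by (auto simp: C2_on_def Basis_real_prod)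
  note c = d(2,3)[THEN differentiable_imp_continuous_on]
  show "C1_grad S f (partial S (1, 0) f) (partial S (0, 1) f)"
    unfolding C1_grad_def using c differentiable_on_grad[OF d(1)] by blast
  have "continuous_on S (partial S e' (partial S e f))" if "e \<in> {(1,0),(0,1)}" "e' \<in> {(1,0),(0,1)}" for e e'
    using assms that by (auto simp: C2_on_def Basis_real_prod)
  then show "C1_grad S (partial S (1, 0) f) (partial S (1, 0) (partial S (1, 0) f)) (partial S (0, 1) (partial S (1, 0) f))"
    and "C1_grad S (partial S (0, 1) f) (partial S (1, 0) (partial S (0, 1) f)) (partial S (0, 1) (partial S (0, 1) f))"
    unfolding C1_grad_def using differentiable_on_grad[OF d(2)] differentiable_on_grad[OF d(3)] by simp_all
qed

lemma C2_grad_partial: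
  assumes S: "convex S" "interior S \<noteq> {}" and f: "C2_grad S f f1 f2 f11 f12 f22"
  shows "C2_on S f"
    and "p \<in> S \<Longrightarrow> partial S (1, 0) f p = f1 p" and "p \<in> S \<Longrightarrow> partial S (0, 1) f p = f2 p"
    and "p \<in> S \<Longrightarrow> partial S (1, 0) (partial S (1, 0) f) p = f11 p"
    and "p \<in> S \<Longrightarrow> partial S (0, 1) (partial S (1, 0) f) p = f12 p"
    and "p \<in> S \<Longrightarrow> partial S (1, 0) (partial S (0, 1) f) p = f12 p"
    and "p \<in> S \<Longrightarrow> partial S (0, 1) (partial S (0, 1) f) p = f22 p"
proof -
  have g: "C1_grad S f f1 f2" "C1_grad S f1 f11 f12" "C1_grad S f2 f12 f22"
    using f by (auto simp: C2_grad_def)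
  have 1: "partial S (1, 0) f p = f1 p" "partial S (0, 1) f p = f2 p" if "p \<in> S" for p
    using C1_grad_partial[OF S that g(1)] .
  then show "p \<in> S \<Longrightarrow> partial S (1, 0) f p = f1 p" "p \<in> S \<Longrightarrow> partial S (0, 1) f p = f2 p"
    by blast+
  have gp: "C1_grad S (partial S (1, 0) f) f11 f12" "C1_grad S (partial S (0, 1) f) f12 f22"
    using C1_grad_cong[OF g(2)] C1_grad_cong[OF g(3)] 1 by simp_all
  have 2: "partial S (1, 0) (partial S (1, 0) f) p = f11 p" "partial S (0, 1) (partial S (1, 0) f) p = f12 p"
    "partial S (1, 0) (partial S (0, 1) f) p = f12 p" "partial S (0, 1) (partial S (0, 1) f) p = f22 p" if "p \<in> S" for p
    using C1_grad_partial[OF S that gp(1)] C1_grad_partial[OF S that gp(2)] by simp_all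
  then show "p \<in> S \<Longrightarrow> partial S (1, 0) (partial S (1, 0) f) p = f11 p"
    "p \<in> S \<Longrightarrow> partial S (0, 1) (partial S (1, 0) f) p = f12 p"
    "p \<in> S \<Longrightarrow> partial S (1, 0) (partial S (0, 1) f) p = f12 p"
    "p \<in> S \<Longrightarrow> partial S (0, 1) (partial S (0, 1) f) p = f22 p" by blast+
  have "f differentiable_on S" "partial S (1, 0) f differentiable_on S" "partial S (0, 1) f differentiable_on S"
    using C1_grad_derivative[OF g(1)] C1_grad_derivative[OF gp(1)] C1_grad_derivative[OF gp(2)]
    unfolding differentiable_on_def differentiable_def by blast+
  moreover have "continuous_on S f11" "continuous_on S f12" "continuous_on S f22"
    using C1_grad_continuous[OF g(2)] C1_grad_continuous[OF g(3)] by auto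
  ultimately show "C2_on S f"
    unfolding C2_on_def Basis_real_prod using 2 by (auto cong: continuous_on_cong)
qed

lemma C1_grad_lines:
  assumes f: "C1_grad S f f1 f2"
  shows "(\<And>s. s \<in> I \<Longrightarrow> (s, y) \<in> S) \<Longrightarrow> s \<in> I \<Longrightarrow> ((\<lambda>s. f (s, y)) has_derivative (\<lambda>v. f1 (s, y) * v)) (at s within I)"
    and "(\<And>s. s \<in> I \<Longrightarrow> (x, s) \<in> S) \<Longrightarrow> s \<in> I \<Longrightarrow> ((\<lambda>s. f (x, s)) has_derivative (\<lambda>v. f2 (x, s) * v)) (at s within I)"
    and "(\<And>s. s \<in> I \<Longrightarrow> (s, s) \<in> S) \<Longrightarrow> s \<in> I \<Longrightarrow> ((\<lambda>s. f (s, s)) has_derivative (\<lambda>v. (f1 (s, s) + f2 (s, s)) * v)) (at s within I)"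
proof -
  have chain: "((\<lambda>s. f (k s)) has_derivative (\<lambda>v. f1 (k s) * fst (k' v) + f2 (k s) * snd (k' v))) (at s within I)"
    if "(k has_derivative k') (at s within I)" "\<And>s. s \<in> I \<Longrightarrow> k s \<in> S" "s \<in> I" for k k' s
  proof -
    have "k ` I \<subseteq> S" using that(2) by auto
    from has_derivative_in_compose[OF that(1) has_derivative_subset[OF C1_grad_derivative[OF f that(2)[OF that(3)]] this]]
    show ?thesis .
  qed
  have d: "((\<lambda>s. (s, y)) has_derivative (\<lambda>v. (v, 0))) (at s within I)"
    "((\<lambda>s. (x, s)) has_derivative (\<lambda>v. (0, v))) (at s within I)"
    "((\<lambda>s. (s, s)) has_derivative (\<lambda>v. (v, v))) (at s within I)"
    by (intro has_derivative_Pair has_derivative_ident has_derivative_const)+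
  show "(\<And>s. s \<in> I \<Longrightarrow> (s, y) \<in> S) \<Longrightarrow> s \<in> I \<Longrightarrow> ((\<lambda>s. f (s, y)) has_derivative (\<lambda>v. f1 (s, y) * v)) (at s within I)"
    using chain[OF d(1)] by simp
  show "(\<And>s. s \<in> I \<Longrightarrow> (x, s) \<in> S) \<Longrightarrow> s \<in> I \<Longrightarrow> ((\<lambda>s. f (x, s)) has_derivative (\<lambda>v. f2 (x, s) * v)) (at s within I)"
    using chain[OF d(2)] by simp
  show "(\<And>s. s \<in> I \<Longrightarrow> (s, s) \<in> S) \<Longrightarrow> s \<in> I \<Longrightarrow> ((\<lambda>s. f (s, s)) has_derivative (\<lambda>v. (f1 (s, s) + f2 (s, s)) * v)) (at s within I)"
    using chain[OF d(3)] by (simp add: distrib_right)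
qed

lemma mixed_partials_rectangle:
  assumes f: "C1_grad S f f1 f2" "C1_grad S f1 f11 f12" "C1_grad S f2 f21 f22"
    and h: "h > 0" and sub: "{x..x+h} \<times> {y..y+h} \<subseteq> S"
  shows "\<exists>q\<in>{x..x+h} \<times> {y..y+h}. \<exists>q'\<in>{x..x+h} \<times> {y..y+h}. f12 q = f21 q'"
proof -
  have mem: "(s, u) \<in> S" if "s \<in> {x..x+h}" "u \<in> {y..y+h}" for s u using sub that by auto
  have ends: "x \<in> {x..x+h}" "x + h \<in> {x..x+h}" "y \<in> {y..y+h}" "y + h \<in> {y..y+h}" using h by auto
  have "\<exists>s\<in>{x<..<x+h}. (f (x+h, y+h) - f (x+h, y)) - (f (x, y+h) - f (x, y)) = (\<lambda>v. f1 (s, y+h) * v - f1 (s, y) * v) (x + h - x)"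
    by (rule mvt_simple[of x "x+h" "\<lambda>s. f (s, y+h) - f (s, y)"])
      (use h in \<open>auto intro!: has_derivative_diff C1_grad_lines[OF f(1)] mem ends\<close>)
  then obtain s where s: "s \<in> {x<..<x+h}"
    "(f (x+h, y+h) - f (x+h, y)) - (f (x, y+h) - f (x, y)) = h * (f1 (s, y+h) - f1 (s, y))"
    by (auto simp: algebra_simps)
  have "\<exists>u\<in>{y<..<y+h}. f1 (s, y+h) - f1 (s, y) = (\<lambda>v. f12 (s, u) * v) (y + h - y)"
    by (rule mvt_simple[of y "y+h" "\<lambda>u. f1 (s, u)"])
      (use h s in \<open>auto intro!: C1_grad_lines[OF f(2)] mem ends\<close>)
  then obtain u where u: "u \<in> {y<..<y+h}" "f1 (s, y+h) - f1 (s, y) = f12 (s, u) * h" by auto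
  have "\<exists>u\<in>{y<..<y+h}. (f (x+h, y+h) - f (x, y+h)) - (f (x+h, y) - f (x, y)) = (\<lambda>v. f2 (x+h, u) * v - f2 (x, u) * v) (y + h - y)"
    by (rule mvt_simple[of y "y+h" "\<lambda>u. f (x+h, u) - f (x, u)"])
      (use h in \<open>auto intro!: has_derivative_diff C1_grad_lines[OF f(1)] mem ends\<close>)
  then obtain u' where u': "u' \<in> {y<..<y+h}"
    "(f (x+h, y+h) - f (x, y+h)) - (f (x+h, y) - f (x, y)) = h * (f2 (x+h, u') - f2 (x, u'))"
    by (auto simp: algebra_simps)
  have "\<exists>s\<in>{x<..<x+h}. f2 (x+h, u') - f2 (x, u') = (\<lambda>v. f21 (s, u') * v) (x + h - x)"
    by (rule mvt_simple[of x "x+h" "\<lambda>s. f2 (s, u')"])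
      (use h u' in \<open>auto intro!: C1_grad_lines[OF f(3)] mem ends\<close>)
  then obtain s' where s': "s' \<in> {x<..<x+h}" "f2 (x+h, u') - f2 (x, u') = f21 (s', u') * h" by auto
  have "h * (f12 (s, u) * h) = h * (f21 (s', u') * h)"
    using s(2) u(2) u'(2) s'(2) by (simp add: algebra_simps)
  then have "f12 (s, u) = f21 (s', u')" using h by simp
  then show ?thesis using s(1) u(1) u'(1) s'(1) by (intro bexI[of _ "(s, u)"] bexI[of _ "(s', u')"]) auto
qed

lemma mixed_partials_eq:
  assumes f: "C1_grad S f f1 f2" "C1_grad S f1 f11 f12" "C1_grad S f2 f21 f22"
    and h: "h > 0" and sub: "{x..x+h} \<times> {y..y+h} \<subseteq> S"
  shows "f12 (x, y) = f21 (x, y)"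
proof -
  define k where "k n = h / real (Suc n)" for n
  have k: "k n > 0" "k n \<le> h" for n using h by (auto simp: k_def field_simps)
  have ksub: "{x..x+k n} \<times> {y..y+k n} \<subseteq> S" for n
    using sub k(2)[of n] by (force simp: subset_iff)
  have "\<forall>n. \<exists>q q'. q \<in> {x..x+k n} \<times> {y..y+k n} \<and> q' \<in> {x..x+k n} \<times> {y..y+k n} \<and> f12 q = f21 q'"
    using mixed_partials_rectangle[OF f k(1) ksub] by blast
  then obtain q q' where q: "\<And>n. q n \<in> {x..x+k n} \<times> {y..y+k n}" "\<And>n. q' n \<in> {x..x+k n} \<times> {y..y+k n}"
    "\<And>n. f12 (q n) = f21 (q' n)" by metis
  have k0: "k \<longlonglongrightarrow> 0"
    unfolding k_def using LIMSEQ_Suc[OF lim_const_over_n[of h]] by simp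
  have lim: "r \<longlonglongrightarrow> (x, y)" if r: "\<And>n. r n \<in> {x..x+k n} \<times> {y..y+k n}" for r
  proof -
    have "(\<lambda>n. fst (r n)) \<longlonglongrightarrow> x"
      by (rule tendsto_sandwich[of "\<lambda>n. x" _ _ "\<lambda>n. x + k n"])
        (use r tendsto_add[OF tendsto_const k0, of x] in \<open>auto simp: mem_Times_iff\<close>)
    moreover have "(\<lambda>n. snd (r n)) \<longlonglongrightarrow> y"
      by (rule tendsto_sandwich[of "\<lambda>n. y" _ _ "\<lambda>n. y + k n"])
        (use r tendsto_add[OF tendsto_const k0, of y] in \<open>auto simp: mem_Times_iff\<close>)
    ultimately show ?thesis using tendsto_Pair by fastforce
  qed
  have xy: "(x, y) \<in> S" using sub h by auto
  have "(\<lambda>n. f12 (q n)) \<longlonglongrightarrow> f12 (x, y)"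
    using q(1) ksub by (intro continuous_on_tendsto_compose[OF C1_grad_continuous(3)[OF f(2)] lim xy] always_eventually allI) blast+
  moreover have "(\<lambda>n. f21 (q' n)) \<longlonglongrightarrow> f21 (x, y)"
    using q(2) ksub by (intro continuous_on_tendsto_compose[OF C1_grad_continuous(2)[OF f(3)] lim xy] always_eventually allI) blast+
  ultimately show ?thesis using q(3) LIMSEQ_unique by fastforce
qed

lemma mixed_partials_triangle:
  assumes f: "C1_grad (triangle L) f f1 f2" "C1_grad (triangle L) f1 f11 f12" "C1_grad (triangle L) f2 f21 f22"
    and p: "p \<in> triangle L"
  shows "f12 p = f21 p"
proof -
  obtain x y where xy: "p = (x, y)" by (cases p)
  have off: "f12 (s, y) = f21 (s, y)" if s: "x < s" "s < L" for s
  proof (rule mixed_partials_eq[OF f, of "min (L - s) (s - x) / 2"])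
    show "min (L - s) (s - x) / 2 > 0" using s by auto
    show "{s..s + min (L - s) (s - x) / 2} \<times> {y..y + min (L - s) (s - x) / 2} \<subseteq> triangle L"
      using s p xy min.cobounded1[of "L - s" "s - x"] min.cobounded2[of "L - s" "s - x"]
      by (auto simp: triangle_def simp del: min.bounded_iff min.cobounded1 min.cobounded2)
  qed
  define s where "s n = x + (L - x) / real (Suc (Suc n))" for n
  have xL: "x < L" using p xy by (simp add: triangle_def)
  have s: "x < s n" "s n < L" for n
  proof -
    have "(L - x) / real (Suc (Suc n)) < (L - x) / 1"
      using xL by (intro divide_strict_left_mono) auto
    then show "x < s n" "s n < L" using xL by (simp_all add: s_def)
  qed
  have "(\<lambda>n. (L - x) / real (Suc (Suc n))) \<longlonglongrightarrow> 0"
    using LIMSEQ_Suc[OF LIMSEQ_Suc[OF lim_const_over_n[of "L - x"]]] by simp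
  from tendsto_add[OF tendsto_const this, of x] have "s \<longlonglongrightarrow> x" unfolding s_def by simp
  then have lim: "(\<lambda>n. (s n, y)) \<longlonglongrightarrow> (x, y)" by (intro tendsto_intros)
  have mem: "(s n, y) \<in> triangle L" for n
    using s[of n] p xy by (auto simp: triangle_def)
  have "(\<lambda>n. f12 (s n, y)) \<longlonglongrightarrow> f12 (x, y)" "(\<lambda>n. f21 (s n, y)) \<longlonglongrightarrow> f21 (x, y)"
    using C1_grad_continuous(3)[OF f(2)] C1_grad_continuous(2)[OF f(3)] lim mem p xy
    unfolding continuous_on_sequentially by (auto simp: o_def)
  then show ?thesis using off[OF s] LIMSEQ_unique xy by fastforce
qed

definition to_null :: "real \<Rightarrow> real \<times> real \<Rightarrow> real \<times> real" where
  "to_null \<rho>0 p = (fst p + snd p - \<rho>0, fst p - snd p + \<rho>0)"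

definition from_null :: "real \<Rightarrow> real \<times> real \<Rightarrow> real \<times> real" where
  "from_null \<rho>0 q = ((fst q + snd q) / 2, \<rho>0 + (fst q - snd q) / 2)"

lemma to_null_from_null [simp]: "to_null \<rho>0 (from_null \<rho>0 q) = q" "from_null \<rho>0 (to_null \<rho>0 p) = p"
  by (auto simp: to_null_def from_null_def prod_eq_iff field_simps)

lemma to_null_mem_iff:
  "to_null \<rho>0 p \<in> triangle (sqrt (\<alpha>\<^sup>2 - r0\<^sup>2)) \<longleftrightarrow> p \<in> domain_of_dependence \<alpha> r0 \<rho>0"
  by (auto simp: to_null_def triangle_def domain_of_dependence_def)

lemma convex_domain_of_dependence: "convex (domain_of_dependence \<alpha> r0 \<rho>0)"
proof -
  have "domain_of_dependence \<alpha> r0 \<rho>0 = {p. (0, 1) \<bullet> p \<ge> \<rho>0} \<inter> {p. (1, -1) \<bullet> p \<ge> - \<rho>0} \<inter>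
      {p. (1, 1) \<bullet> p < sqrt (\<alpha>\<^sup>2 - r0\<^sup>2) + \<rho>0}"
    by (auto simp: domain_of_dependence_def)
  then show ?thesis
    by (simp add: convex_Int convex_halfspace_ge convex_halfspace_lt)
qed

lemma domain_of_dependence_open_subset:
  assumes "0 < r0" "r0 < \<alpha>"
  obtains U where "open U" "U \<noteq> {}" "U \<subseteq> domain_of_dependence \<alpha> r0 \<rho>0"
proof
  define L where "L = sqrt (\<alpha>\<^sup>2 - r0\<^sup>2)"
  have L: "L > 0" using assms by (simp add: L_def power_strict_mono)
  let ?U = "{p. \<rho>0 < snd p \<and> - \<rho>0 < fst p - snd p \<and> fst p + snd p < L + \<rho>0}"
  show "open ?U" by (intro open_Collect_conj open_Collect_less continuous_intros)
  have "(L / 2, \<rho>0 + L / 4) \<in> ?U" using L by simp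
  then show "?U \<noteq> {}" by blast
  show "?U \<subseteq> domain_of_dependence \<alpha> r0 \<rho>0" by (auto simp: domain_of_dependence_def L_def)
qed

lemma interior_domain_of_dependence:
  assumes "0 < r0" "r0 < \<alpha>"
  shows "interior (domain_of_dependence \<alpha> r0 \<rho>0) \<noteq> {}"
  using domain_of_dependence_open_subset[OF assms] interior_maximal by (metis subset_empty)

lemma C1_grad_to_null:
  assumes "C1_grad (triangle (sqrt (\<alpha>\<^sup>2 - r0\<^sup>2))) F F1 F2"
  shows "C1_grad (domain_of_dependence \<alpha> r0 \<rho>0) (\<lambda>p. F (to_null \<rho>0 p))
    (\<lambda>p. F1 (to_null \<rho>0 p) + F2 (to_null \<rho>0 p)) (\<lambda>p. F1 (to_null \<rho>0 p) - F2 (to_null \<rho>0 p))"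
proof -
  have A: "to_null \<rho>0 p = (- \<rho>0 + 1 * fst p + 1 * snd p, \<rho>0 + 1 * fst p + (-1) * snd p)" for p
    by (simp add: to_null_def)
  show ?thesis
    using C1_grad_affine[OF assms A, of "domain_of_dependence \<alpha> r0 \<rho>0"] by (simp add: to_null_mem_iff)
qed

lemma C1_grad_from_null:
  assumes "C1_grad (domain_of_dependence \<alpha> r0 \<rho>0) f f1 f2"
  shows "C1_grad (triangle (sqrt (\<alpha>\<^sup>2 - r0\<^sup>2))) (\<lambda>p. f (from_null \<rho>0 p))
    (\<lambda>p. (f1 (from_null \<rho>0 p) + f2 (from_null \<rho>0 p)) / 2) (\<lambda>p. (f1 (from_null \<rho>0 p) - f2 (from_null \<rho>0 p)) / 2)"
proof -
  have A: "from_null \<rho>0 p = (0 + 1/2 * fst p + 1/2 * snd p, \<rho>0 + 1/2 * fst p + (-1/2) * snd p)" for p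
    by (simp add: from_null_def field_simps)
  have mem: "from_null \<rho>0 p \<in> domain_of_dependence \<alpha> r0 \<rho>0" if "p \<in> triangle (sqrt (\<alpha>\<^sup>2 - r0\<^sup>2))" for p
    using to_null_mem_iff[of \<rho>0 "from_null \<rho>0 p"] that by simp
  show ?thesis
    using C1_grad_affine[OF assms A mem] by (simp add: field_simps)
qed

lemma C2_grad_to_null:
  assumes "C2_grad (triangle (sqrt (\<alpha>\<^sup>2 - r0\<^sup>2))) F F1 F2 F11 F12 F22"
  shows "C2_grad (domain_of_dependence \<alpha> r0 \<rho>0) (\<lambda>p. F (to_null \<rho>0 p))
    (\<lambda>p. F1 (to_null \<rho>0 p) + F2 (to_null \<rho>0 p)) (\<lambda>p. F1 (to_null \<rho>0 p) - F2 (to_null \<rho>0 p))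
    (\<lambda>p. F11 (to_null \<rho>0 p) + 2 * F12 (to_null \<rho>0 p) + F22 (to_null \<rho>0 p))
    (\<lambda>p. F11 (to_null \<rho>0 p) - F22 (to_null \<rho>0 p))
    (\<lambda>p. F11 (to_null \<rho>0 p) - 2 * F12 (to_null \<rho>0 p) + F22 (to_null \<rho>0 p))"
proof -
  have g: "C1_grad (triangle (sqrt (\<alpha>\<^sup>2 - r0\<^sup>2))) F F1 F2"
    "C1_grad (triangle (sqrt (\<alpha>\<^sup>2 - r0\<^sup>2))) F1 F11 F12"
    "C1_grad (triangle (sqrt (\<alpha>\<^sup>2 - r0\<^sup>2))) F2 F12 F22"
    using assms by (auto simp: C2_grad_def)
  note t = g[THEN C1_grad_to_null, of \<rho>0]
  show ?thesis
    unfolding C2_grad_def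
  proof (intro conjI t(1))
    show "C1_grad (domain_of_dependence \<alpha> r0 \<rho>0)
        (\<lambda>p. F1 (to_null \<rho>0 p) + F2 (to_null \<rho>0 p))
        (\<lambda>p. F11 (to_null \<rho>0 p) + 2 * F12 (to_null \<rho>0 p) + F22 (to_null \<rho>0 p))
        (\<lambda>p. F11 (to_null \<rho>0 p) - F22 (to_null \<rho>0 p))"
      by (rule C1_grad_cong[OF C1_grad_add[OF t(2,3)]]) auto
    show "C1_grad (domain_of_dependence \<alpha> r0 \<rho>0)
        (\<lambda>p. F1 (to_null \<rho>0 p) - F2 (to_null \<rho>0 p))
        (\<lambda>p. F11 (to_null \<rho>0 p) - F22 (to_null \<rho>0 p))
        (\<lambda>p. F11 (to_null \<rho>0 p) - 2 * F12 (to_null \<rho>0 p) + F22 (to_null \<rho>0 p))"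
      by (rule C1_grad_cong[OF C1_grad_diff[OF t(2,3)]]) auto
  qed
qed

lemma C2_on_from_null:
  assumes f: "C2_on (domain_of_dependence \<alpha> r0 \<rho>0) f"
  obtains F1 F2 F11 F12 F22 where
    "C2_grad (triangle (sqrt (\<alpha>\<^sup>2 - r0\<^sup>2))) (\<lambda>q. f (from_null \<rho>0 q)) F1 F2 F11 F12 F22"
proof -
  let ?S = "triangle (sqrt (\<alpha>\<^sup>2 - r0\<^sup>2))"
  let ?D = "domain_of_dependence \<alpha> r0 \<rho>0"
  obtain f1 f2 f11 f12 f21 f22 where d: "C1_grad ?D f f1 f2" "C1_grad ?D f1 f11 f12" "C1_grad ?D f2 f21 f22"
    using C2_on_C1_grad[OF f] by blast
  note t = d[THEN C1_grad_from_null]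
  let ?c = "\<lambda>f. \<lambda>p. f (from_null \<rho>0 p)"
  have half: "C1_grad ?S (\<lambda>p. (a p) / 2) (\<lambda>p. a1 p / 2) (\<lambda>p. a2 p / 2)" if "C1_grad ?S a a1 a2" for a a1 a2
    by (rule C1_grad_cong[OF C1_grad_mult[OF that C1_grad_const[of _ "1/2"]]]) auto
  obtain F1 F2 F11 F12 F21 F22 where F: "C1_grad ?S (?c f) F1 F2" "C1_grad ?S F1 F11 F12" "C1_grad ?S F2 F21 F22"
    using t(1) half[OF C1_grad_add[OF t(2,3)]] half[OF C1_grad_diff[OF t(2,3)]] by blast
  have "C1_grad ?S F2 F12 F22"
    by (rule C1_grad_cong[OF F(3)]) (use mixed_partials_triangle[OF F] in auto)
  with F show ?thesis by (intro that) (auto simp: C2_grad_def)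
qed

section \<open>Twice continuously differentiable functions\<close>

lemma C1_on_const: "C1_on S (\<lambda>p. c)"
  unfolding C1_on_def using C1_grad_const by blast

lemma C1_on_compose:
  assumes "C1_on S f" "continuous_on S (\<lambda>p. \<phi>' (f p))"
    and "\<And>p. p \<in> S \<Longrightarrow> (\<phi> has_real_derivative \<phi>' (f p)) (at (f p))"
  shows "C1_on S (\<lambda>p. \<phi> (f p))"
  using assms(1) C1_grad_compose[where \<phi> = \<phi> and \<phi>' = \<phi>', OF _ assms(2,3)] unfolding C1_on_def by blast

lemma C1_on_minus: "C1_on S f \<Longrightarrow> C1_on S (\<lambda>p. - f p)"
  unfolding C1_on_def by (elim exE) (intro exI, rule C1_grad_minus)

lemma C1_on_divide:
  assumes "C1_on S f" "C1_on S g" "\<And>p. p \<in> S \<Longrightarrow> g p \<noteq> 0"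
  shows "C1_on S (\<lambda>p. f p / g p)"
proof -
  have "C1_on S (\<lambda>p. inverse (g p))"
    by (rule C1_on_compose[where \<phi> = inverse and \<phi>' = "\<lambda>z. - (inverse z ^ Suc (Suc 0))",
          OF assms(2) _ DERIV_inverse[OF assms(3)]])
      (use assms(3) C1_on_continuous[OF assms(2)] in \<open>auto intro!: continuous_intros\<close>)
  from C1_on_mult[OF assms(1) this] show ?thesis by (simp add: divide_inverse)
qed

lemma C2_grad_cong:
  assumes "C2_grad S f f1 f2 f11 f12 f22"
    and "\<And>p. p \<in> S \<Longrightarrow> g p = f p" "\<And>p. p \<in> S \<Longrightarrow> g1 p = f1 p" "\<And>p. p \<in> S \<Longrightarrow> g2 p = f2 p"
    and "\<And>p. p \<in> S \<Longrightarrow> g11 p = f11 p" "\<And>p. p \<in> S \<Longrightarrow> g12 p = f12 p" "\<And>p. p \<in> S \<Longrightarrow> g22 p = f22 p"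
  shows "C2_grad S g g1 g2 g11 g12 g22"
  using assms unfolding C2_grad_def by (blast intro: C1_grad_cong)

lemma C2_grad_C1_grad:
  assumes "C2_grad S f f1 f2 f11 f12 f22"
  shows "C1_grad S f f1 f2" "C1_grad S f1 f11 f12" "C1_grad S f2 f12 f22"
  using assms by (auto simp: C2_grad_def)

lemma C2_grad_add:
  assumes "C2_grad S f f1 f2 f11 f12 f22" "C2_grad S g g1 g2 g11 g12 g22"
  shows "C2_grad S (\<lambda>p. f p + g p) (\<lambda>p. f1 p + g1 p) (\<lambda>p. f2 p + g2 p)
    (\<lambda>p. f11 p + g11 p) (\<lambda>p. f12 p + g12 p) (\<lambda>p. f22 p + g22 p)"
  using assms unfolding C2_grad_def by (auto intro: C1_grad_add)

lemma C2_grad_diff: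
  assumes "C2_grad S f f1 f2 f11 f12 f22" "C2_grad S g g1 g2 g11 g12 g22"
  shows "C2_grad S (\<lambda>p. f p - g p) (\<lambda>p. f1 p - g1 p) (\<lambda>p. f2 p - g2 p)
    (\<lambda>p. f11 p - g11 p) (\<lambda>p. f12 p - g12 p) (\<lambda>p. f22 p - g22 p)"
  using assms unfolding C2_grad_def by (auto intro: C1_grad_diff)

lemma C2_grad_mult:
  assumes "C2_grad S f f1 f2 f11 f12 f22" "C2_grad S g g1 g2 g11 g12 g22"
  shows "C2_grad S (\<lambda>p. f p * g p) (\<lambda>p. f1 p * g p + f p * g1 p) (\<lambda>p. f2 p * g p + f p * g2 p)
    (\<lambda>p. f11 p * g p + 2 * f1 p * g1 p + f p * g11 p)
    (\<lambda>p. f12 p * g p + f1 p * g2 p + f2 p * g1 p + f p * g12 p)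
    (\<lambda>p. f22 p * g p + 2 * f2 p * g2 p + f p * g22 p)"
proof -
  note f = C2_grad_C1_grad[OF assms(1)] and g = C2_grad_C1_grad[OF assms(2)]
  show ?thesis
    unfolding C2_grad_def
    by (intro conjI C1_grad_mult[OF f(1) g(1)]
        C1_grad_cong[OF C1_grad_add[OF C1_grad_mult[OF f(2) g(1)] C1_grad_mult[OF f(1) g(2)]]]
        C1_grad_cong[OF C1_grad_add[OF C1_grad_mult[OF f(3) g(1)] C1_grad_mult[OF f(1) g(3)]]])
      (auto simp: algebra_simps)
qed

lemma C2_grad_compose:
  assumes f: "C2_grad S f f1 f2 f11 f12 f22"
    and "continuous_on S (\<lambda>p. \<phi>'' (f p))"
    and "\<And>p. p \<in> S \<Longrightarrow> (\<phi> has_real_derivative \<phi>' (f p)) (at (f p))"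
    and "\<And>p. p \<in> S \<Longrightarrow> (\<phi>' has_real_derivative \<phi>'' (f p)) (at (f p))"
  shows "C2_grad S (\<lambda>p. \<phi> (f p)) (\<lambda>p. \<phi>' (f p) * f1 p) (\<lambda>p. \<phi>' (f p) * f2 p)
    (\<lambda>p. \<phi>'' (f p) * f1 p * f1 p + \<phi>' (f p) * f11 p)
    (\<lambda>p. \<phi>'' (f p) * f1 p * f2 p + \<phi>' (f p) * f12 p)
    (\<lambda>p. \<phi>'' (f p) * f2 p * f2 p + \<phi>' (f p) * f22 p)"
proof -
  note f = C2_grad_C1_grad[OF f]
  have \<phi>': "C1_grad S (\<lambda>p. \<phi>' (f p)) (\<lambda>p. \<phi>'' (f p) * f1 p) (\<lambda>p. \<phi>'' (f p) * f2 p)"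
    by (rule C1_grad_compose[OF f(1) assms(2,4)])
  show ?thesis
    unfolding C2_grad_def
    by (intro conjI C1_grad_compose[OF f(1) C1_grad_continuous(1)[OF \<phi>'] assms(3)]
       C1_grad_cong[OF C1_grad_mult[OF \<phi>' f(2)]] C1_grad_cong[OF C1_grad_mult[OF \<phi>' f(3)]]) auto
qed

lemma C2_grad_fst: "C2_grad S fst (\<lambda>p. 1) (\<lambda>p. 0) (\<lambda>p. 0) (\<lambda>p. 0) (\<lambda>p. 0)"
  and C2_grad_snd: "C2_grad S snd (\<lambda>p. 0) (\<lambda>p. 1) (\<lambda>p. 0) (\<lambda>p. 0) (\<lambda>p. 0)"
  unfolding C2_grad_def using C1_grad_fst C1_grad_snd C1_grad_const by auto

lemma C2_grad_fun_fst:
  assumes "\<And>p. p \<in> S \<Longrightarrow> (\<phi> has_real_derivative \<phi>' (fst p)) (at (fst p))"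
    "\<And>p. p \<in> S \<Longrightarrow> (\<phi>' has_real_derivative \<phi>'' (fst p)) (at (fst p))"
    "continuous_on S (\<lambda>p. \<phi>'' (fst p))"
  shows "C2_grad S (\<lambda>p. \<phi> (fst p)) (\<lambda>p. \<phi>' (fst p)) (\<lambda>p. 0) (\<lambda>p. \<phi>'' (fst p)) (\<lambda>p. 0) (\<lambda>p. 0)"
  using C2_grad_compose[OF C2_grad_fst assms(3,1,2)] by simp

lemma C2_grad_fun_snd:
  assumes "\<And>p. p \<in> S \<Longrightarrow> (\<phi> has_real_derivative \<phi>' (snd p)) (at (snd p))"
    "\<And>p. p \<in> S \<Longrightarrow> (\<phi>' has_real_derivative \<phi>'' (snd p)) (at (snd p))"
    "continuous_on S (\<lambda>p. \<phi>'' (snd p))"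
  shows "C2_grad S (\<lambda>p. \<phi> (snd p)) (\<lambda>p. 0) (\<lambda>p. \<phi>' (snd p)) (\<lambda>p. 0) (\<lambda>p. 0) (\<lambda>p. \<phi>'' (snd p))"
  using C2_grad_compose[OF C2_grad_snd assms(3,1,2)] by simp

lemma C2_grad_inverse_sqrt:
  assumes f: "C2_grad S f f1 f2 f11 f12 f22" and pos: "\<And>p. p \<in> S \<Longrightarrow> f p > 0"
  defines "s \<equiv> \<lambda>p. 1 / sqrt (f p)"
  shows "C2_grad S s (\<lambda>p. - (1/2) * s p ^ 3 * f1 p) (\<lambda>p. - (1/2) * s p ^ 3 * f2 p)
    (\<lambda>p. 3/4 * s p ^ 5 * f1 p * f1 p + (- (1/2) * s p ^ 3) * f11 p)
    (\<lambda>p. 3/4 * s p ^ 5 * f1 p * f2 p + (- (1/2) * s p ^ 3) * f12 p)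
    (\<lambda>p. 3/4 * s p ^ 5 * f2 p * f2 p + (- (1/2) * s p ^ 3) * f22 p)"
proof -
  have d: "((\<lambda>z. 1 / sqrt z) has_real_derivative - (1/2) * (1 / sqrt z) ^ 3) (at z)" if "z > 0" for z
    using that by (auto intro!: derivative_eq_intros simp: power3_eq_cube field_simps)
  have d': "((\<lambda>z. - (1/2) * (1 / sqrt z) ^ 3) has_real_derivative 3/4 * (1 / sqrt z) ^ 5) (at z)" if "z > 0" for z
    by (rule derivative_eq_intros d that refl)+ (simp add: power_numeral_reduce field_simps)
  show ?thesis
    unfolding s_def
    by (rule C2_grad_compose[OF f, where \<phi> = "\<lambda>z. 1 / sqrt z" and \<phi>' = "\<lambda>z. - (1/2) * (1 / sqrt z) ^ 3"
          and \<phi>'' = "\<lambda>z. 3/4 * (1 / sqrt z) ^ 5"])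
      (use C1_grad_continuous(1)[OF C2_grad_C1_grad(1)[OF f]] pos d d'
        in \<open>auto intro!: continuous_intros simp: less_imp_neq[symmetric]\<close>)
qed

lemma C2_grad_sqrt:
  assumes f: "C2_grad S f f1 f2 f11 f12 f22" and pos: "\<And>p. p \<in> S \<Longrightarrow> f p > 0"
  shows "C2_grad S (\<lambda>p. sqrt (f p)) (\<lambda>p. 1 / (2 * sqrt (f p)) * f1 p) (\<lambda>p. 1 / (2 * sqrt (f p)) * f2 p)
    (\<lambda>p. - 1 / (4 * sqrt (f p) ^ 3) * f1 p * f1 p + 1 / (2 * sqrt (f p)) * f11 p)
    (\<lambda>p. - 1 / (4 * sqrt (f p) ^ 3) * f1 p * f2 p + 1 / (2 * sqrt (f p)) * f12 p)
    (\<lambda>p. - 1 / (4 * sqrt (f p) ^ 3) * f2 p * f2 p + 1 / (2 * sqrt (f p)) * f22 p)"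
proof -
  have d: "(sqrt has_real_derivative 1 / (2 * sqrt z)) (at z)" if "z > 0" for z
    using that by (auto intro!: derivative_eq_intros simp: field_simps)
  have d': "((\<lambda>z. 1 / (2 * sqrt z)) has_real_derivative - 1 / (4 * sqrt z ^ 3)) (at z)" if "z > 0" for z
    using that by (auto intro!: derivative_eq_intros simp: power3_eq_cube field_simps)
  show ?thesis
    by (rule C2_grad_compose[OF f, where \<phi> = sqrt and \<phi>' = "\<lambda>z. 1 / (2 * sqrt z)"
          and \<phi>'' = "\<lambda>z. - 1 / (4 * sqrt z ^ 3)"])
      (use C1_grad_continuous(1)[OF C2_grad_C1_grad(1)[OF f]] pos d d'
        in \<open>auto intro!: continuous_intros simp: less_imp_neq[symmetric]\<close>)
qed

lemma diagonal_derivative_zero: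
  assumes f: "C1_grad (triangle L) f f1 f2" and zero: "\<And>s. 0 \<le> s \<Longrightarrow> s < L \<Longrightarrow> f (s, s) = 0"
    and s: "0 \<le> s" "s < L"
  shows "f1 (s, s) + f2 (s, s) = 0"
proof -
  have "((\<lambda>s. f (s, s)) has_derivative (\<lambda>v. (f1 (s, s) + f2 (s, s)) * v)) (at s within {0..<L})"
    by (rule C1_grad_lines(3)[OF f]) (use s in \<open>auto simp: triangle_def\<close>)
  moreover have "((\<lambda>s. f (s, s)) has_derivative (\<lambda>v. 0)) (at s within {0..<L})"
    using has_derivative_transform[of s "{0..<L}" "\<lambda>s. f (s, s)" "\<lambda>s. 0" "\<lambda>v. 0"] zero s by simp
  ultimately have "(\<lambda>v. (f1 (s, s) + f2 (s, s)) * v) = (\<lambda>v. 0)"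
    using s by (intro has_derivative_unique_convex[of "{0..<L}" s]) auto
  from fun_cong[OF this, of 1] show ?thesis by simp
qed

lemma diagonal_derivatives_zero:
  assumes f: "C1_grad (triangle L) f f1 f2"
    and "\<And>s. 0 \<le> s \<Longrightarrow> s < L \<Longrightarrow> f (s, s) = 0 \<and> f1 (s, s) - f2 (s, s) = 0"
    and s: "0 \<le> s" "s < L"
  shows "f1 (s, s) = 0" "f2 (s, s) = 0"
  using diagonal_derivative_zero[OF f _ s] assms(2)[OF s] assms(2) by fastforce+

lemma conserved_along_y:
  assumes "C1_grad (triangle L) f f1 (\<lambda>p. 0)" "\<And>s. 0 \<le> s \<Longrightarrow> s < L \<Longrightarrow> f (s, s) = 0"
    and "p \<in> triangle L"
  shows "f p = 0"
  using integrate_along_characteristics(1)[OF assms(1,3)] assms(2)[of "fst p"] assms(3)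
  by (auto simp: y_int_def triangle_def)

lemma conserved_along_x:
  assumes "C1_grad (triangle L) f (\<lambda>p. 0) f2" "\<And>s. 0 \<le> s \<Longrightarrow> s < L \<Longrightarrow> f (s, s) = 0"
    and "p \<in> triangle L"
  shows "f p = 0"
  using integrate_along_characteristics(2)[OF assms(1,3)] assms(2)[of "snd p"] assms(3)
  by (auto simp: x_int_def triangle_def)

section \<open>The exterior in null coordinates\<close>

locale cylinder_collapse =
  fixes \<alpha> r0 :: real
  assumes r0_pos: "0 < r0" and alpha_pos: "0 < \<alpha>" and r0_less: "r0 < \<alpha> / sqrt 3"
begin

definition L :: real where "L = sqrt (\<alpha>\<^sup>2 - r0\<^sup>2)"

lemma r0_sq: "3 * r0\<^sup>2 < \<alpha>\<^sup>2"
proof -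
  have "(r0 * sqrt 3)\<^sup>2 < \<alpha>\<^sup>2"
    using r0_less r0_pos by (intro power_strict_mono) (auto simp: field_simps)
  then show ?thesis by (simp add: power_mult_distrib mult.commute)
qed

lemma L_sq: "L\<^sup>2 = \<alpha>\<^sup>2 - r0\<^sup>2"
proof -
  have "r0\<^sup>2 \<le> \<alpha>\<^sup>2" using r0_sq zero_le_power2[of r0] by linarith
  then show ?thesis unfolding L_def by simp
qed

lemma r0_less_L: "r0 < L"
proof (rule power2_less_imp_less)
  show "r0\<^sup>2 < L\<^sup>2" using r0_sq zero_le_power2[of r0] unfolding L_sq by linarith
  show "0 \<le> L" using r0_sq zero_le_power2[of r0] unfolding L_def by (intro real_sqrt_ge_zero) linarith
qed

lemma L_pos: "0 < L"
  using r0_pos r0_less_L by linarith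

lemma r0_less_alpha: "r0 < \<alpha>"
proof (rule power2_less_imp_less)
  show "r0\<^sup>2 < \<alpha>\<^sup>2" using r0_sq zero_le_power2[of r0] by linarith
qed (use alpha_pos in simp)

abbreviation \<D> :: "real \<Rightarrow> (real \<times> real) set" where "\<D> \<equiv> domain_of_dependence \<alpha> r0"

abbreviation \<Delta> :: "(real \<times> real) set" where "\<Delta> \<equiv> triangle L"

text \<open>The d'Alembert decomposition \<open>R = f + g\<close> and the decomposition \<open>p + q\<close> of the solution of the
  flat wave equation with the Cauchy data of \<open>\<psi>\<close>; \<open>f'\<close>, \<open>q'\<close>, ... are written \<open>f1\<close>, \<open>q1\<close>, ....\<close>

definition "f s = r0 * (L\<^sup>2 - s\<^sup>2) / (2 * \<alpha>\<^sup>2) + (s * (\<alpha>\<^sup>2 - 3 * r0\<^sup>2) - s ^ 3 / 3) / (2 * \<alpha>\<^sup>2)"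
definition "g s = r0 * (L\<^sup>2 - s\<^sup>2) / (2 * \<alpha>\<^sup>2) - (s * (\<alpha>\<^sup>2 - 3 * r0\<^sup>2) - s ^ 3 / 3) / (2 * \<alpha>\<^sup>2)"
definition "f1 s = (\<alpha>\<^sup>2 - 2 * r0\<^sup>2 - (s + r0)\<^sup>2) / (2 * \<alpha>\<^sup>2)"
definition "g1 s = ((s - r0)\<^sup>2 + 2 * r0\<^sup>2 - \<alpha>\<^sup>2) / (2 * \<alpha>\<^sup>2)"
definition "f2 s = - (s + r0) / \<alpha>\<^sup>2"
definition "g2 s = (s - r0) / \<alpha>\<^sup>2"
definition "p s = (L + r0) / (2 * L) * ln (L - s) + (L - r0) / (2 * L) * ln (L + s) - 2 * ln \<alpha>"
definition "q s = (L - r0) / (2 * L) * ln (L - s) + (L + r0) / (2 * L) * ln (L + s)"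
definition "p1 s = - (s + r0) / (L\<^sup>2 - s\<^sup>2)"
definition "q1 s = - (s - r0) / (L\<^sup>2 - s\<^sup>2)"
definition "p2 s = - 1 / (L\<^sup>2 - s\<^sup>2) - 2 * s * (s + r0) / (L\<^sup>2 - s\<^sup>2)\<^sup>2"
definition "q2 s = - 1 / (L\<^sup>2 - s\<^sup>2) - 2 * s * (s - r0) / (L\<^sup>2 - s\<^sup>2)\<^sup>2"
definition R :: "real \<times> real \<Rightarrow> real" where "R z = f (fst z) + g (snd z)"

lemma DERIV_f: "(f has_real_derivative f1 s) (at s)" "(f1 has_real_derivative f2 s) (at s)" "(f2 has_real_derivative - 1 / \<alpha>\<^sup>2) (at s)"
  and DERIV_g: "(g has_real_derivative g1 s) (at s)" "(g1 has_real_derivative g2 s) (at s)" "(g2 has_real_derivative 1 / \<alpha>\<^sup>2) (at s)"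
  unfolding f_def[abs_def] f1_def[abs_def] f2_def[abs_def] g_def[abs_def] g1_def[abs_def] g2_def[abs_def]
  by (auto intro!: derivative_eq_intros simp: alpha_pos less_imp_neq[OF alpha_pos, symmetric] power2_eq_square field_simps)

lemma \<Delta>_bounds:
  assumes "z \<in> \<Delta>"
  shows "0 \<le> fst z" "fst z < L" "0 \<le> snd z" "snd z < L" "snd z \<le> fst z"
  using assms by (auto simp: triangle_def)

lemma L_sq_minus: "0 \<le> s \<Longrightarrow> s < L \<Longrightarrow> L\<^sup>2 - s\<^sup>2 > 0"
  by (simp add: power_strict_mono)

lemma DERIV_pq:
  assumes "0 \<le> s" "s < L"
  shows "(p has_real_derivative p1 s) (at s)" "(p1 has_real_derivative p2 s) (at s)"
    "(q has_real_derivative q1 s) (at s)" "(q1 has_real_derivative q2 s) (at s)"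
proof -
  have nz: "L - s > 0" "L + s > 0" "L > 0" "L\<^sup>2 - s\<^sup>2 \<noteq> 0"
    using assms L_sq_minus[OF assms] L_pos by auto
  have fac: "L\<^sup>2 - s\<^sup>2 = (L - s) * (L + s)" by (simp add: power2_eq_square algebra_simps)
  have log: "((\<lambda>s. a * ln (L - s) + b * ln (L + s) - c) has_real_derivative (b / (L + s) - a / (L - s))) (at s)" for a b c
    using nz by (auto intro!: derivative_eq_intros)
  have "(L - r0) / (2 * L) / (L + s) - (L + r0) / (2 * L) / (L - s) = p1 s"
    "(L + r0) / (2 * L) / (L + s) - (L - r0) / (2 * L) / (L - s) = q1 s"
    unfolding p1_def q1_def fac using nz by (simp_all add: divide_simps) (simp_all add: algebra_simps)
  then show "(p has_real_derivative p1 s) (at s)" "(q has_real_derivative q1 s) (at s)"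
    using log[of "(L + r0) / (2 * L)" "(L - r0) / (2 * L)" "2 * ln \<alpha>"]
      log[of "(L - r0) / (2 * L)" "(L + r0) / (2 * L)" 0] unfolding p_def[abs_def] q_def[abs_def]
    by simp_all
  show "(p1 has_real_derivative p2 s) (at s)" "(q1 has_real_derivative q2 s) (at s)"
    unfolding p1_def[abs_def] p2_def q1_def[abs_def] q2_def using nz(4)
    by (auto intro!: derivative_eq_intros simp: divide_simps) (simp_all add: power2_eq_square algebra_simps)
qed

lemma g1_neg: "0 \<le> s \<Longrightarrow> s \<le> L \<Longrightarrow> g1 s < 0"
proof -
  assume s: "0 \<le> s" "s \<le> L"
  have "(s - r0)\<^sup>2 + 2 * r0\<^sup>2 < \<alpha>\<^sup>2"
  proof (cases "s \<le> 2 * r0")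
    case True
    then have "\<bar>s - r0\<bar> \<le> \<bar>r0\<bar>" using s r0_pos by auto
    then have "(s - r0)\<^sup>2 \<le> r0\<^sup>2" by (simp only: abs_le_square_iff)
    then show ?thesis using r0_sq by linarith
  next
    case False
    then have "\<bar>s - r0\<bar> \<le> \<bar>L - r0\<bar>" using s r0_pos by auto
    then have "(s - r0)\<^sup>2 \<le> (L - r0)\<^sup>2" by (simp only: abs_le_square_iff)
    also have "(L - r0)\<^sup>2 = \<alpha>\<^sup>2 - 2 * r0 * L" using L_sq by (simp add: power2_eq_square algebra_simps)
    finally have "(s - r0)\<^sup>2 + 2 * r0\<^sup>2 \<le> \<alpha>\<^sup>2 - 2 * (r0 * (L - r0))"
      by (simp add: power2_eq_square algebra_simps)
    moreover have "r0 * (L - r0) > 0" using r0_pos r0_less_L by simp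
    ultimately show ?thesis by linarith
  qed
  then show ?thesis using alpha_pos by (simp add: g1_def divide_neg_pos)
qed

lemma R_diag: "f s + g s = r0 * (1 - (s\<^sup>2 + r0\<^sup>2) / \<alpha>\<^sup>2)"
  using alpha_pos by (simp add: f_def g_def L_sq field_simps)

lemma R_pos: assumes "z \<in> \<Delta>" shows "R z > 0"
proof -
  note b = \<Delta>_bounds[OF assms]
  have "g (fst z) \<le> g (snd z)"
  proof (rule DERIV_nonpos_imp_nonincreasing[OF b(5)])
    show "\<exists>y. (g has_real_derivative y) (at s) \<and> y \<le> 0" if "snd z \<le> s" "s \<le> fst z" for s
      using DERIV_g(1)[of s] g1_neg[of s] that b by (intro exI[of _ "g1 s"]) auto
  qed
  moreover have "f (fst z) + g (fst z) = r0 * (L\<^sup>2 - (fst z)\<^sup>2) / \<alpha>\<^sup>2"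
    by (simp add: f_def g_def field_simps)
  moreover have "\<dots> > 0" using L_sq_minus[OF b(1,2)] r0_pos alpha_pos by simp
  ultimately show ?thesis unfolding R_def by linarith
qed

lemma R_C2: "C2_grad \<Delta> R (\<lambda>z. f1 (fst z)) (\<lambda>z. g1 (snd z)) (\<lambda>z. f2 (fst z)) (\<lambda>z. 0) (\<lambda>z. g2 (snd z))"
proof -
  have "continuous_on \<Delta> (\<lambda>z. f2 (fst z))" "continuous_on \<Delta> (\<lambda>z. g2 (snd z))"
    unfolding f2_def g2_def using alpha_pos by (auto intro!: continuous_intros)
  then show ?thesis
    using C2_grad_add[OF C2_grad_fun_fst[OF DERIV_f(1,2)] C2_grad_fun_snd[OF DERIV_g(1,2)]]
    by (simp add: R_def[abs_def])
qed

lemma pq_C2: "C2_grad \<Delta> (\<lambda>z. p (fst z) + q (snd z)) (\<lambda>z. p1 (fst z)) (\<lambda>z. q1 (snd z)) (\<lambda>z. p2 (fst z)) (\<lambda>z. 0) (\<lambda>z. q2 (snd z))"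
proof -
  have nz: "L\<^sup>2 - (fst z)\<^sup>2 \<noteq> 0" "L\<^sup>2 - (snd z)\<^sup>2 \<noteq> 0" if "z \<in> \<Delta>" for z
    using L_sq_minus[of "fst z"] L_sq_minus[of "snd z"] \<Delta>_bounds[OF that] by auto
  have "continuous_on \<Delta> (\<lambda>z. p2 (fst z))" "continuous_on \<Delta> (\<lambda>z. q2 (snd z))"
    unfolding p2_def q2_def using nz by (auto intro!: continuous_intros)
  then show ?thesis
    using C2_grad_add[OF C2_grad_fun_fst[of \<Delta> p p1 p2] C2_grad_fun_snd[of \<Delta> q q1 q2]] DERIV_pq \<Delta>_bounds
    by simp
qed

lemma p_plus_q:
  assumes "0 \<le> s" "s < L"
  shows "p s + q s = ln (1 - (s\<^sup>2 + r0\<^sup>2) / \<alpha>\<^sup>2)"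
proof -
  have "p s + q s = ln (L - s) + ln (L + s) - 2 * ln \<alpha>"
    using L_pos by (simp add: p_def q_def field_simps)
  also have "\<dots> = ln ((L - s) * (L + s) / \<alpha>\<^sup>2)"
    using assms alpha_pos L_pos by (simp add: ln_div ln_mult ln_realpow)
  also have "(L - s) * (L + s) / \<alpha>\<^sup>2 = 1 - (s\<^sup>2 + r0\<^sup>2) / \<alpha>\<^sup>2"
  proof -
    have "(L - s) * (L + s) = \<alpha>\<^sup>2 - r0\<^sup>2 - s\<^sup>2" using L_sq by (simp add: power2_eq_square algebra_simps)
    then show ?thesis using alpha_pos by (simp add: field_simps)
  qed
  finally show ?thesis .
qed

lemma C1_f1g1: "C1_on \<Delta> (\<lambda>z. f1 (fst z))" "C1_on \<Delta> (\<lambda>z. g1 (snd z))" "C1_on \<Delta> R"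
  and C1_p1q1: "C1_on \<Delta> (\<lambda>z. p1 (fst z))" "C1_on \<Delta> (\<lambda>z. q1 (snd z))"
  using C2_grad_C1_grad[OF R_C2] C2_grad_C1_grad[OF pq_C2] unfolding C1_on_def by blast+

lemma C1_sqrt_R: "C1_on \<Delta> (\<lambda>z. 1 / sqrt (R z))"
  using C2_grad_C1_grad(1)[OF C2_grad_inverse_sqrt[OF R_C2 R_pos]] unfolding C1_on_def by blast

text \<open>The substitution \<open>\<psi> = p + q + w / \<surd>R\<close> removes the first-order terms.\<close>

lemma psi_exists:
  obtains \<psi> \<psi>1 \<psi>2 \<psi>11 \<psi>12 \<psi>22 where "C2_grad \<Delta> \<psi> \<psi>1 \<psi>2 \<psi>11 \<psi>12 \<psi>22"
    "\<And>z. z \<in> \<Delta> \<Longrightarrow> 2 * R z * \<psi>12 z + f1 (fst z) * \<psi>2 z + g1 (snd z) * \<psi>1 z = 0"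
    "\<And>s. 0 \<le> s \<Longrightarrow> s < L \<Longrightarrow> \<psi> (s, s) = p s + q s \<and> \<psi>1 (s, s) = p1 s \<and> \<psi>2 (s, s) = q1 s"
proof -
  define i where "i z = 1 / sqrt (R z)" for z
  define c where "c z = - (1/4) * (f1 (fst z) * g1 (snd z) * (i z * i z * (i z * i z)))" for z
  define h where "h z = - (1/2) * ((f1 (fst z) * q1 (snd z) + g1 (snd z) * p1 (fst z)) * i z)" for z
  have "C1_on \<Delta> c"
    unfolding c_def i_def by (intro C1_on_mult C1_on_const C1_f1g1 C1_sqrt_R)
  moreover have "C1_on \<Delta> h"
    unfolding h_def i_def by (intro C1_on_mult C1_on_add C1_on_const C1_f1g1 C1_sqrt_R C1_p1q1)
  ultimately obtain w w1 w2 w11 w22 where w: "C2_grad \<Delta> w w1 w2 w11 (\<lambda>z. c z * w z + h z) w22"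
    "\<And>s. 0 \<le> s \<Longrightarrow> s < L \<Longrightarrow> w (s, s) = 0 \<and> w1 (s, s) = 0 \<and> w2 (s, s) = 0"
    using cauchy_exists[of L c h] by blast
  note i = C2_grad_inverse_sqrt[OF R_C2 R_pos, folded i_def]
  note psi = C2_grad_add[OF pq_C2 C2_grad_mult[OF w(1) i]]
  show ?thesis
  proof (rule that[OF psi], goal_cases)
    case (1 z)
    then show ?case .
  next
    case z: (2 z)
    have Ri: "R z * i z ^ 2 = 1" using R_pos[OF z] by (simp add: i_def power_divide)
    let ?F = "f1 (fst z)" and ?G = "g1 (snd z)" and ?P = "p1 (fst z)" and ?Q = "q1 (snd z)"
    have "2 * R z * (0 + ((c z * w z + h z) * i z + w1 z * (- (1/2) * i z ^ 3 * ?G) +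
               w2 z * (- (1/2) * i z ^ 3 * ?F) + w z * (3/4 * i z ^ 5 * ?F * ?G + (- (1/2) * i z ^ 3) * 0)))
      + ?F * (?Q + (w2 z * i z + w z * (- (1/2) * i z ^ 3 * ?G)))
      + ?G * (?P + (w1 z * i z + w z * (- (1/2) * i z ^ 3 * ?F)))
      = (R z * i z ^ 2 - 1) * (- ?F * ?Q - ?G * ?P - w1 z * i z * ?G - w2 z * i z * ?F + w z * i z ^ 3 * ?F * ?G)"
      unfolding c_def h_def by (simp add: power_numeral_reduce algebra_simps)
    then show ?case
      using Ri by simp
  next
    case (3 s)
    then show ?case using w(2) by auto
  qed
qed

lemma psi_unique:
  assumes \<psi>: "C2_grad \<Delta> \<psi> \<psi>1 \<psi>2 \<psi>11 \<psi>12 \<psi>22"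
    and eq: "\<And>z. z \<in> \<Delta> \<Longrightarrow> 2 * R z * \<psi>12 z + f1 (fst z) * \<psi>2 z + g1 (snd z) * \<psi>1 z = 0"
    and zero: "\<And>s. 0 \<le> s \<Longrightarrow> s < L \<Longrightarrow> \<psi> (s, s) = 0 \<and> \<psi>1 (s, s) - \<psi>2 (s, s) = 0"
    and z: "z \<in> \<Delta>"
  shows "\<psi> z = 0"
proof -
  note g = C2_grad_C1_grad[OF \<psi>]
  note d = diagonal_derivatives_zero[OF g(1) zero]
  define c where "c z = - (1/4) * (f1 (fst z) * g1 (snd z) / (R z * R z))" for z
  have "C1_on \<Delta> c"
    unfolding c_def by (intro C1_on_mult C1_on_divide C1_on_const C1_f1g1) (use R_pos in force)
  then have c: "continuous_on \<Delta> c" by (rule C1_on_continuous)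
  note w = C2_grad_C1_grad[OF C2_grad_mult[OF \<psi> C2_grad_sqrt[OF R_C2 R_pos]]]
  have "\<psi> z * sqrt (R z) = 0"
  proof (rule cauchy_unique[OF w(1) C1_grad_cong[OF w(2)] c _ z])
    fix z assume z: "z \<in> \<Delta>"
    define S where "S = sqrt (R z)"
    have S: "S \<noteq> 0" "R z = S * S" using R_pos[OF z] by (auto simp: S_def)
    have e: "\<psi>12 z = - (f1 (fst z) * \<psi>2 z + g1 (snd z) * \<psi>1 z) / (2 * (S * S))"
      using eq[OF z] S by (simp add: field_simps)
    show "c z * (\<psi> z * sqrt (R z)) = \<psi>12 z * sqrt (R z) + \<psi>1 z * (1 / (2 * sqrt (R z)) * g1 (snd z)) +
      \<psi>2 z * (1 / (2 * sqrt (R z)) * f1 (fst z)) +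
      \<psi> z * (- 1 / (4 * sqrt (R z) ^ 3) * f1 (fst z) * g1 (snd z) + 1 / (2 * sqrt (R z)) * 0)"
      unfolding c_def S_def[symmetric] S(2) e using S(1) by (simp add: power3_eq_cube divide_simps)
  qed (use d zero in auto)
  with R_pos[OF z] show ?thesis by simp
qed

lemma wave_unique:
  assumes \<psi>: "C2_grad \<Delta> \<psi> \<psi>1 \<psi>2 \<psi>11 \<psi>12 \<psi>22"
    and eq: "\<And>z. z \<in> \<Delta> \<Longrightarrow> \<psi>12 z = 0"
    and zero: "\<And>s. 0 \<le> s \<Longrightarrow> s < L \<Longrightarrow> \<psi> (s, s) = 0 \<and> \<psi>1 (s, s) - \<psi>2 (s, s) = 0"
    and z: "z \<in> \<Delta>"
  shows "\<psi> z = 0"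
proof -
  note g = C2_grad_C1_grad[OF \<psi>]
  note d = diagonal_derivatives_zero[OF g(1) zero]
  show ?thesis
    by (rule cauchy_unique[where c = "\<lambda>z. 0", OF g(1) C1_grad_cong[OF g(2)] _ _ z]) (use d zero eq in auto)
qed

lemma gamma_exists:
  assumes \<psi>: "C2_grad \<Delta> \<psi> \<psi>1 \<psi>2 \<psi>11 \<psi>12 \<psi>22"
  obtains \<gamma> \<gamma>1 \<gamma>2 \<gamma>11 \<gamma>22 where "C2_grad \<Delta> \<gamma> \<gamma>1 \<gamma>2 \<gamma>11 (\<lambda>z. - (\<psi>1 z * \<psi>2 z)) \<gamma>22"
    "\<And>s. 0 \<le> s \<Longrightarrow> s < L \<Longrightarrow> \<gamma> (s, s) = p s + q s \<and> \<gamma>1 (s, s) = p1 s \<and> \<gamma>2 (s, s) = q1 s"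
proof -
  have "C1_on \<Delta> (\<lambda>z. - (\<psi>1 z * \<psi>2 z))"
    using C2_grad_C1_grad[OF \<psi>] by (intro C1_on_minus C1_on_mult) (auto simp: C1_on_def)
  from cauchy_exists[OF C1_on_const[of _ 0] this] obtain w w1 w2 w11 w22
    where w: "C2_grad \<Delta> w w1 w2 w11 (\<lambda>z. 0 * w z + - (\<psi>1 z * \<psi>2 z)) w22"
      "\<And>s. 0 \<le> s \<Longrightarrow> s < L \<Longrightarrow> w (s, s) = 0 \<and> w1 (s, s) = 0 \<and> w2 (s, s) = 0"
    by blast
  show ?thesis
    by (rule that[OF C2_grad_cong[OF C2_grad_add[OF pq_C2 w(1)] refl refl refl refl _ refl]]) (use w(2) in auto)
qed

lemma constraints:
  assumes \<psi>: "C2_grad \<Delta> \<psi> \<psi>1 \<psi>2 \<psi>11 \<psi>12 \<psi>22"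
    and \<gamma>: "C2_grad \<Delta> \<gamma> \<gamma>1 \<gamma>2 \<gamma>11 (\<lambda>z. - (\<psi>1 z * \<psi>2 z)) \<gamma>22"
    and eq: "\<And>z. z \<in> \<Delta> \<Longrightarrow> 2 * R z * \<psi>12 z + f1 (fst z) * \<psi>2 z + g1 (snd z) * \<psi>1 z = 0"
    and \<psi>0: "\<And>s. 0 \<le> s \<Longrightarrow> s < L \<Longrightarrow> \<psi>1 (s, s) = p1 s \<and> \<psi>2 (s, s) = q1 s"
    and \<gamma>0: "\<And>s. 0 \<le> s \<Longrightarrow> s < L \<Longrightarrow> \<gamma>1 (s, s) = p1 s \<and> \<gamma>2 (s, s) = q1 s"
    and z: "z \<in> \<Delta>"
  shows "2 * f1 (fst z) * \<gamma>1 z = 2 * R z * \<psi>1 z ^ 2 + f2 (fst z)"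
    and "2 * g1 (snd z) * \<gamma>2 z = 2 * R z * \<psi>2 z ^ 2 + g2 (snd z)"
proof -
  note R = C2_grad_C1_grad[OF R_C2] and \<psi> = C2_grad_C1_grad[OF \<psi>] and \<gamma> = C2_grad_C1_grad[OF \<gamma>]
  have f2: "C1_grad \<Delta> (\<lambda>z. f2 (fst z)) (\<lambda>z. - 1 / \<alpha>\<^sup>2) (\<lambda>z. 0)"
    using C1_grad_compose[OF C1_grad_fst continuous_on_const, where \<phi> = f2] DERIV_f(3) by fastforce
  have g2: "C1_grad \<Delta> (\<lambda>z. g2 (snd z)) (\<lambda>z. 0) (\<lambda>z. 1 / \<alpha>\<^sup>2)"
    using C1_grad_compose[OF C1_grad_snd continuous_on_const, where \<phi> = g2] DERIV_g(3) by fastforce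
  have nz: "L\<^sup>2 - s\<^sup>2 \<noteq> 0" "f s + g s = r0 * (L\<^sup>2 - s\<^sup>2) / \<alpha>\<^sup>2" if "0 \<le> s" "s < L" for s
    using L_sq_minus[OF that] by (auto simp: f_def g_def field_simps)
  have "f1 (fst z) * \<gamma>1 z - (R z * (\<psi>1 z * \<psi>1 z) + 1/2 * f2 (fst z)) = 0"
  proof (rule conserved_along_y[OF C1_grad_cong[OF C1_grad_diff[OF C1_grad_mult[OF R(2) \<gamma>(2)]
        C1_grad_add[OF C1_grad_mult[OF R(1) C1_grad_mult[OF \<psi>(2) \<psi>(2)]] C1_grad_mult[OF C1_grad_const f2]]] refl refl] _ z])
    fix z assume z: "z \<in> \<Delta>"
    have "0 * \<gamma>1 z + f1 (fst z) * - (\<psi>1 z * \<psi>2 z) - (g1 (snd z) * (\<psi>1 z * \<psi>1 z) + R z * (\<psi>12 z * \<psi>1 z + \<psi>1 z * \<psi>12 z) + (0 * f2 (fst z) + 1/2 * 0))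
      = - \<psi>1 z * (2 * R z * \<psi>12 z + f1 (fst z) * \<psi>2 z + g1 (snd z) * \<psi>1 z)" by (simp add: algebra_simps)
    then show "0 = 0 * \<gamma>1 z + f1 (fst z) * - (\<psi>1 z * \<psi>2 z) - (g1 (snd z) * (\<psi>1 z * \<psi>1 z) + R z * (\<psi>12 z * \<psi>1 z + \<psi>1 z * \<psi>12 z) + (0 * f2 (fst z) + 1/2 * 0))"
      using eq[OF z] by simp
  next
    fix s assume s: "0 \<le> s" "s < L"
    have f1: "f1 s = ((L\<^sup>2 - s\<^sup>2) - 2 * r0 * (s + r0)) / (2 * \<alpha>\<^sup>2)"
      unfolding f1_def L_sq by (simp add: power2_eq_square algebra_simps)
    show "f1 (fst (s, s)) * \<gamma>1 (s, s) - (R (s, s) * (\<psi>1 (s, s) * \<psi>1 (s, s)) + 1/2 * f2 (fst (s, s))) = 0"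
    proof -
      define u where "u = L\<^sup>2 - s\<^sup>2"
      have u: "u \<noteq> 0" using nz(1)[OF s] by (simp add: u_def)
      have e: "f s + g s = r0 * u / \<alpha>\<^sup>2" "f1 s = (u - 2 * r0 * (s + r0)) / (2 * \<alpha>\<^sup>2)"
        "\<psi>1 (s, s) = - (s + r0) / u" "\<gamma>1 (s, s) = - (s + r0) / u"
        using nz(2)[OF s] f1 \<psi>0[OF s] \<gamma>0[OF s] by (simp_all add: u_def p1_def)
      show ?thesis
        using u alpha_pos unfolding R_def fst_conv snd_conv e f2_def
        by (simp add: divide_simps) (simp add: algebra_simps)
    qed
  qed
  then show "2 * f1 (fst z) * \<gamma>1 z = 2 * R z * \<psi>1 z ^ 2 + f2 (fst z)"
    by (simp add: power2_eq_square algebra_simps)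
  have "g1 (snd z) * \<gamma>2 z - (R z * (\<psi>2 z * \<psi>2 z) + 1/2 * g2 (snd z)) = 0"
  proof (rule conserved_along_x[OF C1_grad_cong[OF C1_grad_diff[OF C1_grad_mult[OF R(3) \<gamma>(3)]
        C1_grad_add[OF C1_grad_mult[OF R(1) C1_grad_mult[OF \<psi>(3) \<psi>(3)]] C1_grad_mult[OF C1_grad_const g2]]] refl _ refl] _ z])
    fix z assume z: "z \<in> \<Delta>"
    have "0 * \<gamma>2 z + g1 (snd z) * - (\<psi>1 z * \<psi>2 z) - (f1 (fst z) * (\<psi>2 z * \<psi>2 z) + R z * (\<psi>12 z * \<psi>2 z + \<psi>2 z * \<psi>12 z) + (0 * g2 (snd z) + 1/2 * 0))
      = - \<psi>2 z * (2 * R z * \<psi>12 z + f1 (fst z) * \<psi>2 z + g1 (snd z) * \<psi>1 z)" by (simp add: algebra_simps)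
    then show "0 = 0 * \<gamma>2 z + g1 (snd z) * - (\<psi>1 z * \<psi>2 z) - (f1 (fst z) * (\<psi>2 z * \<psi>2 z) + R z * (\<psi>12 z * \<psi>2 z + \<psi>2 z * \<psi>12 z) + (0 * g2 (snd z) + 1/2 * 0))"
      using eq[OF z] by simp
  next
    fix s assume s: "0 \<le> s" "s < L"
    have g1: "g1 s = (- (L\<^sup>2 - s\<^sup>2) - 2 * r0 * (s - r0)) / (2 * \<alpha>\<^sup>2)"
      unfolding g1_def L_sq by (simp add: power2_eq_square algebra_simps)
    show "g1 (snd (s, s)) * \<gamma>2 (s, s) - (R (s, s) * (\<psi>2 (s, s) * \<psi>2 (s, s)) + 1/2 * g2 (snd (s, s))) = 0"
    proof -
      define u where "u = L\<^sup>2 - s\<^sup>2"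
      have u: "u \<noteq> 0" using nz(1)[OF s] by (simp add: u_def)
      have e: "f s + g s = r0 * u / \<alpha>\<^sup>2" "g1 s = (- u - 2 * r0 * (s - r0)) / (2 * \<alpha>\<^sup>2)"
        "\<psi>2 (s, s) = - (s - r0) / u" "\<gamma>2 (s, s) = - (s - r0) / u"
        using nz(2)[OF s] g1 \<psi>0[OF s] \<gamma>0[OF s] by (simp_all add: u_def q1_def)
      show ?thesis
        using u alpha_pos unfolding R_def fst_conv snd_conv e g2_def
        by (simp add: divide_simps) (simp add: algebra_simps)
    qed
  qed
  then show "2 * g1 (snd z) * \<gamma>2 z = 2 * R z * \<psi>2 z ^ 2 + g2 (snd z)"
    by (simp add: power2_eq_square algebra_simps)
qed

end

context cylinder_collapse
begin

definition null_solution where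
  "null_solution \<psi> \<psi>1 \<psi>2 \<psi>11 \<psi>12 \<psi>22 \<gamma> \<gamma>1 \<gamma>2 \<gamma>11 \<gamma>12 \<gamma>22 \<longleftrightarrow>
     C2_grad \<Delta> \<psi> \<psi>1 \<psi>2 \<psi>11 \<psi>12 \<psi>22 \<and> C2_grad \<Delta> \<gamma> \<gamma>1 \<gamma>2 \<gamma>11 \<gamma>12 \<gamma>22 \<and>
     (\<forall>z\<in>\<Delta>. \<gamma>12 z = - (\<psi>1 z * \<psi>2 z) \<and>
        2 * R z * \<psi>12 z + f1 (fst z) * \<psi>2 z + g1 (snd z) * \<psi>1 z = 0 \<and>
        2 * f1 (fst z) * \<gamma>1 z = 2 * R z * \<psi>1 z ^ 2 + f2 (fst z) \<and>
        2 * g1 (snd z) * \<gamma>2 z = 2 * R z * \<psi>2 z ^ 2 + g2 (snd z)) \<and>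
     (\<forall>s. 0 \<le> s \<and> s < L \<longrightarrow>
        \<psi> (s, s) = p s + q s \<and> \<psi>1 (s, s) = p1 s \<and> \<psi>2 (s, s) = q1 s \<and>
        \<gamma> (s, s) = p s + q s \<and> \<gamma>1 (s, s) = p1 s \<and> \<gamma>2 (s, s) = q1 s)"

lemma null_solution_exists:
  obtains \<psi> \<psi>1 \<psi>2 \<psi>11 \<psi>12 \<psi>22 \<gamma> \<gamma>1 \<gamma>2 \<gamma>11 \<gamma>12 \<gamma>22
  where "null_solution \<psi> \<psi>1 \<psi>2 \<psi>11 \<psi>12 \<psi>22 \<gamma> \<gamma>1 \<gamma>2 \<gamma>11 \<gamma>12 \<gamma>22"
proof -
  obtain \<psi> \<psi>1 \<psi>2 \<psi>11 \<psi>12 \<psi>22 where \<psi>: "C2_grad \<Delta> \<psi> \<psi>1 \<psi>2 \<psi>11 \<psi>12 \<psi>22"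
    "\<And>z. z \<in> \<Delta> \<Longrightarrow> 2 * R z * \<psi>12 z + f1 (fst z) * \<psi>2 z + g1 (snd z) * \<psi>1 z = 0"
    "\<And>s. 0 \<le> s \<Longrightarrow> s < L \<Longrightarrow> \<psi> (s, s) = p s + q s \<and> \<psi>1 (s, s) = p1 s \<and> \<psi>2 (s, s) = q1 s"
    using psi_exists by blast
  obtain \<gamma> \<gamma>1 \<gamma>2 \<gamma>11 \<gamma>22 where \<gamma>: "C2_grad \<Delta> \<gamma> \<gamma>1 \<gamma>2 \<gamma>11 (\<lambda>z. - (\<psi>1 z * \<psi>2 z)) \<gamma>22"
    "\<And>s. 0 \<le> s \<Longrightarrow> s < L \<Longrightarrow> \<gamma> (s, s) = p s + q s \<and> \<gamma>1 (s, s) = p1 s \<and> \<gamma>2 (s, s) = q1 s"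
    using gamma_exists[OF \<psi>(1)] by blast
  have "\<psi>1 (s, s) = p1 s \<and> \<psi>2 (s, s) = q1 s" "\<gamma>1 (s, s) = p1 s \<and> \<gamma>2 (s, s) = q1 s" if "0 \<le> s" "s < L" for s
    using \<psi>(3)[OF that] \<gamma>(2)[OF that] by auto
  note c = constraints[OF \<psi>(1) \<gamma>(1) \<psi>(2) this]
  show ?thesis
    by (rule that[of \<psi> \<psi>1 \<psi>2 \<psi>11 \<psi>12 \<psi>22 \<gamma> \<gamma>1 \<gamma>2 \<gamma>11 "\<lambda>z. - (\<psi>1 z * \<psi>2 z)" \<gamma>22])
      (use \<psi> \<gamma> c in \<open>simp add: null_solution_def\<close>)
qed

lemma D_mem:
  "z \<in> \<D> \<rho>0 \<Longrightarrow> to_null \<rho>0 z \<in> \<Delta>"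
  "w \<in> \<Delta> \<Longrightarrow> from_null \<rho>0 w \<in> \<D> \<rho>0"
  using to_null_mem_iff[of \<rho>0 z \<alpha> r0] to_null_mem_iff[of \<rho>0 "from_null \<rho>0 w" \<alpha> r0] by (auto simp: L_def)

lemma boundary_mem:
  assumes "0 \<le> s" "s < L"
  shows "(s, \<rho>0) \<in> \<D> \<rho>0" "(s, s) \<in> \<Delta>"
    "to_null \<rho>0 (s, \<rho>0) = (s, s)" "from_null \<rho>0 (s, s) = (s, \<rho>0)"
  using assms by (auto simp: domain_of_dependence_def triangle_def to_null_def from_null_def L_def)

lemmas interior_D = interior_domain_of_dependence[OF r0_pos r0_less_alpha]
lemmas D_partial = C2_grad_partial(2-7)[OF convex_domain_of_dependence interior_D]
lemmas D_C2_on = C2_grad_partial(1)[OF convex_domain_of_dependence interior_D]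
lemmas D_to_null = C2_grad_to_null[of \<alpha> r0, folded L_def]

lemma null_solution_field_equations:
  assumes sol: "null_solution \<psi> \<psi>1 \<psi>2 \<psi>11 \<psi>12 \<psi>22 \<gamma> \<gamma>1 \<gamma>2 \<gamma>11 \<gamma>12 \<gamma>22"
  shows "field_equations (\<D> \<rho>0) (\<lambda>z. \<psi> (to_null \<rho>0 z)) (\<lambda>z. \<gamma> (to_null \<rho>0 z)) (\<lambda>z. R (to_null \<rho>0 z))"
proof -
  have \<psi>: "C2_grad \<Delta> \<psi> \<psi>1 \<psi>2 \<psi>11 \<psi>12 \<psi>22" and \<gamma>: "C2_grad \<Delta> \<gamma> \<gamma>1 \<gamma>2 \<gamma>11 \<gamma>12 \<gamma>22"
    using sol by (auto simp: null_solution_def)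
  note d = D_partial[OF D_to_null[OF \<psi>, of \<rho>0]] D_partial[OF D_to_null[OF \<gamma>, of \<rho>0]] D_partial[OF D_to_null[OF R_C2, of \<rho>0]]
  show ?thesis
    unfolding field_equations_def Let_def
  proof (rule ballI, goal_cases)
    case z: (1 z)
    define w where "w = to_null \<rho>0 z"
    have w: "w \<in> \<Delta>" using D_mem(1)[OF z] by (simp add: w_def)
    define F G F2 G2 where "F = f1 (fst w)" and "G = g1 (snd w)" and "F2 = f2 (fst w)" and "G2 = g2 (snd w)"
    have e: "\<gamma>12 w = - (\<psi>1 w * \<psi>2 w)" "2 * R w * \<psi>12 w + F * \<psi>2 w + G * \<psi>1 w = 0"
      "F2 = 2 * F * \<gamma>1 w - 2 * R w * \<psi>1 w ^ 2"
      "G2 = 2 * G * \<gamma>2 w - 2 * R w * \<psi>2 w ^ 2"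
      using sol w unfolding null_solution_def F_def G_def F2_def G2_def by auto
    have \<psi>12: "\<psi>12 w = - (F * \<psi>2 w + G * \<psi>1 w) / (2 * R w)"
      using e(2) R_pos[OF w] by (simp add: field_simps)
    have "R w \<noteq> 0" using R_pos[OF w] by simp
    have e4: "R w * (F * \<psi>2 w ^ 2) - R w * (G * \<psi>1 w ^ 2) = F * G * \<gamma>2 w - F * G2 / 2 - F * G * \<gamma>1 w + G * F2 / 2"
      unfolding e(3,4) by (simp add: field_simps)
    have e5: "R w * (F * \<psi>2 w ^ 2) + R w * (G * \<psi>1 w ^ 2) = F * G * \<gamma>2 w - F * G2 / 2 + F * G * \<gamma>1 w - G * F2 / 2"
      unfolding e(3,4) by (simp add: field_simps)
    show ?case
      unfolding d[OF z] w_def[symmetric] F_def[symmetric] G_def[symmetric] F2_def[symmetric] G2_def[symmetric]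
    proof (intro conjI, goal_cases)
      case 1
      show ?case using e(1) by (simp add: power2_eq_square algebra_simps)
    next
      case 2
      show ?case by simp
    next
      case 3
      show ?case unfolding \<psi>12 using \<open>R w \<noteq> 0\<close> by (simp add: divide_simps) (simp add: algebra_simps)
    next
      case 4
      have "R w * (F - G) * ((\<psi>1 w + \<psi>2 w)\<^sup>2 + (\<psi>1 w - \<psi>2 w)\<^sup>2) - 2 * R w * (F + G) * (\<psi>1 w + \<psi>2 w) * (\<psi>1 w - \<psi>2 w)
        = 4 * (R w * (F * \<psi>2 w ^ 2) - R w * (G * \<psi>1 w ^ 2))"
        by (simp add: power2_eq_square algebra_simps)
      then show ?case unfolding e4 by (simp add: power2_eq_square algebra_simps)
    next
      case 5
      have "R w * (F + G) * ((\<psi>1 w + \<psi>2 w)\<^sup>2 + (\<psi>1 w - \<psi>2 w)\<^sup>2) - 2 * R w * (F - G) * (\<psi>1 w + \<psi>2 w) * (\<psi>1 w - \<psi>2 w)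
        = 4 * (R w * (F * \<psi>2 w ^ 2) + R w * (G * \<psi>1 w ^ 2))"
        by (simp add: power2_eq_square algebra_simps)
      then show ?case unfolding e5 by (simp add: power2_eq_square algebra_simps)
    qed
  qed
qed

lemma f1_minus_g1: "f1 s - g1 s = 1 - (s\<^sup>2 + 3 * r0\<^sup>2) / \<alpha>\<^sup>2"
  using alpha_pos by (simp add: f1_def g1_def field_simps power2_eq_square)

lemma p1_minus_q1:
  assumes "0 \<le> s" "s < L"
  shows "p1 s - q1 s = - (2 * r0 / \<alpha>\<^sup>2) * inverse (1 - (s\<^sup>2 + r0\<^sup>2) / \<alpha>\<^sup>2)"
proof -
  define u where "u = L\<^sup>2 - s\<^sup>2"
  have u: "u > 0" using L_sq_minus[OF assms] by (simp add: u_def)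
  have e: "1 - (s\<^sup>2 + r0\<^sup>2) / \<alpha>\<^sup>2 = u / \<alpha>\<^sup>2" using alpha_pos by (simp add: u_def L_sq field_simps)
  show ?thesis unfolding e p1_def q1_def u_def[symmetric] using u alpha_pos by (simp add: divide_simps)
qed

lemma null_solution_boundary_data:
  assumes sol: "null_solution \<psi> \<psi>1 \<psi>2 \<psi>11 \<psi>12 \<psi>22 \<gamma> \<gamma>1 \<gamma>2 \<gamma>11 \<gamma>12 \<gamma>22"
  shows "boundary_data \<alpha> r0 \<rho>0 (\<lambda>z. \<psi> (to_null \<rho>0 z)) (\<lambda>z. \<gamma> (to_null \<rho>0 z)) (\<lambda>z. R (to_null \<rho>0 z))"
proof -
  have \<psi>: "C2_grad \<Delta> \<psi> \<psi>1 \<psi>2 \<psi>11 \<psi>12 \<psi>22" and \<gamma>: "C2_grad \<Delta> \<gamma> \<gamma>1 \<gamma>2 \<gamma>11 \<gamma>12 \<gamma>22"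
    using sol by (auto simp: null_solution_def)
  note d = D_partial[OF D_to_null[OF \<psi>, of \<rho>0]] D_partial[OF D_to_null[OF \<gamma>, of \<rho>0]] D_partial[OF D_to_null[OF R_C2, of \<rho>0]]
  show ?thesis
    unfolding boundary_data_def Let_def L_def[symmetric]
  proof (intro allI impI, goal_cases)
    case (1 s)
    then have s: "0 \<le> s" "s < L" by auto
    have b: "\<psi> (s, s) = p s + q s" "\<psi>1 (s, s) = p1 s" "\<psi>2 (s, s) = q1 s"
      "\<gamma> (s, s) = p s + q s" "\<gamma>1 (s, s) = p1 s" "\<gamma>2 (s, s) = q1 s"
      using sol s by (auto simp: null_solution_def)
    show ?case
      unfolding d[OF boundary_mem(1)[OF s]] boundary_mem(3)[OF s] b p1_minus_q1[OF s] p_plus_q[OF s]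
      by (simp add: f1_minus_g1 R_def R_diag)
  qed
qed

lemma C2_on_null_partials:
  assumes h: "C2_on (\<D> \<rho>0) h"
  obtains F1 F2 F11 F12 F22 where
    "C2_grad \<Delta> (\<lambda>w. h (from_null \<rho>0 w)) F1 F2 F11 F12 F22"
    "\<And>w. w \<in> \<Delta> \<Longrightarrow> partial (\<D> \<rho>0) (1, 0) h (from_null \<rho>0 w) = F1 w + F2 w"
    "\<And>w. w \<in> \<Delta> \<Longrightarrow> partial (\<D> \<rho>0) (0, 1) h (from_null \<rho>0 w) = F1 w - F2 w"
    "\<And>w. w \<in> \<Delta> \<Longrightarrow> partial (\<D> \<rho>0) (1, 0) (partial (\<D> \<rho>0) (1, 0) h) (from_null \<rho>0 w)
      - partial (\<D> \<rho>0) (0, 1) (partial (\<D> \<rho>0) (0, 1) h) (from_null \<rho>0 w) = 4 * F12 w"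
proof -
  obtain F1 F2 F11 F12 F22 where F: "C2_grad \<Delta> (\<lambda>w. h (from_null \<rho>0 w)) F1 F2 F11 F12 F22"
    using C2_on_from_null[OF h] unfolding L_def by blast
  note d = D_partial[OF D_to_null[OF F, of \<rho>0], unfolded to_null_from_null]
  show ?thesis
    by (rule that[OF F]) (simp_all add: d D_mem(2))
qed

lemma exterior_unique:
  assumes \<psi>: "C2_on (\<D> \<rho>0) \<psi>" and \<psi>': "C2_on (\<D> \<rho>0) \<psi>'"
    and \<gamma>: "C2_on (\<D> \<rho>0) \<gamma>" and \<gamma>': "C2_on (\<D> \<rho>0) \<gamma>'"
    and R': "C2_on (\<D> \<rho>0) R'"
    and b: "boundary_data \<alpha> r0 \<rho>0 \<psi> \<gamma> (\<lambda>z. R (to_null \<rho>0 z))" "boundary_data \<alpha> r0 \<rho>0 \<psi>' \<gamma>' R'"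
    and e: "field_equations (\<D> \<rho>0) \<psi> \<gamma> (\<lambda>z. R (to_null \<rho>0 z))"
      "field_equations (\<D> \<rho>0) \<psi>' \<gamma>' R'"
    and z: "z \<in> \<D> \<rho>0"
  shows "\<psi>' z = \<psi> z \<and> \<gamma>' z = \<gamma> z \<and> R' z = R (to_null \<rho>0 z)"
proof -
  let ?D = "\<D> \<rho>0"
  let ?dT = "partial ?D (1, 0)" and ?d\<rho> = "partial ?D (0, 1)"
  have bd: "\<psi>' (s, \<rho>0) = \<psi> (s, \<rho>0)" "\<gamma>' (s, \<rho>0) = \<gamma> (s, \<rho>0)" "R' (s, \<rho>0) = R (to_null \<rho>0 (s, \<rho>0))"
      "?d\<rho> \<psi>' (s, \<rho>0) = ?d\<rho> \<psi> (s, \<rho>0)"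
      "?d\<rho> \<gamma>' (s, \<rho>0) = ?d\<rho> \<gamma> (s, \<rho>0)"
      "?d\<rho> R' (s, \<rho>0) = ?d\<rho> (\<lambda>z. R (to_null \<rho>0 z)) (s, \<rho>0)"
    if "0 \<le> s" "s < L" for s
    using b that unfolding boundary_data_def Let_def L_def by auto
  obtain P1 P2 P11 P12 P22 where P: "C2_grad \<Delta> (\<lambda>w. \<psi> (from_null \<rho>0 w)) P1 P2 P11 P12 P22"
    and dP: "\<And>w. w \<in> \<Delta> \<Longrightarrow> ?dT \<psi> (from_null \<rho>0 w) = P1 w + P2 w"
      "\<And>w. w \<in> \<Delta> \<Longrightarrow> ?d\<rho> \<psi> (from_null \<rho>0 w) = P1 w - P2 w"
      "\<And>w. w \<in> \<Delta> \<Longrightarrow> ?dT (?dT \<psi>) (from_null \<rho>0 w)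
        - ?d\<rho> (?d\<rho> \<psi>) (from_null \<rho>0 w) = 4 * P12 w"
    using C2_on_null_partials[OF \<psi>] by blast
  obtain P1' P2' P11' P12' P22' where P': "C2_grad \<Delta> (\<lambda>w. \<psi>' (from_null \<rho>0 w)) P1' P2' P11' P12' P22'"
    and dP': "\<And>w. w \<in> \<Delta> \<Longrightarrow> ?dT \<psi>' (from_null \<rho>0 w) = P1' w + P2' w"
      "\<And>w. w \<in> \<Delta> \<Longrightarrow> ?d\<rho> \<psi>' (from_null \<rho>0 w) = P1' w - P2' w"
      "\<And>w. w \<in> \<Delta> \<Longrightarrow> ?dT (?dT \<psi>') (from_null \<rho>0 w)
        - ?d\<rho> (?d\<rho> \<psi>') (from_null \<rho>0 w) = 4 * P12' w"
    using C2_on_null_partials[OF \<psi>'] by blast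
  obtain G1 G2 G11 G12 G22 where G: "C2_grad \<Delta> (\<lambda>w. \<gamma> (from_null \<rho>0 w)) G1 G2 G11 G12 G22"
    and dG: "\<And>w. w \<in> \<Delta> \<Longrightarrow> ?dT \<gamma> (from_null \<rho>0 w) = G1 w + G2 w"
      "\<And>w. w \<in> \<Delta> \<Longrightarrow> ?d\<rho> \<gamma> (from_null \<rho>0 w) = G1 w - G2 w"
      "\<And>w. w \<in> \<Delta> \<Longrightarrow> ?dT (?dT \<gamma>) (from_null \<rho>0 w)
        - ?d\<rho> (?d\<rho> \<gamma>) (from_null \<rho>0 w) = 4 * G12 w"
    using C2_on_null_partials[OF \<gamma>] by blast
  obtain G1' G2' G11' G12' G22' where G': "C2_grad \<Delta> (\<lambda>w. \<gamma>' (from_null \<rho>0 w)) G1' G2' G11' G12' G22'"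
    and dG': "\<And>w. w \<in> \<Delta> \<Longrightarrow> ?dT \<gamma>' (from_null \<rho>0 w) = G1' w + G2' w"
      "\<And>w. w \<in> \<Delta> \<Longrightarrow> ?d\<rho> \<gamma>' (from_null \<rho>0 w) = G1' w - G2' w"
      "\<And>w. w \<in> \<Delta> \<Longrightarrow> ?dT (?dT \<gamma>') (from_null \<rho>0 w)
        - ?d\<rho> (?d\<rho> \<gamma>') (from_null \<rho>0 w) = 4 * G12' w"
    using C2_on_null_partials[OF \<gamma>'] by blast
  obtain S1 S2 S11 S12 S22 where S: "C2_grad \<Delta> (\<lambda>w. R' (from_null \<rho>0 w)) S1 S2 S11 S12 S22"
    and dS: "\<And>w. w \<in> \<Delta> \<Longrightarrow> ?dT R' (from_null \<rho>0 w) = S1 w + S2 w"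
      "\<And>w. w \<in> \<Delta> \<Longrightarrow> ?d\<rho> R' (from_null \<rho>0 w) = S1 w - S2 w"
      "\<And>w. w \<in> \<Delta> \<Longrightarrow> ?dT (?dT R') (from_null \<rho>0 w)
        - ?d\<rho> (?d\<rho> R') (from_null \<rho>0 w) = 4 * S12 w"
    using C2_on_null_partials[OF R'] by blast
  note RD = D_partial[OF D_to_null[OF R_C2, of \<rho>0]]
  have fe: "?dT (?dT \<gamma>) v - ?d\<rho> (?d\<rho> \<gamma>) v
        = (?d\<rho> \<psi> v)\<^sup>2 - (?dT \<psi> v)\<^sup>2"
      "?dT (?dT \<psi>) v - ?d\<rho> (?d\<rho> \<psi>) v
        = ?d\<rho> (\<lambda>z. R (to_null \<rho>0 z)) v / R (to_null \<rho>0 v) * ?d\<rho> \<psi> v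
          - ?dT (\<lambda>z. R (to_null \<rho>0 z)) v / R (to_null \<rho>0 v) * ?dT \<psi> v"
    if "v \<in> ?D" for v
    using e(1) that unfolding field_equations_def Let_def by (auto simp: algebra_simps)
  have fe': "?dT (?dT \<gamma>') v - ?d\<rho> (?d\<rho> \<gamma>') v
        = (?d\<rho> \<psi>' v)\<^sup>2 - (?dT \<psi>' v)\<^sup>2"
      "?dT (?dT R') v - ?d\<rho> (?d\<rho> R') v = 0"
      "?dT (?dT \<psi>') v - ?d\<rho> (?d\<rho> \<psi>') v
        = ?d\<rho> R' v / R' v * ?d\<rho> \<psi>' v - ?dT R' v / R' v * ?dT \<psi>' v"
    if "v \<in> ?D" for v
    using e(2) that unfolding field_equations_def Let_def by (auto simp: algebra_simps)
  have diag: "?d\<rho> (\<lambda>z. R (to_null \<rho>0 z)) (s, \<rho>0) = f1 s - g1 s" if "0 \<le> s" "s < L" for s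
    using RD(2)[OF boundary_mem(1)[OF that]] boundary_mem(3)[OF that] by simp
  have Req: "R' (from_null \<rho>0 w) = R w" if w: "w \<in> \<Delta>" for w
  proof -
    have "R' (from_null \<rho>0 w) - R w = 0"
    proof (rule wave_unique[OF C2_grad_diff[OF S R_C2] _ _ w])
      fix w assume w: "w \<in> \<Delta>"
      show "S12 w - 0 = 0" using dS(3)[OF w] fe'(2)[OF D_mem(2)[OF w]] by simp
    next
      fix s assume s: "0 \<le> s" "s < L"
      show "R' (from_null \<rho>0 (s, s)) - R (s, s) = 0 \<and> S1 (s, s) - f1 (fst (s, s)) - (S2 (s, s) - g1 (snd (s, s))) = 0"
        using bd(3,6)[OF s] dS(2)[OF boundary_mem(2)[OF s]] diag[OF s] boundary_mem(3,4)[OF s, of \<rho>0] by simp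
    qed
    then show ?thesis by simp
  qed
  then have Req': "R' v = R (to_null \<rho>0 v)" if "v \<in> ?D" for v
    using D_mem(1)[OF that] by fastforce
  have dR': "partial ?D v R' u = partial ?D v (\<lambda>z. R (to_null \<rho>0 z)) u" if "u \<in> ?D" for u v
    by (rule partial_cong[OF Req' that])
  have alg: "2 * R w * X12 + f1 (fst w) * X2 + g1 (snd w) * X1 = 0"
    if "w \<in> \<Delta>" "4 * X12 = (f1 (fst w) - g1 (snd w)) / R w * (X1 - X2) - (f1 (fst w) + g1 (snd w)) / R w * (X1 + X2)"
    for w X1 X2 X12
  proof -
    have "4 * X12 = ((f1 (fst w) - g1 (snd w)) * (X1 - X2) - (f1 (fst w) + g1 (snd w)) * (X1 + X2)) / R w"
      unfolding that(2) diff_divide_distrib[of "_ * _"] by (simp only: times_divide_eq_left)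
    then have "4 * X12 * R w = (f1 (fst w) - g1 (snd w)) * (X1 - X2) - (f1 (fst w) + g1 (snd w)) * (X1 + X2)"
      using R_pos[OF that(1)] by simp
    then show ?thesis by (simp add: algebra_simps)
  qed
  have \<psi>eq: "\<psi>' (from_null \<rho>0 w) = \<psi> (from_null \<rho>0 w)" if w: "w \<in> \<Delta>" for w
  proof -
    have "\<psi>' (from_null \<rho>0 w) - \<psi> (from_null \<rho>0 w) = 0"
    proof (rule psi_unique[OF C2_grad_diff[OF P' P] _ _ w])
      fix w assume w: "w \<in> \<Delta>"
      note v = D_mem(2)[OF w, of \<rho>0]
      have "4 * P12' w = (f1 (fst w) - g1 (snd w)) / R w * (P1' w - P2' w) - (f1 (fst w) + g1 (snd w)) / R w * (P1' w + P2' w)"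
        using fe'(3)[OF v] dP'[OF w] dR'[OF v] RD[OF v] Req[OF w] by simp
      moreover have "4 * P12 w = (f1 (fst w) - g1 (snd w)) / R w * (P1 w - P2 w) - (f1 (fst w) + g1 (snd w)) / R w * (P1 w + P2 w)"
        using fe(2)[OF v] dP[OF w] RD[OF v] by simp
      ultimately show "2 * R w * (P12' w - P12 w) + f1 (fst w) * (P2' w - P2 w) + g1 (snd w) * (P1' w - P1 w) = 0"
        using alg[OF w, of "P12' w" "P1' w" "P2' w"] alg[OF w, of "P12 w" "P1 w" "P2 w"] by (simp add: algebra_simps)
    next
      fix s assume s: "0 \<le> s" "s < L"
      show "\<psi>' (from_null \<rho>0 (s, s)) - \<psi> (from_null \<rho>0 (s, s)) = 0 \<and> P1' (s, s) - P1 (s, s) - (P2' (s, s) - P2 (s, s)) = 0"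
        using bd(1,4)[OF s] dP(2)[OF boundary_mem(2)[OF s]] dP'(2)[OF boundary_mem(2)[OF s]] boundary_mem(3,4)[OF s, of \<rho>0] by simp
    qed
    then show ?thesis by simp
  qed
  then have \<psi>eq': "\<psi>' v = \<psi> v" if "v \<in> ?D" for v
    using D_mem(1)[OF that] by fastforce
  have d\<psi>': "partial ?D v \<psi>' u = partial ?D v \<psi> u" if "u \<in> ?D" for u v
    by (rule partial_cong[OF \<psi>eq' that])
  have \<gamma>eq: "\<gamma>' (from_null \<rho>0 w) = \<gamma> (from_null \<rho>0 w)" if w: "w \<in> \<Delta>" for w
  proof -
    have "\<gamma>' (from_null \<rho>0 w) - \<gamma> (from_null \<rho>0 w) = 0"
    proof (rule wave_unique[OF C2_grad_diff[OF G' G] _ _ w])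
      fix w assume w: "w \<in> \<Delta>"
      note v = D_mem(2)[OF w, of \<rho>0]
      show "G12' w - G12 w = 0"
        using fe'(1)[OF v] fe(1)[OF v] dG(3)[OF w] dG'(3)[OF w] d\<psi>'[OF v] by simp
    next
      fix s assume s: "0 \<le> s" "s < L"
      show "\<gamma>' (from_null \<rho>0 (s, s)) - \<gamma> (from_null \<rho>0 (s, s)) = 0 \<and> G1' (s, s) - G1 (s, s) - (G2' (s, s) - G2 (s, s)) = 0"
        using bd(2,5)[OF s] dG(2)[OF boundary_mem(2)[OF s]] dG'(2)[OF boundary_mem(2)[OF s]] boundary_mem(3,4)[OF s, of \<rho>0] by simp
    qed
    then show ?thesis by simp
  qed
  show ?thesis
    using \<psi>eq'[OF z] \<gamma>eq[OF D_mem(1)[OF z]] Req'[OF z] by simp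
qed

end

section \<open>Curvature of diagonal metrics\<close>

lemma matrix_inv_diagonal:
  fixes A :: "real^'n^'n"
  assumes A: "\<And>i j. A $ i $ j = (if i = j then d i else 0)" and d: "\<And>i. d i \<noteq> 0"
  shows "matrix_inv A $ i $ j = (if i = j then 1 / d i else 0)"
proof -
  define B :: "real^'n^'n" where "B = (\<chi> i j. if i = j then 1 / d i else 0)"
  have AB: "A ** B = mat 1"
    using d by (simp add: matrix_matrix_mult_def B_def A mat_def vec_eq_iff if_distrib[of "\<lambda>x. x * _"] cong: if_cong)
  have BA: "B ** A = mat 1"
    using d by (simp add: matrix_matrix_mult_def B_def A mat_def vec_eq_iff if_distrib[of "\<lambda>x. x * _"] cong: if_cong)
  have "invertible A" using AB BA unfolding invertible_def by blast
  then have "matrix_inv A ** A = mat 1"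
    unfolding invertible_def matrix_inv_def by (rule someI2_ex) blast
  then have "matrix_inv A = B"
    using AB by (metis matrix_mul_assoc matrix_mul_lid matrix_mul_rid)
  then show ?thesis by (simp add: B_def)
qed

lemma partial_const:
  assumes "convex M" "interior M \<noteq> {}" "x \<in> M"
  shows "partial M e (\<lambda>y. c) x = 0"
  using partial_eq[OF assms has_derivative_const] .

lemma christoffel_diagonal:
  assumes M: "convex M" "interior M \<noteq> {}" "x \<in> M"
    and g: "\<And>y a b. y \<in> M \<Longrightarrow> g y $ a $ b = (if a = b then G a y else 0)" and nz: "\<And>a. G a x \<noteq> 0"
  shows "christoffel M g i j k x = 1 / (2 * G i x) *
    ((if i = k then partial M (axis j 1) (G i) x else 0) + (if i = j then partial M (axis k 1) (G i) x else 0)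
     - (if j = k then partial M (axis i 1) (G j) x else 0))"
proof -
  have p: "partial M e (\<lambda>y. g y $ a $ b) x = (if a = b then partial M e (G a) x else 0)" for e a b
  proof (cases "a = b")
    case True
    then show ?thesis using partial_cong[of M "\<lambda>y. g y $ a $ b" "G a"] g M(3) by simp
  next
    case False
    then show ?thesis using partial_cong[of M "\<lambda>y. g y $ a $ b" "\<lambda>y. 0"] g M partial_const[OF M, of e 0] by simp
  qed
  have inv: "matrix_inv (g x) $ i $ l = (if i = l then 1 / G i x else 0)" for l
    by (rule matrix_inv_diagonal) (use g M nz in auto)
  show ?thesis
    unfolding christoffel_def p inv
    by (simp add: if_distrib[of "\<lambda>x. x * _"] cong: if_cong)
qed

lemma vector_4:
  "(vector [a, b, c, d] :: real^4) $ 1 = a" "(vector [a, b, c, d] :: real^4) $ 2 = b"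
  "(vector [a, b, c, d] :: real^4) $ 3 = c" "(vector [a, b, c, d] :: real^4) $ 4 = d"
  unfolding vector_def by simp_all

definition lift_region :: "(real \<times> real) set \<Rightarrow> (real^4) set" where
  "lift_region D = {x. (x $ 1, x $ 2) \<in> D}"

lemma convex_lift_region: "convex D \<Longrightarrow> convex (lift_region D)"
  using convex_linear_vimage[of "\<lambda>x::real^4. (x $ 1, x $ 2)" D]
  by (simp add: lift_region_def vimage_def linear_iff)

lemma interior_lift_region:
  assumes "interior D \<noteq> {}"
  shows "interior (lift_region D) \<noteq> {}"
proof -
  let ?U = "(\<lambda>x::real^4. (x $ 1, x $ 2)) -` interior D"
  have "open ?U"
    by (intro open_vimage open_interior continuous_intros)
  moreover have "?U \<subseteq> lift_region D"
    using interior_subset[of D] by (auto simp: lift_region_def)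
  ultimately have "?U \<subseteq> interior (lift_region D)" by (intro interior_maximal)
  moreover obtain a b where "(a, b) \<in> interior D" using assms by fastforce
  then have "(\<chi> i. if i = 1 then a else b) \<in> ?U" by simp
  ultimately show ?thesis by blast
qed

lemma partial_lift:
  assumes D: "convex D" "interior D \<noteq> {}" and f: "C1_grad D f f1 f2" and x: "x \<in> lift_region D"
  shows "partial (lift_region D) (axis j 1) (\<lambda>y. f (y $ 1, y $ 2)) x
    = (if j = 1 then f1 (x $ 1, x $ 2) else if j = 2 then f2 (x $ 1, x $ 2) else 0)"
proof -
  have p: "(x $ 1, x $ 2) \<in> D" using x by (simp add: lift_region_def)
  have d: "((\<lambda>y::real^4. (y $ 1, y $ 2)) has_derivative (\<lambda>v. (v $ 1, v $ 2))) (at x within lift_region D)"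
    by (intro has_derivative_Pair bounded_linear_imp_has_derivative bounded_linear_vec_nth)
  have sub: "(\<lambda>y. (y $ 1, y $ 2)) ` lift_region D \<subseteq> D" by (auto simp: lift_region_def)
  from has_derivative_in_compose[OF d has_derivative_subset[OF C1_grad_derivative[OF f p] sub]]
  have "((\<lambda>y. f (y $ 1, y $ 2)) has_derivative (\<lambda>v. f1 (x $ 1, x $ 2) * v $ 1 + f2 (x $ 1, x $ 2) * v $ 2)) (at x within lift_region D)"
    by simp
  from partial_eq[OF convex_lift_region[OF D(1)] interior_lift_region[OF D(2)] x this]
  show ?thesis by (simp add: axis_def)
qed

lemma C1_grad_if:
  assumes "P \<Longrightarrow> C1_grad S f f1 f2" "\<not> P \<Longrightarrow> C1_grad S g g1 g2"
  shows "C1_grad S (\<lambda>p. if P then f p else g p) (\<lambda>p. if P then f1 p else g1 p) (\<lambda>p. if P then f2 p else g2 p)"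
  using assms by (cases P) auto

lemma ricci_diagonal:
  fixes A A1 A2 A11 A12 A22 :: "4 \<Rightarrow> real \<times> real \<Rightarrow> real" and \<epsilon> :: "4 \<Rightarrow> real"
  assumes D: "convex D" "interior D \<noteq> {}"
    and A: "\<And>i. C2_grad D (A i) (A1 i) (A2 i) (A11 i) (A12 i) (A22 i)" and \<epsilon>: "\<And>i. \<epsilon> i * \<epsilon> i = 1"
    and g: "\<forall>y\<in>lift_region D. \<forall>a b. g y $ a $ b = (if a = b then \<epsilon> a * exp (2 * A a (y $ 1, y $ 2)) else 0)"
    and x: "x \<in> lift_region D"
  defines "p \<equiv> (x $ 1, x $ 2)"
  defines "dA \<equiv> \<lambda>i j. if j = 1 then A1 i p else if j = 2 then A2 i p else 0"
  defines "ddA \<equiv> \<lambda>i j k. if k = 1 then (if j = 1 then A11 i p else if j = 2 then A12 i p else 0)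
     else if k = 2 then (if j = 1 then A12 i p else if j = 2 then A22 i p else 0) else 0"
  defines "E \<equiv> \<lambda>j i. \<epsilon> j * \<epsilon> i * exp (2 * A j p - 2 * A i p)"
  defines "\<Gamma> \<equiv> \<lambda>i j k. (if i = k then dA i j else 0) + (if i = j then dA i k else 0) - (if j = k then E j i * dA j i else 0)"
  defines "d\<Gamma> \<equiv> \<lambda>l i j k. if l = 1 \<or> l = 2 then (if i = k then ddA i j l else 0) + (if i = j then ddA i k l else 0)
     - (if j = k then E j i * (2 * (dA j l - dA i l)) * dA j i + E j i * ddA j i l else 0) else 0"
  shows "ricci (lift_region D) g i j x =
     (\<Sum>k\<in>UNIV. d\<Gamma> k k i j - d\<Gamma> j k i k + (\<Sum>l\<in>UNIV. \<Gamma> k k l * \<Gamma> l i j - \<Gamma> k j l * \<Gamma> l i k))"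
proof -
  let ?M = "lift_region D"
  note M = convex_lift_region[OF D(1)] interior_lift_region[OF D(2)]
  note A = C2_grad_C1_grad[OF A]
  define dAf where "dAf i j q = (if j = 1 then A1 i q else if j = 2 then A2 i q else 0)" for i j :: 4 and q
  define Ef where "Ef j i q = \<epsilon> j * \<epsilon> i * exp (2 * A j q - 2 * A i q)" for j i q
  define \<Gamma>f where "\<Gamma>f i j k q = (if i = k then dAf i j q else 0) + (if i = j then dAf i k q else 0)
    - (if j = k then Ef j i q * dAf j i q else 0)" for i j k q
  have \<epsilon>nz: "\<epsilon> i \<noteq> 0" for i using \<epsilon>[of i] by auto
  have ch: "christoffel ?M g i j k y = \<Gamma>f i j k (y $ 1, y $ 2)" if y: "y \<in> ?M" for i j k y
  proof -
    let ?G = "\<lambda>a y. \<epsilon> a * exp (2 * A a (y $ 1, y $ 2))"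
    have dG: "C1_grad D (\<lambda>q. \<epsilon> a * exp (2 * A a q)) (\<lambda>q. \<epsilon> a * exp (2 * A a q) * (2 * A1 a q)) (\<lambda>q. \<epsilon> a * exp (2 * A a q) * (2 * A2 a q))" for a
      by (rule C1_grad_cong[OF C1_grad_mult[OF C1_grad_const C1_grad_compose[where \<phi> = exp and \<phi>' = exp,
            OF C1_grad_mult[OF C1_grad_const A(1)]]]])
        (auto intro!: continuous_intros C1_grad_continuous(1)[OF A(1)])
    have p: "partial ?M (axis l 1) (?G a) y = 2 * ?G a y * dAf a l (y $ 1, y $ 2)" for l a
      using partial_lift[OF D dG y] by (simp add: dAf_def)
    have e: "exp (2 * A j q - 2 * A i q) = exp (2 * A j q) / exp (2 * A i q)" for q by (rule exp_diff)
    have inv: "1 / \<epsilon> i = \<epsilon> i" using \<epsilon>[of i] \<epsilon>nz[of i] by (simp add: field_simps)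
    have "christoffel ?M g i j k y = 1 / (2 * ?G i y) *
      ((if i = k then partial ?M (axis j 1) (?G i) y else 0) + (if i = j then partial ?M (axis k 1) (?G i) y else 0)
       - (if j = k then partial ?M (axis i 1) (?G j) y else 0))"
      by (rule christoffel_diagonal[OF M y]) (use g \<epsilon>nz in auto)
    also have "\<dots> = (1 / \<epsilon> i) * (\<epsilon> i * (if i = k then dAf i j (y $ 1, y $ 2) else 0) + \<epsilon> i * (if i = j then dAf i k (y $ 1, y $ 2) else 0)
        - (if j = k then \<epsilon> j * exp (2 * A j (y $ 1, y $ 2)) / exp (2 * A i (y $ 1, y $ 2)) * dAf j i (y $ 1, y $ 2) else 0))"
      unfolding p by (simp add: field_simps)
    also have "\<dots> = \<Gamma>f i j k (y $ 1, y $ 2)"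
      unfolding \<Gamma>f_def Ef_def e using \<epsilon>nz[of i] \<epsilon>[of i] inv by (auto simp: right_diff_distrib distrib_left)
    finally show ?thesis .
  qed
  have dd: "C1_grad D (dAf i j) (\<lambda>q. if j = 1 then A11 i q else if j = 2 then A12 i q else 0)
      (\<lambda>q. if j = 1 then A12 i q else if j = 2 then A22 i q else 0)" for i j
    unfolding dAf_def[abs_def] by (intro C1_grad_if A C1_grad_const)
  have dE: "C1_grad D (Ef j i) (\<lambda>q. Ef j i q * (2 * (A1 j q - A1 i q))) (\<lambda>q. Ef j i q * (2 * (A2 j q - A2 i q)))" for i j
    unfolding Ef_def[abs_def]
    by (rule C1_grad_cong[OF C1_grad_mult[OF C1_grad_const C1_grad_compose[where \<phi> = exp and \<phi>' = exp,
          OF C1_grad_diff[OF C1_grad_mult[OF C1_grad_const[of D 2] A(1)[of j]] C1_grad_mult[OF C1_grad_const[of D 2] A(1)[of i]]]]],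
        of _ "\<epsilon> j * \<epsilon> i"])
      (auto intro!: continuous_intros C1_grad_continuous(1)[OF A(1)] simp: algebra_simps)
  have z: "C1_grad D (\<lambda>q. 0) (\<lambda>q. 0) (\<lambda>q. 0)" by (rule C1_grad_const)
  have d\<Gamma>f: "partial ?M (axis l 1) (christoffel ?M g i j k) x = d\<Gamma> l i j k" for i j k l
  proof -
    note G = C1_grad_diff[OF C1_grad_add[OF C1_grad_if[of "i = k", OF dd[of i j] z] C1_grad_if[of "i = j", OF dd[of i k] z]]
        C1_grad_if[of "j = k", OF C1_grad_mult[OF dE[of j i] dd[of j i]] z], folded \<Gamma>f_def]
    have "partial ?M (axis l 1) (christoffel ?M g i j k) x = partial ?M (axis l 1) (\<lambda>y. \<Gamma>f i j k (y $ 1, y $ 2)) x"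
      by (rule partial_cong[OF ch x])
    also have "\<dots> = d\<Gamma> l i j k"
      unfolding partial_lift[OF D G x] d\<Gamma>_def p_def[symmetric]
      by (simp add: ddA_def dA_def E_def dAf_def Ef_def)
    finally show ?thesis .
  qed
  have \<Gamma>: "christoffel ?M g i j k x = \<Gamma> i j k" for i j k
    unfolding ch[OF x] by (simp add: \<Gamma>f_def \<Gamma>_def E_def Ef_def dA_def dAf_def p_def)
  show ?thesis
    unfolding ricci_def d\<Gamma>f \<Gamma> ..
qed

lemma vacuum_if:
  fixes a b c :: "real \<times> real \<Rightarrow> real"
  assumes D: "convex D" "interior D \<noteq> {}"
    and a: "C2_grad D a a1 a2 a11 a12 a22" and b: "C2_grad D b b1 b2 b11 b12 b22" and c: "C2_grad D c c1 c2 c11 c12 c22"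
    and g: "\<And>y. y \<in> lift_region D \<Longrightarrow> g y = diag4 (- exp (2 * a (y $ 1, y $ 2))) (exp (2 * a (y $ 1, y $ 2)))
       (exp (2 * b (y $ 1, y $ 2))) (exp (2 * c (y $ 1, y $ 2)))"
    and e: "\<And>p. p \<in> D \<Longrightarrow> a22 p - a11 p - (b11 p + c11 p) + (b1 p + c1 p) * a1 p + (b2 p + c2 p) * a2 p = b1 p ^ 2 + c1 p ^ 2"
      "\<And>p. p \<in> D \<Longrightarrow> a11 p - a22 p - (b22 p + c22 p) + (b1 p + c1 p) * a1 p + (b2 p + c2 p) * a2 p = b2 p ^ 2 + c2 p ^ 2"
      "\<And>p. p \<in> D \<Longrightarrow> (b1 p + c1 p) * a2 p + (b2 p + c2 p) * a1 p - (b12 p + c12 p) = b1 p * b2 p + c1 p * c2 p"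
      "\<And>p. p \<in> D \<Longrightarrow> b11 p - b22 p + (b1 p + c1 p) * b1 p - (b2 p + c2 p) * b2 p = 0"
      "\<And>p. p \<in> D \<Longrightarrow> c11 p - c22 p + (b1 p + c1 p) * c1 p - (b2 p + c2 p) * c2 p = 0"
  shows "vacuum (lift_region D) g"
  unfolding vacuum_def
proof (intro ballI allI)
  fix x i j assume x: "x \<in> lift_region D"
  define p where "p = (x $ 1, x $ 2)"
  have p: "p \<in> D" using x by (simp add: p_def lift_region_def)
  define A where "A i = (if i = 1 \<or> i = 2 then a else if i = 3 then b else c)" for i :: 4
  define A1 where "A1 i = (if i = 1 \<or> i = 2 then a1 else if i = 3 then b1 else c1)" for i :: 4
  define A2 where "A2 i = (if i = 1 \<or> i = 2 then a2 else if i = 3 then b2 else c2)" for i :: 4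
  define A11 where "A11 i = (if i = 1 \<or> i = 2 then a11 else if i = 3 then b11 else c11)" for i :: 4
  define A12 where "A12 i = (if i = 1 \<or> i = 2 then a12 else if i = 3 then b12 else c12)" for i :: 4
  define A22 where "A22 i = (if i = 1 \<or> i = 2 then a22 else if i = 3 then b22 else c22)" for i :: 4
  define \<epsilon> :: "4 \<Rightarrow> real" where "\<epsilon> i = (if i = 1 then -1 else 1)" for i
  note As = A_def A1_def A2_def A11_def A12_def A22_def \<epsilon>_def
  have C2: "C2_grad D (A i) (A1 i) (A2 i) (A11 i) (A12 i) (A22 i)" for i
    using a b c by (simp add: As)
  have gA: "\<forall>y\<in>lift_region D. \<forall>i j. g y $ i $ j = (if i = j then \<epsilon> i * exp (2 * A i (y $ 1, y $ 2)) else 0)"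
    by (simp add: g diag4_def vector_4 As forall_4)
  have \<epsilon>: "\<epsilon> i * \<epsilon> i = 1" for i by (simp add: \<epsilon>_def)
  note ric = ricci_diagonal[OF D C2 \<epsilon> gA x, folded p_def]
  have H: "b22 p = b11 p + (b1 p + c1 p) * b1 p - (b2 p + c2 p) * b2 p"
    "c22 p = c11 p + (b1 p + c1 p) * c1 p - (b2 p + c2 p) * c2 p"
    "a22 p = a11 p + (b11 p + c11 p) - (b1 p + c1 p) * a1 p - (b2 p + c2 p) * a2 p + b1 p ^ 2 + c1 p ^ 2"
    "b12 p = (b1 p + c1 p) * a2 p + (b2 p + c2 p) * a1 p - c12 p - b1 p * b2 p - c1 p * c2 p"
    using e[OF p] by linarith+
  have diag: "ricci (lift_region D) g 1 1 x = 0" "ricci (lift_region D) g 3 3 x = 0" "ricci (lift_region D) g 4 4 x = 0"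
    unfolding ric by (simp_all add: sum_4 As H power2_eq_square algebra_simps)
  have diag2: "ricci (lift_region D) g 2 2 x = 0"
    unfolding ric using e(2)[OF p] by (simp add: sum_4 As power2_eq_square) (simp add: algebra_simps)
  have off: "ricci (lift_region D) g i j x = 0" if "i \<noteq> j"
    unfolding ric using exhaust_4[of i] exhaust_4[of j] that
    by (elim disjE) (simp_all add: sum_4 As H power2_eq_square algebra_simps)
  show "ricci (lift_region D) g i j x = 0"
    using diag diag2 off exhaust_4[of i] by (cases "i = j") auto
qed

section \<open>Matching across a cylinder\<close>

lemma axis_nth: "axis i x $ j = (if j = i then x else 0)"
  by (simp add: axis_def)

lemma convex_surface_params: "convex (surface_params \<alpha> r0)"
proof -
  have "surface_params \<alpha> r0 = {\<sigma>. axis 1 1 \<bullet> \<sigma> \<ge> 0} \<inter> {\<sigma>. axis 1 1 \<bullet> \<sigma> < sqrt (\<alpha>\<^sup>2 - r0\<^sup>2)}"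
    by (auto simp: surface_params_def inner_axis inner_commute)
  then show ?thesis
    by (simp add: convex_Int convex_halfspace_ge convex_halfspace_lt)
qed

lemma interior_surface_params:
  assumes "0 < sqrt (\<alpha>\<^sup>2 - r0\<^sup>2)"
  shows "interior (surface_params \<alpha> r0) \<noteq> {}"
proof -
  let ?U = "{\<sigma>::real^3. 0 < \<sigma> $ 1 \<and> \<sigma> $ 1 < sqrt (\<alpha>\<^sup>2 - r0\<^sup>2)}"
  have "open ?U" by (intro open_Collect_conj open_Collect_less continuous_intros)
  moreover have "?U \<subseteq> surface_params \<alpha> r0" by (auto simp: surface_params_def)
  ultimately have "?U \<subseteq> interior (surface_params \<alpha> r0)" by (intro interior_maximal)
  moreover have "(\<chi> i. sqrt (\<alpha>\<^sup>2 - r0\<^sup>2) / 2) \<in> ?U" using assms by simp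
  ultimately show ?thesis by blast
qed

definition surface_index :: "3 \<Rightarrow> 4" where
  "surface_index a = (if a = 1 then 1 else if a = 2 then 4 else 3)"

lemma surface_index_neq: "surface_index a \<noteq> 2"
  by (simp add: surface_index_def)

lemma surface_index_inj: "surface_index a = surface_index b \<longleftrightarrow> a = b"
  using exhaust_3[of a] exhaust_3[of b] by (auto simp: surface_index_def)

lemma surface_index_surj:
  assumes "i \<noteq> 2"
  obtains a where "i = surface_index a"
proof -
  have "i = surface_index 1 \<or> i = surface_index 2 \<or> i = surface_index 3"
    using exhaust_4[of i] assms by (auto simp: surface_index_def)
  then show ?thesis using that by blast
qed

lemma tangent_cylinder:
  assumes W: "convex W" "interior W \<noteq> {}" "\<sigma> \<in> W"
  shows "tangent W (cylinder c) a \<sigma> = axis (surface_index a) 1"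
proof -
  have p: "partial W (axis a 1) (\<lambda>\<tau>. \<tau> $ b) \<sigma> = axis a 1 $ b" for a b :: 3
    by (rule partial_eq[OF W]) (intro bounded_linear_imp_has_derivative bounded_linear_vec_nth)
  have "tangent W (cylinder c) a \<sigma> $ i = axis (surface_index a) 1 $ i" for i
    using exhaust_4[of i] exhaust_3[of a]
    by (auto simp: tangent_def cylinder_def vector_4 p partial_const[OF W] axis_nth surface_index_def)
  then show ?thesis by (simp add: vec_eq_iff)
qed

lemma diagonal_mult:
  fixes A :: "real^'n^'n"
  assumes "\<And>i j. A $ i $ j = (if i = j then d i else 0)"
  shows "(A *v v) $ i = d i * v $ i"
  by (simp add: matrix_vector_mult_def assms if_distrib[of "\<lambda>x. x * _"] cong: if_cong)

locale diagonal_cylinder =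
  fixes M :: "(real^4) set" and g :: metric and G :: "4 \<Rightarrow> real^4 \<Rightarrow> real" and W :: "(real^3) set"
    and c :: real and \<sigma> :: "real^3"
  assumes M: "convex M" "interior M \<noteq> {}" "cylinder c \<sigma> \<in> M" and W: "convex W" "interior W \<noteq> {}" "\<sigma> \<in> W"
    and g: "\<And>y i j. y \<in> M \<Longrightarrow> g y $ i $ j = (if i = j then G i y else 0)"
    and G_nz: "\<And>i. G i (cylinder c \<sigma>) \<noteq> 0" and G2: "G 2 (cylinder c \<sigma>) > 0"
begin

lemma first_form_eq:
  "first_form g W (cylinder c) a b \<sigma> = (if a = b then G (surface_index a) (cylinder c \<sigma>) else 0)"
  unfolding first_form_def tangent_cylinder[OF W]
  by (auto simp: inner_axis' diagonal_mult[OF g[OF M(3)]] axis_nth surface_index_inj)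

lemma unit_normal_iff:
  "unit_normal g W (cylinder c) \<sigma> n \<and> n $ 2 > 0 \<longleftrightarrow> n = axis 2 (1 / sqrt (G 2 (cylinder c \<sigma>)))"
proof
  let ?G = "\<lambda>i. G i (cylinder c \<sigma>)"
  note gm = diagonal_mult[OF g[OF M(3)]]
  {
    assume n: "unit_normal g W (cylinder c) \<sigma> n \<and> n $ 2 > 0"
    have "n $ i = 0" if i: "i \<noteq> 2" for i
    proof -
      obtain a where a: "i = surface_index a" using surface_index_surj[OF i] by blast
      have "n \<bullet> (g (cylinder c \<sigma>) *v axis i 1) = 0"
        using n unfolding unit_normal_def tangent_cylinder[OF W] a by blast
      moreover have "n \<bullet> (g (cylinder c \<sigma>) *v axis i 1) = n $ i * ?G i"
        by (simp add: inner_vec_def gm axis_nth if_distrib[of "\<lambda>x. _ * x"] cong: if_cong)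
      ultimately show ?thesis using G_nz by simp
    qed
    then have n2: "n = axis 2 (n $ 2)" by (simp add: vec_eq_iff axis_nth)
    have "n \<bullet> (g (cylinder c \<sigma>) *v n) = 1" using n by (simp add: unit_normal_def)
    moreover have "n \<bullet> (g (cylinder c \<sigma>) *v n) = ?G 2 * (n $ 2)\<^sup>2"
      by (subst n2, subst (2) n2) (simp add: inner_axis' gm axis_nth power2_eq_square)
    ultimately have "(n $ 2)\<^sup>2 = 1 / ?G 2" using G2 by (simp add: field_simps)
    then have "n $ 2 = 1 / sqrt (?G 2)" using n by (metis less_imp_le real_sqrt_divide real_sqrt_one real_sqrt_unique)
    with n2 show "n = axis 2 (1 / sqrt (?G 2))" by simp
  }
  assume n: "n = axis 2 (1 / sqrt (?G 2))"
  have "n \<bullet> (g (cylinder c \<sigma>) *v n) = 1"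
    using G2 by (simp add: n inner_axis' gm axis_nth)
  moreover have "n \<bullet> (g (cylinder c \<sigma>) *v axis (surface_index a) 1) = 0" for a
    using surface_index_neq[of a] by (auto simp: n inner_axis' gm axis_nth)
  ultimately show "unit_normal g W (cylinder c) \<sigma> n \<and> n $ 2 > 0"
    using G2 by (simp add: unit_normal_def tangent_cylinder[OF W] n axis_nth)
qed

lemma second_form_eq:
  assumes n: "n = axis 2 (1 / sqrt (G 2 (cylinder c \<sigma>)))"
  shows "second_form M g W (cylinder c) n a b \<sigma> =
    (if a = b then partial M (axis 2 1) (G (surface_index a)) (cylinder c \<sigma>) / (2 * sqrt (G 2 (cylinder c \<sigma>))) else 0)"
proof -
  let ?x = "cylinder c \<sigma>"
  note gm = diagonal_mult[OF g[OF M(3)]]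
  have t: "partial W (axis a 1) (\<lambda>\<tau>. tangent W (cylinder c) b \<tau> $ i) \<sigma> = 0" for i
  proof -
    have "partial W (axis a 1) (\<lambda>\<tau>. tangent W (cylinder c) b \<tau> $ i) \<sigma> = partial W (axis a 1) (\<lambda>\<tau>. axis (surface_index b) 1 $ i) \<sigma>"
      by (rule partial_cong[OF _ W(3)]) (simp add: tangent_cylinder[OF W(1,2)])
    then show ?thesis by (simp add: partial_const[OF W])
  qed
  have ch: "christoffel M g 2 (surface_index a) (surface_index b) ?x =
     - (if a = b then partial M (axis 2 1) (G (surface_index a)) ?x else 0) / (2 * G 2 ?x)"
    using christoffel_diagonal[where G = G, OF M g G_nz, of 2 "surface_index a" "surface_index b"]
      surface_index_neq[of a, symmetric] surface_index_neq[of b, symmetric] by (simp add: surface_index_inj)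
  have "second_form M g W (cylinder c) n a b \<sigma> =
     - (\<Sum>i\<in>UNIV. G i ?x * n $ i * christoffel M g i (surface_index a) (surface_index b) ?x)"
    unfolding second_form_def t tangent_cylinder[OF W] gm
    by (simp add: axis_nth if_distrib[of "\<lambda>x. _ * x"] cong: if_cong)
  also have "\<dots> = - (G 2 ?x * (1 / sqrt (G 2 ?x)) * christoffel M g 2 (surface_index a) (surface_index b) ?x)"
    by (simp add: n axis_nth if_distrib[of "\<lambda>x. _ * x"] if_distrib[of "\<lambda>x. x * _"] cong: if_cong)
  also have "\<dots> = (if a = b then partial M (axis 2 1) (G (surface_index a)) ?x / (2 * sqrt (G 2 ?x)) else 0)"
    unfolding ch using G2 by simp
  finally show ?thesis .
qed

end

lemma matched_diagonal_iff:
  assumes "\<forall>\<sigma>\<in>W. diagonal_cylinder M\<^sub>1 g\<^sub>1 G\<^sub>1 W c\<^sub>1 \<sigma>" "\<forall>\<sigma>\<in>W. diagonal_cylinder M\<^sub>2 g\<^sub>2 G\<^sub>2 W c\<^sub>2 \<sigma>"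
  shows "matched M\<^sub>1 g\<^sub>1 (cylinder c\<^sub>1) M\<^sub>2 g\<^sub>2 (cylinder c\<^sub>2) W \<longleftrightarrow>
    (\<forall>\<sigma>\<in>W. \<forall>i\<in>{1, 3, 4}. G\<^sub>1 i (cylinder c\<^sub>1 \<sigma>) = G\<^sub>2 i (cylinder c\<^sub>2 \<sigma>) \<and>
      partial M\<^sub>1 (axis 2 1) (G\<^sub>1 i) (cylinder c\<^sub>1 \<sigma>) / sqrt (G\<^sub>1 2 (cylinder c\<^sub>1 \<sigma>)) =
      partial M\<^sub>2 (axis 2 1) (G\<^sub>2 i) (cylinder c\<^sub>2 \<sigma>) / sqrt (G\<^sub>2 2 (cylinder c\<^sub>2 \<sigma>)))"
  unfolding matched_def
proof (intro ball_cong refl, goal_cases)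
  case \<sigma>: (1 \<sigma>)
  interpret A: diagonal_cylinder M\<^sub>1 g\<^sub>1 G\<^sub>1 W c\<^sub>1 \<sigma> using assms(1) \<sigma> by blast
  interpret B: diagonal_cylinder M\<^sub>2 g\<^sub>2 G\<^sub>2 W c\<^sub>2 \<sigma> using assms(2) \<sigma> by blast
  have idx: "(\<forall>i\<in>{1, 3, 4}. P i) \<longleftrightarrow> (\<forall>a. P (surface_index a))" for P
    by (auto simp: forall_3 surface_index_def)
  have "(\<exists>n m. unit_normal g\<^sub>1 W (cylinder c\<^sub>1) \<sigma> n \<and> n $ 2 > 0 \<and> unit_normal g\<^sub>2 W (cylinder c\<^sub>2) \<sigma> m \<and> m $ 2 > 0 \<and>
        (\<forall>a b. second_form M\<^sub>1 g\<^sub>1 W (cylinder c\<^sub>1) n a b \<sigma> = second_form M\<^sub>2 g\<^sub>2 W (cylinder c\<^sub>2) m a b \<sigma>)) \<longleftrightarrow>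
     (\<exists>n m. n = axis 2 (1 / sqrt (G\<^sub>1 2 (cylinder c\<^sub>1 \<sigma>))) \<and> m = axis 2 (1 / sqrt (G\<^sub>2 2 (cylinder c\<^sub>2 \<sigma>))) \<and>
        (\<forall>a b. second_form M\<^sub>1 g\<^sub>1 W (cylinder c\<^sub>1) n a b \<sigma> = second_form M\<^sub>2 g\<^sub>2 W (cylinder c\<^sub>2) m a b \<sigma>))"
    using A.unit_normal_iff B.unit_normal_iff by metis
  also have "\<dots> \<longleftrightarrow> (\<forall>a. partial M\<^sub>1 (axis 2 1) (G\<^sub>1 (surface_index a)) (cylinder c\<^sub>1 \<sigma>) / sqrt (G\<^sub>1 2 (cylinder c\<^sub>1 \<sigma>)) =
      partial M\<^sub>2 (axis 2 1) (G\<^sub>2 (surface_index a)) (cylinder c\<^sub>2 \<sigma>) / sqrt (G\<^sub>2 2 (cylinder c\<^sub>2 \<sigma>)))"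
    by (simp add: A.second_form_eq B.second_form_eq)
      (auto simp: divide_simps)
  finally show ?case
    unfolding idx by (auto simp: A.first_form_eq B.first_form_eq)
qed

section \<open>The exterior spacetime\<close>

lemma exterior_region_eq: "exterior_region \<alpha> r0 \<rho>0 = lift_region (domain_of_dependence \<alpha> r0 \<rho>0)"
  by (simp add: exterior_region_def lift_region_def)

definition interior_base :: "real \<Rightarrow> real \<Rightarrow> (real \<times> real) set" where
  "interior_base \<alpha> r0 = {p. 0 \<le> snd p \<and> snd p \<le> r0 \<and> 0 \<le> fst p \<and> (fst p)\<^sup>2 + (snd p)\<^sup>2 < \<alpha>\<^sup>2}"

lemma interior_region_eq: "interior_region \<alpha> r0 = lift_region (interior_base \<alpha> r0)"
  by (simp add: interior_region_def lift_region_def interior_base_def)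

lemma convex_interior_base:
  assumes "0 < \<alpha>"
  shows "convex (interior_base \<alpha> r0)"
proof -
  have "(a\<^sup>2 + b\<^sup>2 < \<alpha>\<^sup>2) = ((a, b) \<in> ball 0 \<alpha>)" for a b :: real
    using assms by (simp add: norm_Pair real_sqrt_less_iff[symmetric, of _ "\<alpha>\<^sup>2"] del: real_sqrt_less_iff)
  then have "interior_base \<alpha> r0 = {p. (0, 1) \<bullet> p \<ge> 0} \<inter> {p. (0, 1) \<bullet> p \<le> r0} \<inter> {p. (1, 0) \<bullet> p \<ge> 0} \<inter> ball 0 \<alpha>"
    by (auto simp: interior_base_def)
  then show ?thesis
    by (simp add: convex_Int convex_halfspace_ge convex_halfspace_le)
qed

lemma interior_interior_base:
  assumes "0 < r0" "r0 < \<alpha>"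
  shows "interior (interior_base \<alpha> r0) \<noteq> {}"
proof -
  let ?U = "{p::real \<times> real. 0 < snd p \<and> snd p < r0 \<and> 0 < fst p \<and> (fst p)\<^sup>2 + (snd p)\<^sup>2 < \<alpha>\<^sup>2}"
  have "open ?U" by (intro open_Collect_conj open_Collect_less continuous_intros)
  moreover have "?U \<subseteq> interior_base \<alpha> r0" by (auto simp: interior_base_def)
  ultimately have sub: "?U \<subseteq> interior (interior_base \<alpha> r0)" by (intro interior_maximal)
  have "r0\<^sup>2 < \<alpha>\<^sup>2" using assms by (intro power_strict_mono) auto
  then have "r0\<^sup>2 < \<alpha>\<^sup>2 * 2" using zero_le_power2[of \<alpha>] by linarith
  then have "(r0 / 2, r0 / 2) \<in> ?U" using assms by (auto simp: power_divide)
  with sub show ?thesis by blast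
qed

lemma partial_2_lift:
  assumes "convex D" "interior D \<noteq> {}" "C1_grad D f f1 f2" "x \<in> lift_region D" "\<And>y. h y = f (y $ 1, y $ 2)"
  shows "partial (lift_region D) (axis 2 1) h x = f2 (x $ 1, x $ 2)"
proof -
  have "h = (\<lambda>y. f (y $ 1, y $ 2))" using assms(5) by auto
  then show ?thesis using partial_lift[OF assms(1-4), of 2] by simp
qed

lemma cylinder_nth: "cylinder c \<sigma> $ 1 = \<sigma> $ 1" "cylinder c \<sigma> $ 2 = c"
  by (simp_all add: cylinder_def vector_4)

lemma vacuum_algebra:
  fixes r F G p1 p2 p11 p22 q1 q2 q11 q22 :: real
  assumes r: "r \<noteq> 0" and p12: "2 * r * p12 + F * p2 + G * p1 = 0" and q12: "q12 = - (p1 * p2)"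
    and F2: "2 * F * q1 = 2 * r * p1 ^ 2 + F2" and G2: "2 * G * q2 = 2 * r * p2 ^ 2 + G2"
  defines "a1 \<equiv> q1 + q2 - (p1 + p2)" and "a2 \<equiv> q1 - q2 - (p1 - p2)"
    and "a11 \<equiv> q11 + 2 * q12 + q22 - (p11 + 2 * p12 + p22)" and "a22 \<equiv> q11 - 2 * q12 + q22 - (p11 - 2 * p12 + p22)"
    and "b1 \<equiv> 1 / r * (F + G) - (p1 + p2)" and "b2 \<equiv> 1 / r * (F - G) - (p1 - p2)"
    and "b11 \<equiv> - 1 / r\<^sup>2 * (F + G) * (F + G) + 1 / r * (F2 + 2 * 0 + G2) - (p11 + 2 * p12 + p22)"
    and "b12 \<equiv> - 1 / r\<^sup>2 * (F + G) * (F - G) + 1 / r * (F2 - G2) - (p11 - p22)"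
    and "b22 \<equiv> - 1 / r\<^sup>2 * (F - G) * (F - G) + 1 / r * (F2 - 2 * 0 + G2) - (p11 - 2 * p12 + p22)"
    and "c1 \<equiv> p1 + p2" and "c2 \<equiv> p1 - p2"
    and "c11 \<equiv> p11 + 2 * p12 + p22" and "c12 \<equiv> p11 - p22" and "c22 \<equiv> p11 - 2 * p12 + p22"
  shows "a22 - a11 - (b11 + c11) + (b1 + c1) * a1 + (b2 + c2) * a2 = b1 ^ 2 + c1 ^ 2"
    and "a11 - a22 - (b22 + c22) + (b1 + c1) * a1 + (b2 + c2) * a2 = b2 ^ 2 + c2 ^ 2"
    and "(b1 + c1) * a2 + (b2 + c2) * a1 - (b12 + c12) = b1 * b2 + c1 * c2"
    and "b11 - b22 + (b1 + c1) * b1 - (b2 + c2) * b2 = 0"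
    and "c11 - c22 + (b1 + c1) * c1 - (b2 + c2) * c2 = 0"
proof -
  define f g where "f = F / r" and "g = G / r"
  have FG: "F = r * f" "G = r * g" using r by (auto simp: f_def g_def)
  have "2 * r * p12 = r * - (f * p2 + g * p1)" using p12 by (simp add: FG algebra_simps)
  then have p12: "p12 = - (f * p2 + g * p1) / 2" using r by simp
  have "F2 = r * (2 * f * q1 - 2 * p1 ^ 2)" "G2 = r * (2 * g * q2 - 2 * p2 ^ 2)"
    using F2 G2 by (simp_all add: FG algebra_simps)
  then have d: "1 / r * (F + G) = f + g" "1 / r * (F - G) = f - g"
    "- 1 / r\<^sup>2 * (F + G) * (F + G) = - (f + g)\<^sup>2" "- 1 / r\<^sup>2 * (F + G) * (F - G) = - (f + g) * (f - g)"
    "- 1 / r\<^sup>2 * (F - G) * (F - G) = - (f - g)\<^sup>2"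
    "1 / r * (F2 + 2 * 0 + G2) = 2 * f * q1 - 2 * p1 ^ 2 + (2 * g * q2 - 2 * p2 ^ 2)"
    "1 / r * (F2 - 2 * 0 + G2) = 2 * f * q1 - 2 * p1 ^ 2 + (2 * g * q2 - 2 * p2 ^ 2)"
    "1 / r * (F2 - G2) = 2 * f * q1 - 2 * p1 ^ 2 - (2 * g * q2 - 2 * p2 ^ 2)"
    using r by (simp_all add: FG power2_eq_square field_simps)
  show "a22 - a11 - (b11 + c11) + (b1 + c1) * a1 + (b2 + c2) * a2 = b1 ^ 2 + c1 ^ 2"
    "a11 - a22 - (b22 + c22) + (b1 + c1) * a1 + (b2 + c2) * a2 = b2 ^ 2 + c2 ^ 2"
    "(b1 + c1) * a2 + (b2 + c2) * a1 - (b12 + c12) = b1 * b2 + c1 * c2"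
    "b11 - b22 + (b1 + c1) * b1 - (b2 + c2) * b2 = 0"
    "c11 - c22 + (b1 + c1) * c1 - (b2 + c2) * c2 = 0"
    unfolding a1_def a2_def a11_def a22_def b1_def b2_def b11_def b12_def b22_def c1_def c2_def c11_def c12_def c22_def d q12 p12
    by (simp_all add: power2_eq_square field_simps)
qed

lemma matching_algebra:
  fixes u \<psi> \<gamma> R d\<psi> d\<gamma> dR k r :: real
  assumes u: "u > 0" and R: "R > 0" and r: "r > 0"
  shows "(- 1 = - exp (2 * (\<gamma> - \<psi>)) \<and> 0 = - exp (2 * (\<gamma> - \<psi>)) * (2 * (d\<gamma> - d\<psi>)) / sqrt (exp (2 * (\<gamma> - \<psi>))) \<and>
     r\<^sup>2 = R\<^sup>2 * exp (- 2 * \<psi>) \<and> 2 * r = 2 * R * exp (- 2 * \<psi>) * (dR - R * d\<psi>) / sqrt (exp (2 * (\<gamma> - \<psi>))) \<and>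
     u\<^sup>2 = exp (2 * \<psi>) \<and> 2 * u * k = exp (2 * \<psi>) * (2 * d\<psi>) / sqrt (exp (2 * (\<gamma> - \<psi>)))) \<longleftrightarrow>
   (\<gamma> = \<psi> \<and> \<psi> = ln u \<and> R = r * u \<and> d\<gamma> = d\<psi> \<and> d\<psi> = k * inverse u \<and> dR = u + r * k)" (is "?lhs \<longleftrightarrow> ?rhs")
proof (cases "\<gamma> = \<psi> \<and> \<psi> = ln u")
  case True
  then have e: "\<gamma> = \<psi>" "exp \<psi> = u" using u by auto
  then have e2: "exp (2 * \<psi>) = u\<^sup>2" "exp (- 2 * \<psi>) = 1 / u\<^sup>2"
    by (simp_all add: exp_double exp_minus inverse_eq_divide)
  have 1: "r\<^sup>2 = R\<^sup>2 * (1 / u\<^sup>2) \<longleftrightarrow> R = r * u"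
  proof -
    have "r\<^sup>2 = R\<^sup>2 * (1 / u\<^sup>2) \<longleftrightarrow> (r * u)\<^sup>2 = R\<^sup>2" using u by (simp add: field_simps)
    also have "\<dots> \<longleftrightarrow> r * u = R" using u R r by (intro power2_eq_iff_nonneg) auto
    finally show ?thesis by auto
  qed
  have 2: "2 * u * k = u\<^sup>2 * (2 * d\<psi>) \<longleftrightarrow> d\<psi> = k * inverse u"
    using u by (auto simp: power2_eq_square field_simps)
  have 3: "2 * r = 2 * R * (1 / u\<^sup>2) * (dR - R * d\<psi>) \<longleftrightarrow> dR = u + r * k" if "R = r * u" "d\<psi> = k * inverse u"
  proof -
    have x: "2 * r = 2 * (r * u) * (1 / u\<^sup>2) * x \<longleftrightarrow> x = u" for x
      using u r by (auto simp: power2_eq_square field_simps)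
    have "R * d\<psi> = r * k" using that u by simp
    then show ?thesis
      using x[of "dR - R * d\<psi>"] that(1) by auto
  qed
  have "?lhs \<longleftrightarrow> d\<gamma> = d\<psi> \<and> r\<^sup>2 = R\<^sup>2 * (1 / u\<^sup>2) \<and> 2 * r = 2 * R * (1 / u\<^sup>2) * (dR - R * d\<psi>) \<and> 2 * u * k = u\<^sup>2 * (2 * d\<psi>)"
    by (simp only: e(1) e2 diff_self mult_zero_right exp_zero real_sqrt_one div_by_1) auto
  then show ?thesis
    using True 1 2 3 by blast
next
  case False
  have "\<psi> = ln u" if "u\<^sup>2 = exp (2 * \<psi>)"
  proof -
    have "u\<^sup>2 = (exp \<psi>)\<^sup>2" using that by (simp add: exp_double)
    then have "u = exp \<psi>" using u by (simp add: power2_eq_iff_nonneg)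
    then show ?thesis by simp
  qed
  with False show ?thesis by auto
qed

context cylinder_collapse
begin

definition int_diag :: "4 \<Rightarrow> real^4 \<Rightarrow> real" where
  "int_diag i y = (if i = 1 then -1 else if i = 2 then 1 else if i = 3 then (y $ 2)\<^sup>2
     else (1 - ((y $ 1)\<^sup>2 + (y $ 2)\<^sup>2) / \<alpha>\<^sup>2)\<^sup>2)"

definition ext_diag :: "(real \<times> real \<Rightarrow> real) \<Rightarrow> (real \<times> real \<Rightarrow> real) \<Rightarrow> (real \<times> real \<Rightarrow> real) \<Rightarrow> 4 \<Rightarrow> real^4 \<Rightarrow> real" where
  "ext_diag \<psi> \<gamma> S i y = (let p = (y $ 1, y $ 2) in
     if i = 1 then - exp (2 * (\<gamma> p - \<psi> p)) else if i = 2 then exp (2 * (\<gamma> p - \<psi> p))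
     else if i = 3 then (S p)\<^sup>2 * exp (- 2 * \<psi> p) else exp (2 * \<psi> p))"

abbreviation W :: "(real^3) set" where "W \<equiv> surface_params \<alpha> r0"

lemma u_pos: "0 \<le> s \<Longrightarrow> s < L \<Longrightarrow> 1 - (s\<^sup>2 + r0\<^sup>2) / \<alpha>\<^sup>2 > 0"
  using L_sq_minus[of s] alpha_pos by (simp add: L_sq field_simps)

lemma W_iff: "\<sigma> \<in> W \<longleftrightarrow> 0 \<le> \<sigma> $ 1 \<and> \<sigma> $ 1 < L"
  by (simp add: surface_params_def L_def)

lemma W_props: "convex W" "interior W \<noteq> {}"
  using convex_surface_params interior_surface_params L_pos by (auto simp: L_def)

lemma interior_cylinder:
  assumes "\<sigma> \<in> W"
  shows "diagonal_cylinder (interior_region \<alpha> r0) (interior_metric \<alpha>) int_diag W r0 \<sigma>"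
proof
  note s = assms[unfolded W_iff]
  show "convex (interior_region \<alpha> r0)" "interior (interior_region \<alpha> r0) \<noteq> {}"
    unfolding interior_region_eq
    using convex_lift_region[OF convex_interior_base[OF alpha_pos]] interior_lift_region[OF interior_interior_base[OF r0_pos r0_less_alpha]] by auto
  show "cylinder r0 \<sigma> \<in> interior_region \<alpha> r0"
    using s L_sq_minus[of "\<sigma> $ 1"] r0_pos by (auto simp: interior_region_def cylinder_nth L_sq)
  show "interior_metric \<alpha> y $ i $ j = (if i = j then int_diag i y else 0)" for y i j
    using exhaust_4[of i] by (auto simp: interior_metric_def diag4_def vector_4 int_diag_def)
  show "int_diag i (cylinder r0 \<sigma>) \<noteq> 0" for i
    using u_pos[of "\<sigma> $ 1"] s r0_pos by (auto simp: int_diag_def cylinder_nth)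
  show "int_diag 2 (cylinder r0 \<sigma>) > 0" by (simp add: int_diag_def)
qed (use W_props assms in auto)

lemma exterior_cylinder:
  assumes "\<sigma> \<in> W" and S: "\<forall>p\<in>\<D> \<rho>0. S p > 0"
  shows "diagonal_cylinder (exterior_region \<alpha> r0 \<rho>0) (exterior_metric \<psi> \<gamma> S) (ext_diag \<psi> \<gamma> S) W \<rho>0 \<sigma>"
proof
  note s = assms(1)[unfolded W_iff]
  note m = boundary_mem(1)[of "\<sigma> $ 1" \<rho>0]
  show "convex (exterior_region \<alpha> r0 \<rho>0)" "interior (exterior_region \<alpha> r0 \<rho>0) \<noteq> {}"
    unfolding exterior_region_eq
    using convex_lift_region[OF convex_domain_of_dependence] interior_lift_region[OF interior_D] by auto
  show "cylinder \<rho>0 \<sigma> \<in> exterior_region \<alpha> r0 \<rho>0"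
    using s m by (auto simp: exterior_region_def cylinder_nth)
  show "exterior_metric \<psi> \<gamma> S y $ i $ j = (if i = j then ext_diag \<psi> \<gamma> S i y else 0)" for y i j
    using exhaust_4[of i] by (auto simp: exterior_metric_def diag4_def vector_4 ext_diag_def Let_def)
  show "ext_diag \<psi> \<gamma> S i (cylinder \<rho>0 \<sigma>) \<noteq> 0" for i
    using S m s by (auto simp: ext_diag_def cylinder_nth Let_def)
  show "ext_diag \<psi> \<gamma> S 2 (cylinder \<rho>0 \<sigma>) > 0" by (simp add: ext_diag_def Let_def)
qed (use W_props assms in auto)

lemma interior_partials:
  assumes "\<sigma> \<in> W"
  shows "partial (interior_region \<alpha> r0) (axis 2 1) (int_diag 1) (cylinder r0 \<sigma>) = 0"
    "partial (interior_region \<alpha> r0) (axis 2 1) (int_diag 3) (cylinder r0 \<sigma>) = 2 * r0"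
    "partial (interior_region \<alpha> r0) (axis 2 1) (int_diag 4) (cylinder r0 \<sigma>)
      = 2 * (1 - ((\<sigma> $ 1)\<^sup>2 + r0\<^sup>2) / \<alpha>\<^sup>2) * - (2 * r0 / \<alpha>\<^sup>2)"
proof -
  interpret diagonal_cylinder "interior_region \<alpha> r0" "interior_metric \<alpha>" int_diag W r0 \<sigma>
    by (rule interior_cylinder[OF assms])
  let ?B = "interior_base \<alpha> r0"
  note B = convex_interior_base[OF alpha_pos, of r0] interior_interior_base[OF r0_pos r0_less_alpha]
  note x = M(3)[unfolded interior_region_eq]
  show "partial (interior_region \<alpha> r0) (axis 2 1) (int_diag 1) (cylinder r0 \<sigma>) = 0"
    unfolding interior_region_eq
    using partial_2_lift[OF B C1_grad_const[of _ "-1"] x, where h = "int_diag 1"] by (simp add: int_diag_def)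
  have sq: "C1_grad ?B (\<lambda>p. snd p * snd p) (\<lambda>p. 0 * snd p + snd p * 0) (\<lambda>p. 1 * snd p + snd p * 1)"
    by (rule C1_grad_mult[OF C1_grad_snd C1_grad_snd])
  show "partial (interior_region \<alpha> r0) (axis 2 1) (int_diag 3) (cylinder r0 \<sigma>) = 2 * r0"
    unfolding interior_region_eq
    using partial_2_lift[OF B sq x, where h = "int_diag 3"] by (simp add: int_diag_def power2_eq_square cylinder_nth)
  note u = C1_grad_diff[OF C1_grad_const[of ?B 1] C1_grad_mult[OF C1_grad_add[OF C1_grad_mult[OF C1_grad_fst C1_grad_fst] sq] C1_grad_const[of _ "1 / \<alpha>\<^sup>2"]]]
  show "partial (interior_region \<alpha> r0) (axis 2 1) (int_diag 4) (cylinder r0 \<sigma>)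
      = 2 * (1 - ((\<sigma> $ 1)\<^sup>2 + r0\<^sup>2) / \<alpha>\<^sup>2) * - (2 * r0 / \<alpha>\<^sup>2)"
    unfolding interior_region_eq
    using partial_2_lift[OF B C1_grad_mult[OF u u] x, where h = "int_diag 4"] by (simp add: int_diag_def power2_eq_square cylinder_nth)
qed

lemma exterior_partials:
  assumes "\<sigma> \<in> W"
    and "C2_on (\<D> \<rho>0) \<psi>" "C2_on (\<D> \<rho>0) \<gamma>" "C2_on (\<D> \<rho>0) S"
  defines "z \<equiv> (\<sigma> $ 1, \<rho>0)" and "d \<equiv> partial (\<D> \<rho>0) (0, 1)"
  shows "partial (exterior_region \<alpha> r0 \<rho>0) (axis 2 1) (ext_diag \<psi> \<gamma> S 1) (cylinder \<rho>0 \<sigma>) = - exp (2 * (\<gamma> z - \<psi> z)) * (2 * (d \<gamma> z - d \<psi> z))"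
    "partial (exterior_region \<alpha> r0 \<rho>0) (axis 2 1) (ext_diag \<psi> \<gamma> S 3) (cylinder \<rho>0 \<sigma>)
      = 2 * S z * exp (- 2 * \<psi> z) * (d S z - S z * d \<psi> z)"
    "partial (exterior_region \<alpha> r0 \<rho>0) (axis 2 1) (ext_diag \<psi> \<gamma> S 4) (cylinder \<rho>0 \<sigma>) = exp (2 * \<psi> z) * (2 * d \<psi> z)"
proof -
  let ?D = "\<D> \<rho>0"
  note D = convex_domain_of_dependence[of \<alpha> r0 \<rho>0] interior_D
  note g = C2_on_C1_grad(1)[OF assms(2)] C2_on_C1_grad(1)[OF assms(3)] C2_on_C1_grad(1)[OF assms(4)]
  have x: "cylinder \<rho>0 \<sigma> \<in> lift_region ?D"
    using boundary_mem(1)[of "\<sigma> $ 1" \<rho>0] assms(1) by (simp add: lift_region_def cylinder_nth W_iff)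
  have exp: "C1_grad ?D (\<lambda>p. exp (f p)) (\<lambda>p. exp (f p) * f1 p) (\<lambda>p. exp (f p) * f2 p)" if "C1_grad ?D f f1 f2" for f f1 f2
    by (rule C1_grad_compose[where \<phi> = exp and \<phi>' = exp, OF that]) (auto intro!: continuous_intros C1_grad_continuous(1)[OF that])
  note e1 = C1_grad_minus[OF exp[OF C1_grad_mult[OF C1_grad_const[of _ 2] C1_grad_diff[OF g(2,1)]]]]
  note e3 = C1_grad_mult[OF C1_grad_mult[OF g(3) g(3)] exp[OF C1_grad_mult[OF C1_grad_const[of _ "- 2"] g(1)]]]
  note e4 = exp[OF C1_grad_mult[OF C1_grad_const[of _ 2] g(1)]]
  show "partial (exterior_region \<alpha> r0 \<rho>0) (axis 2 1) (ext_diag \<psi> \<gamma> S 1) (cylinder \<rho>0 \<sigma>) = - exp (2 * (\<gamma> z - \<psi> z)) * (2 * (d \<gamma> z - d \<psi> z))"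
    unfolding exterior_region_eq z_def d_def
    using partial_2_lift[OF D e1 x, where h = "ext_diag \<psi> \<gamma> S 1"] by (simp add: ext_diag_def cylinder_nth Let_def)
  show "partial (exterior_region \<alpha> r0 \<rho>0) (axis 2 1) (ext_diag \<psi> \<gamma> S 3) (cylinder \<rho>0 \<sigma>)
      = 2 * S z * exp (- 2 * \<psi> z) * (d S z - S z * d \<psi> z)"
    unfolding exterior_region_eq z_def d_def
    using partial_2_lift[OF D e3 x, where h = "ext_diag \<psi> \<gamma> S 3"] by (simp add: ext_diag_def cylinder_nth Let_def power2_eq_square algebra_simps)
  show "partial (exterior_region \<alpha> r0 \<rho>0) (axis 2 1) (ext_diag \<psi> \<gamma> S 4) (cylinder \<rho>0 \<sigma>) = exp (2 * \<psi> z) * (2 * d \<psi> z)"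
    unfolding exterior_region_eq z_def d_def
    using partial_2_lift[OF D e4 x, where h = "ext_diag \<psi> \<gamma> S 4"] by (simp add: ext_diag_def cylinder_nth Let_def)
qed

lemma matched_iff_boundary_data:
  assumes \<psi>: "C2_on (\<D> \<rho>0) \<psi>" and \<gamma>: "C2_on (\<D> \<rho>0) \<gamma>"
    and S: "C2_on (\<D> \<rho>0) S" and pos: "\<forall>p\<in>\<D> \<rho>0. S p > 0"
  shows "matched_to_exterior \<alpha> r0 \<rho>0 \<psi> \<gamma> S \<longleftrightarrow> boundary_data \<alpha> r0 \<rho>0 \<psi> \<gamma> S"
proof -
  let ?D = "\<D> \<rho>0"
  define P where "P s \<longleftrightarrow> (let p = (s, \<rho>0); u = 1 - (s\<^sup>2 + r0\<^sup>2) / \<alpha>\<^sup>2; k = - (2 * r0 / \<alpha>\<^sup>2) in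
      \<gamma> p = \<psi> p \<and> \<psi> p = ln u \<and> S p = r0 * u \<and> partial ?D (0, 1) \<gamma> p = partial ?D (0, 1) \<psi> p \<and>
      partial ?D (0, 1) \<psi> p = k * inverse u \<and> partial ?D (0, 1) S p = u + r0 * k)" for s
  have int: "\<forall>\<sigma>\<in>W. diagonal_cylinder (interior_region \<alpha> r0) (interior_metric \<alpha>) int_diag W r0 \<sigma>"
    using interior_cylinder by blast
  have ext: "\<forall>\<sigma>\<in>W. diagonal_cylinder (exterior_region \<alpha> r0 \<rho>0) (exterior_metric \<psi> \<gamma> S) (ext_diag \<psi> \<gamma> S) W \<rho>0 \<sigma>"
    using exterior_cylinder pos by blast
  have "matched_to_exterior \<alpha> r0 \<rho>0 \<psi> \<gamma> S \<longleftrightarrow> (\<forall>\<sigma>\<in>W. P (\<sigma> $ 1))"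
    unfolding matched_to_exterior_def matched_diagonal_iff[OF int ext]
  proof (rule ball_cong[OF refl], goal_cases)
    case \<sigma>: (1 \<sigma>)
    then have s: "0 \<le> \<sigma> $ 1" "\<sigma> $ 1 < L" by (auto simp: W_iff)
    have Rp: "S (\<sigma> $ 1, \<rho>0) > 0" using pos boundary_mem(1)[OF s] by blast
    let ?z = "(\<sigma> $ 1, \<rho>0)"
    have vals: "int_diag 1 (cylinder r0 \<sigma>) = -1" "int_diag 2 (cylinder r0 \<sigma>) = 1"
      "int_diag 3 (cylinder r0 \<sigma>) = r0\<^sup>2"
      "int_diag 4 (cylinder r0 \<sigma>) = (1 - ((\<sigma> $ 1)\<^sup>2 + r0\<^sup>2) / \<alpha>\<^sup>2)\<^sup>2"
      "ext_diag \<psi> \<gamma> S 1 (cylinder \<rho>0 \<sigma>) = - exp (2 * (\<gamma> ?z - \<psi> ?z))"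
      "ext_diag \<psi> \<gamma> S 2 (cylinder \<rho>0 \<sigma>) = exp (2 * (\<gamma> ?z - \<psi> ?z))"
      "ext_diag \<psi> \<gamma> S 3 (cylinder \<rho>0 \<sigma>) = (S ?z)\<^sup>2 * exp (- 2 * \<psi> ?z)"
      "ext_diag \<psi> \<gamma> S 4 (cylinder \<rho>0 \<sigma>) = exp (2 * \<psi> ?z)"
      by (simp_all add: int_diag_def ext_diag_def cylinder_nth Let_def)
    have ball: "(\<forall>i\<in>{1, 3, 4::4}. Q i) \<longleftrightarrow> Q 1 \<and> Q 3 \<and> Q 4" for Q by simp
    show ?case
      unfolding P_def Let_def matching_algebra[OF u_pos[OF s] Rp r0_pos, symmetric]
        ball vals interior_partials[OF \<sigma>] exterior_partials[OF \<sigma> \<psi> \<gamma> S] real_sqrt_one div_by_1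
      by blast
  qed
  also have "\<dots> \<longleftrightarrow> (\<forall>s. 0 \<le> s \<and> s < L \<longrightarrow> P s)"
  proof
    assume a: "\<forall>\<sigma>\<in>W. P (\<sigma> $ 1)"
    show "\<forall>s. 0 \<le> s \<and> s < L \<longrightarrow> P s"
    proof (intro allI impI)
      fix s assume "0 \<le> s \<and> s < L"
      then have "(\<chi> i. s) \<in> W" by (simp add: W_iff)
      with a show "P s" by fastforce
    qed
  qed (auto simp: W_iff)
  also have "\<dots> \<longleftrightarrow> boundary_data \<alpha> r0 \<rho>0 \<psi> \<gamma> S"
  proof -
    have k: "1 - (s\<^sup>2 + r0\<^sup>2) / \<alpha>\<^sup>2 + r0 * - (2 * r0 / \<alpha>\<^sup>2) = 1 - (s\<^sup>2 + 3 * r0\<^sup>2) / \<alpha>\<^sup>2" for s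
      using alpha_pos by (simp add: field_simps power2_eq_square)
    have T: "partial ?D (1, 0) \<gamma> (s, \<rho>0) = partial ?D (1, 0) \<psi> (s, \<rho>0)"
      if P: "\<forall>s. 0 \<le> s \<and> s < L \<longrightarrow> P s" and s: "0 \<le> s" "s < L" for s
    proof -
      note d = C1_grad_from_null[of \<alpha> r0, folded L_def, OF C2_on_C1_grad(1)]
      have "\<gamma> (from_null \<rho>0 (s, s)) - \<psi> (from_null \<rho>0 (s, s)) = 0" if "0 \<le> s" "s < L" for s
        using P that boundary_mem(4)[OF that] by (simp add: P_def Let_def)
      from diagonal_derivative_zero[OF C1_grad_diff[OF d[OF \<gamma>] d[OF \<psi>]] this s]
      show ?thesis by (simp add: boundary_mem(4)[OF s] field_simps)
    qed
    show ?thesis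
      unfolding boundary_data_def L_def[symmetric] Let_def
      using T unfolding P_def Let_def k by blast
  qed
  finally show ?thesis .
qed

lemma null_solution_vacuum:
  assumes sol: "null_solution \<psi> \<psi>1 \<psi>2 \<psi>11 \<psi>12 \<psi>22 \<gamma> \<gamma>1 \<gamma>2 \<gamma>11 \<gamma>12 \<gamma>22"
  shows "vacuum (exterior_region \<alpha> r0 \<rho>0) (exterior_metric (\<lambda>z. \<psi> (to_null \<rho>0 z)) (\<lambda>z. \<gamma> (to_null \<rho>0 z)) (\<lambda>z. R (to_null \<rho>0 z)))"
proof -
  let ?D = "\<D> \<rho>0"
  have \<psi>: "C2_grad \<Delta> \<psi> \<psi>1 \<psi>2 \<psi>11 \<psi>12 \<psi>22" and \<gamma>: "C2_grad \<Delta> \<gamma> \<gamma>1 \<gamma>2 \<gamma>11 \<gamma>12 \<gamma>22"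
    using sol by (auto simp: null_solution_def)
  have pos: "\<forall>z\<in>?D. R (to_null \<rho>0 z) > 0" using R_pos D_mem(1) by blast
  note t = D_to_null[OF \<psi>, of \<rho>0] D_to_null[OF \<gamma>, of \<rho>0] D_to_null[OF R_C2, of \<rho>0]
  have ln: "C2_grad ?D (\<lambda>z. ln (h z)) (\<lambda>z. 1 / h z * h1 z) (\<lambda>z. 1 / h z * h2 z)
      (\<lambda>z. (- 1 / (h z)\<^sup>2) * h1 z * h1 z + 1 / h z * h11 z) (\<lambda>z. (- 1 / (h z)\<^sup>2) * h1 z * h2 z + 1 / h z * h12 z)
      (\<lambda>z. (- 1 / (h z)\<^sup>2) * h2 z * h2 z + 1 / h z * h22 z)"
    if h: "C2_grad ?D h h1 h2 h11 h12 h22" and hpos: "\<forall>z\<in>?D. h z > 0" for h h1 h2 h11 h12 h22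
  proof (rule C2_grad_compose[OF h, where \<phi> = ln and \<phi>' = "\<lambda>v. 1 / v" and \<phi>'' = "\<lambda>v. - 1 / v\<^sup>2"])
    have "h z \<noteq> 0" if "z \<in> ?D" for z using hpos that by force
    then show "continuous_on ?D (\<lambda>z. - 1 / (h z)\<^sup>2)"
      using C1_grad_continuous(1)[OF C2_grad_C1_grad(1)[OF h]] by (auto intro!: continuous_intros)
    show "(ln has_real_derivative 1 / h z) (at (h z))" "((\<lambda>v. 1 / v) has_real_derivative - 1 / (h z)\<^sup>2) (at (h z))"
      if "z \<in> ?D" for z
      using bspec[OF hpos that] by (auto intro!: derivative_eq_intros simp: power2_eq_square)
  qed
  have alg: "2 * R w * \<psi>12 w + f1 (fst w) * \<psi>2 w + g1 (snd w) * \<psi>1 w = 0" "\<gamma>12 w = - (\<psi>1 w * \<psi>2 w)"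
    "2 * f1 (fst w) * \<gamma>1 w = 2 * R w * \<psi>1 w ^ 2 + f2 (fst w)" "2 * g1 (snd w) * \<gamma>2 w = 2 * R w * \<psi>2 w ^ 2 + g2 (snd w)"
    "R w \<noteq> 0" if "w \<in> \<Delta>" for w
    using sol that R_pos[OF that] by (auto simp: null_solution_def)
  note a = C2_grad_diff[OF t(2) t(1)] and b = C2_grad_diff[OF ln[OF t(3) pos] t(1)]
  show ?thesis
    unfolding exterior_region_eq
  proof (rule vacuum_if[OF convex_domain_of_dependence interior_D a b t(1)], goal_cases)
    case (1 y)
    then have "R (to_null \<rho>0 (y $ 1, y $ 2)) > 0" using pos by (simp add: lift_region_def)
    then have "(R (to_null \<rho>0 (y $ 1, y $ 2)))\<^sup>2 * exp (- 2 * \<psi> (to_null \<rho>0 (y $ 1, y $ 2)))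
        = exp (2 * (ln (R (to_null \<rho>0 (y $ 1, y $ 2))) - \<psi> (to_null \<rho>0 (y $ 1, y $ 2))))"
      by (simp add: right_diff_distrib exp_diff exp_double exp_minus inverse_eq_divide)
    then show ?case
      by (simp add: exterior_metric_def Let_def)
  next
    case (2 z)
    show ?case using vacuum_algebra(1)[OF alg(5,1,2,3,4)[OF D_mem(1)[OF 2]]] .
  next
    case (3 z)
    show ?case using vacuum_algebra(2)[OF alg(5,1,2,3,4)[OF D_mem(1)[OF 3]]] .
  next
    case (4 z)
    show ?case using vacuum_algebra(3)[OF alg(5,1,2,3,4)[OF D_mem(1)[OF 4]]] .
  next
    case (5 z)
    show ?case using vacuum_algebra(4)[OF alg(5,1,2,3,4)[OF D_mem(1)[OF 5]]] .
  next
    case (6 z)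
    show ?case using vacuum_algebra(5)[OF alg(5,1,2,3,4)[OF D_mem(1)[OF 6]]] .
  qed
qed

end

theorem theorem2:
  fixes \<alpha> r\<^sub>0 \<rho>\<^sub>0 :: real and D :: "(real \<times> real) set"
  assumes "D = domain_of_dependence \<alpha> r\<^sub>0 \<rho>\<^sub>0"
    and "\<alpha> > 0" and "0 < r\<^sub>0" and "r\<^sub>0 < \<alpha> / sqrt 3"
  shows
    "(\<forall>\<psi> \<gamma> R. C2_on D \<psi> \<and> C2_on D \<gamma> \<and> C2_on D R \<and> (\<forall>p\<in>D. R p > 0) \<longrightarrow>
        (matched_to_exterior \<alpha> r\<^sub>0 \<rho>\<^sub>0 \<psi> \<gamma> R \<longleftrightarrow> boundary_data \<alpha> r\<^sub>0 \<rho>\<^sub>0 \<psi> \<gamma> R)) \<and>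
     (\<exists>\<psi> \<gamma> R.
        C2_on D \<psi> \<and> C2_on D \<gamma> \<and> C2_on D R \<and> (\<forall>p\<in>D. R p > 0) \<and>
        boundary_data \<alpha> r\<^sub>0 \<rho>\<^sub>0 \<psi> \<gamma> R \<and> field_equations D \<psi> \<gamma> R \<and>
        matched_to_exterior \<alpha> r\<^sub>0 \<rho>\<^sub>0 \<psi> \<gamma> R \<and>
        vacuum (exterior_region \<alpha> r\<^sub>0 \<rho>\<^sub>0) (exterior_metric \<psi> \<gamma> R) \<and>
        (\<forall>\<psi>' \<gamma>' R'.
           C2_on D \<psi>' \<and> C2_on D \<gamma>' \<and> C2_on D R' \<and>
           boundary_data \<alpha> r\<^sub>0 \<rho>\<^sub>0 \<psi>' \<gamma>' R' \<and> field_equations D \<psi>' \<gamma>' R' \<longrightarrow>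
           (\<forall>p\<in>D. \<psi>' p = \<psi> p \<and> \<gamma>' p = \<gamma> p \<and> R' p = R p)))"
proof -
  interpret S: cylinder_collapse \<alpha> r\<^sub>0
    using assms by unfold_locales
  obtain \<psi> \<psi>1 \<psi>2 \<psi>11 \<psi>12 \<psi>22 \<gamma> \<gamma>1 \<gamma>2 \<gamma>11 \<gamma>12 \<gamma>22
    where sol: "S.null_solution \<psi> \<psi>1 \<psi>2 \<psi>11 \<psi>12 \<psi>22 \<gamma> \<gamma>1 \<gamma>2 \<gamma>11 \<gamma>12 \<gamma>22"
    using S.null_solution_exists by blast
  then have \<psi>: "C2_grad S.\<Delta> \<psi> \<psi>1 \<psi>2 \<psi>11 \<psi>12 \<psi>22" and \<gamma>: "C2_grad S.\<Delta> \<gamma> \<gamma>1 \<gamma>2 \<gamma>11 \<gamma>12 \<gamma>22"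
    by (auto simp: S.null_solution_def)
  define \<psi>\<^sub>D where "\<psi>\<^sub>D = (\<lambda>z. \<psi> (to_null \<rho>\<^sub>0 z))"
  define \<gamma>\<^sub>D where "\<gamma>\<^sub>D = (\<lambda>z. \<gamma> (to_null \<rho>\<^sub>0 z))"
  define R\<^sub>D where "R\<^sub>D = (\<lambda>z. S.R (to_null \<rho>\<^sub>0 z))"
  note defs = \<psi>\<^sub>D_def[symmetric] \<gamma>\<^sub>D_def[symmetric] R\<^sub>D_def[symmetric]
  have C2: "C2_on D \<psi>\<^sub>D" "C2_on D \<gamma>\<^sub>D" "C2_on D R\<^sub>D"
    using S.D_C2_on[OF S.D_to_null[OF \<psi>]] S.D_C2_on[OF S.D_to_null[OF \<gamma>]] S.D_C2_on[OF S.D_to_null[OF S.R_C2]]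
    unfolding assms(1) \<psi>\<^sub>D_def \<gamma>\<^sub>D_def R\<^sub>D_def by auto
  have pos: "\<forall>p\<in>D. R\<^sub>D p > 0"
    using S.R_pos S.D_mem(1) unfolding assms(1) R\<^sub>D_def by blast
  have b: "boundary_data \<alpha> r\<^sub>0 \<rho>\<^sub>0 \<psi>\<^sub>D \<gamma>\<^sub>D R\<^sub>D"
    using S.null_solution_boundary_data[OF sol, of \<rho>\<^sub>0] unfolding defs .
  have e: "field_equations D \<psi>\<^sub>D \<gamma>\<^sub>D R\<^sub>D"
    using S.null_solution_field_equations[OF sol, of \<rho>\<^sub>0] unfolding defs assms(1) .
  have v: "vacuum (exterior_region \<alpha> r\<^sub>0 \<rho>\<^sub>0) (exterior_metric \<psi>\<^sub>D \<gamma>\<^sub>D R\<^sub>D)"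
    using S.null_solution_vacuum[OF sol, of \<rho>\<^sub>0] unfolding defs .
  have match: "matched_to_exterior \<alpha> r\<^sub>0 \<rho>\<^sub>0 \<psi> \<gamma> R \<longleftrightarrow> boundary_data \<alpha> r\<^sub>0 \<rho>\<^sub>0 \<psi> \<gamma> R"
    if "C2_on D \<psi>" "C2_on D \<gamma>" "C2_on D R" "\<forall>p\<in>D. R p > 0" for \<psi> \<gamma> R
    using S.matched_iff_boundary_data that unfolding assms(1) by blast
  have unique: "\<psi>' p = \<psi>\<^sub>D p \<and> \<gamma>' p = \<gamma>\<^sub>D p \<and> R' p = R\<^sub>D p"
    if "C2_on D \<psi>'" "C2_on D \<gamma>'" "C2_on D R'" "boundary_data \<alpha> r\<^sub>0 \<rho>\<^sub>0 \<psi>' \<gamma>' R'" "field_equations D \<psi>' \<gamma>' R'" "p \<in> D"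
    for \<psi>' \<gamma>' R' p
    using S.exterior_unique[of \<rho>\<^sub>0 \<psi>\<^sub>D \<psi>' \<gamma>\<^sub>D \<gamma>' R' p] that C2 b e unfolding R\<^sub>D_def assms(1) by blast
  show ?thesis
    using match C2 pos b e v unique by blast
qed

end
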